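(* Let $K$ and $K'$ be affine Cantor sets in $\mathbb{R}$, given as the attractors of iterated function systems $\{F_i(x)=r_ix+t_i\}_{i=1}^{M}$ and $\{F'_j(x)=r'_jx+t'_j\}_{j=1}^{N}$ respectively. Then: (1) The box dimension of $K-K'$ exists and equals its Hausdorff dimension, $BD(K-K')=HD(K-K')=:s$, and $H^s(K-K')<\infty$. (2) If, in addition, $HD(K)+HD(K')\le 1$, $r_i>0$ for all $i$ and $r'_j>0$ for all $j$, and $\frac{\log r_i}{\log r'_j}\notin\mathbb{Q}$ for at least one pair $(i,j)$, then there exists a dense subset $D\subset\mathbb{R}$ such that $H^s(K-\lambda K')=0$ for all $\lambda\in D$, where $s=HD(K-K')$ is as in (1).
   Context: Affine Cantor set: $K$ is the attractor (unique nonempty compact set with $K=\bigcup_{i=1}^M F_i(K)$) of an iterated function system $\{F_i(x)=r_ix+t_i\}_{i=1}^{M}$ on $\mathbb{R}$ with $M\ge 2$, $0<|r_i|<1$ (the $r_i$ may be negative), where the convex hull of $K$ is $[0,a]$ with $a>0$ and the intervals $F_i([0,a])$, $1\le i\le M$, are pairwise disjoint. Likewise $K'$ is the attractor of $\{F'_j(x)=r'_jx+t'_j\}_{j=1}^{N}$ with $N\ge2$, $0<|r'_j|<1$, convex hull $[0,b]$ with $b>0$, and pairwise disjoint intervals $F'_j([0,b])$. For $\lambda\in\mathbb{R}$, $K-\lambda K':=\{x-\lambda y : x\in K,\ y\in K'\}$. $BD$, $HD$ and $H^s$ denote box dimension, Hausdorff dimension and $s$-dimensional Hausdorff measure. *)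

theory Defs
  imports "HOL-Analysis.Analysis"
begin

text \<open>
  The contribution of a set to a Hausdorff sum is \<open>(diam U)\<^sup>s\<close>, with the usual conventions that the
  empty set contributes \<open>0\<close> and that \<open>0\<^sup>0 = 1\<close> for nonempty sets, so that the measure for \<open>s = 0\<close>
  is the counting measure. The case distinction is needed because \<open>0 powr 0 = 0\<close>.
\<close>
definition diam_powr :: "real \<Rightarrow> 'a::metric_space set \<Rightarrow> ennreal" where
  "diam_powr s U =
     (if U = {} then 0 else if s = 0 then 1 else ennreal (diameter U powr s))"

text \<open>
  Boundedness is required explicitly because the library's \<^const>\<open>diameter\<close> is a real number,
  which carries no information for unbounded sets.
\<close>
definition hausdorff_premeasure :: "real \<Rightarrow> real \<Rightarrow> 'a::metric_space set \<Rightarrow> ennreal" where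
  "hausdorff_premeasure s \<delta> A =
     (INF U \<in> {U :: nat \<Rightarrow> 'a set. A \<subseteq> (\<Union>n. U n) \<and> (\<forall>n. bounded (U n) \<and> diameter (U n) \<le> \<delta>)}.
        \<Sum>n. diam_powr s (U n))"

definition hausdorff_measure :: "real \<Rightarrow> 'a::metric_space set \<Rightarrow> ennreal" where
  "hausdorff_measure s A = (SUP \<delta> \<in> {0<..}. hausdorff_premeasure s \<delta> A)"

text \<open>
  On the real line the \<open>s\<close>-dimensional measure vanishes identically for \<open>s > 1\<close>, so the infimum
  is over a nonempty set that is bounded below.
\<close>
definition hausdorff_dim :: "real set \<Rightarrow> real" where
  "hausdorff_dim A = Inf {s. 0 \<le> s \<and> hausdorff_measure s A = 0}"

text \<open>Meaningful for totally bounded \<open>A\<close> and \<open>\<delta> > 0\<close>, when such a finite cover exists.\<close>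
definition covering_number :: "real \<Rightarrow> 'a::metric_space set \<Rightarrow> nat" where
  "covering_number \<delta> A =
     (LEAST n. \<exists>C. finite C \<and> card C = n \<and> A \<subseteq> \<Union>C \<and> (\<forall>U\<in>C. bounded U \<and> diameter U \<le> \<delta>))"

text \<open>The box dimension of the (nonempty, totally bounded) set \<open>A\<close> exists and equals \<open>d\<close>.\<close>
definition has_box_dim :: "'a::metric_space set \<Rightarrow> real \<Rightarrow> bool" where
  "has_box_dim A d \<longleftrightarrow>
     ((\<lambda>\<delta>. ln (real (covering_number \<delta> A)) / (- ln \<delta>)) \<longlongrightarrow> d) (at_right 0)"

definition is_attractor :: "nat \<Rightarrow> (nat \<Rightarrow> real) \<Rightarrow> (nat \<Rightarrow> real) \<Rightarrow> real set \<Rightarrow> bool" where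
  "is_attractor M r t K \<longleftrightarrow>
     K \<noteq> {} \<and> compact K \<and> K = (\<Union>i\<in>{1..M}. (\<lambda>x. r i * x + t i) ` K)"

definition affine_cantor_set ::
    "nat \<Rightarrow> (nat \<Rightarrow> real) \<Rightarrow> (nat \<Rightarrow> real) \<Rightarrow> real \<Rightarrow> real set \<Rightarrow> bool" where
  "affine_cantor_set M r t a K \<longleftrightarrow>
     2 \<le> M \<and> (\<forall>i\<in>{1..M}. 0 < \<bar>r i\<bar> \<and> \<bar>r i\<bar> < 1) \<and>
     is_attractor M r t K \<and>
     0 < a \<and> convex hull K = {0..a} \<and>
     disjoint_family_on (\<lambda>i. (\<lambda>x. r i * x + t i) ` {0..a}) {1..M}"

definition scaled_difference :: "real \<Rightarrow> real set \<Rightarrow> real set \<Rightarrow> real set" where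
  "scaled_difference c K K' = {x - c * y | x y. x \<in> K \<and> y \<in> K'}"

abbreviation arith_difference :: "real set \<Rightarrow> real set \<Rightarrow> real set" where
  "arith_difference K K' \<equiv> scaled_difference 1 K K'"

end

theory Submission
  imports Defs
begin

text \<open>
  Let \<open>\<sigma>\<^sub>1\<close> and \<open>\<sigma>\<^sub>2\<close> be the similarity dimensions of \<open>K\<close> and \<open>K'\<close>, the solutions of
  \<open>\<Sum>\<bar>r i\<bar>\<^sup>s = 1\<close> and \<open>\<Sum>\<bar>r' j\<bar>\<^sup>s = 1\<close>. All sets are measured by finite covers with balls, where a ball of
  radius \<open>e\<close> costs \<open>e\<^sup>s\<close>. If \<open>K - K'\<close> has \<open>\<delta>\<close>-nets with \<open>O(\<delta>\<^sup>-\<^sup>s)\<close> points for its own Hausdorff dimension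
  \<open>s\<close>, then its box dimension is \<open>s\<close> and its \<open>s\<close>-dimensional measure is finite
  (\<open>has_box_dim_hausdorff_dim\<close>, \<open>hausdorff_measure_finite\<close>). Part (1) is therefore a question about nets.
  Lower bounds for dimensions all come from one blow-up principle, \<open>self_reproducing_cover_bound\<close>: if
  sets contain sufficiently many separated copies of one another, a cheap cover could be split and
  magnified until it consists of a large ball, which is not cheap.

  Two cylinders, of ratios \<open>\<rho>\<close> in \<open>K\<close> and \<open>\<rho>'\<close> in \<open>K'\<close>, contribute to \<open>K - c K'\<close> a copy of
  \<open>K - (c \<rho>'/\<rho>) K'\<close> scaled by \<open>\<rho>\<close>. What matters is how the parameter moves.

  \<^item> Suppose all quotients \<open>ln \<bar>r i\<bar> / ln \<bar>r' j\<bar>\<close> are rational. In a bounded window the parameter takes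
    only finitely many values and can be brought back to \<open>1\<close> by words of bounded length. So every
    ball centred in \<open>K - K'\<close> contains a copy of \<open>K - K'\<close> of comparable size, and too many
    separated points would raise the dimension (\<open>net_bounded_difference_commensurable\<close>).

  \<^item> Suppose one quotient is irrational. Then the dimension is \<open>min 1 (\<sigma>\<^sub>1 + \<sigma>\<^sub>2)\<close>, and the net bound is
    that of a product or of an interval. For the lower bound, which is a theorem of Peres and Shmerkin,
    both systems are replaced by subsystems with a single contraction ratio, still incommensurable.
    Under successive magnifications the logarithm of the parameter then follows an
    irrational rotation. Two cells of \<open>K \<times> K'\<close> have overlapping projections only for
    parameters in a short interval, which the rotation visits rarely; so on average few pairs overlap
    (\<open>average_close_pairs\<close>), the projections have many separated pieces, and the blow-up principle
    applies (\<open>difference_cover_bound\<close>, \<open>hausdorff_dim_difference_ge\<close>).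

  In part (2) the assumption gives \<open>\<sigma>\<^sub>1 + \<sigma>\<^sub>2 \<le> 1\<close> and hence \<open>s = \<sigma>\<^sub>1 + \<sigma>\<^sub>2\<close>. The content of \<open>K - c K'\<close>,
  divided by \<open>\<bar>c\<bar>\<close> to the power \<open>\<sigma>\<^sub>2\<close>, is an upper semicontinuous function of \<open>c\<close> that is bounded by its own
  average over the parameters reached by magnification. Such a function is constant, by the maximum principle
  and the density of the orbits. At parameters where two cylinder pairs have exactly the same
  projection, it is strictly smaller than its maximum unless it vanishes. So it vanishes for
  all \<open>c \<noteq> 0\<close> (\<open>content_difference_eq_0\<close>), and \<open>D\<close> can be taken to be the set of nonzero numbers.
\<close>

section \<open>Finite covers, Hausdorff measure and box dimension\<close>

text \<open>
  Finite lists of pairs (centre, radius) replace the countable covers of the Hausdorff measure.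
  Lists are convenient because a list can be filtered and rescaled entry by entry without caring
  about repetitions; compactness makes finite covers sufficient.
\<close>
definition ball_cover :: "real set \<Rightarrow> (real \<times> real) list \<Rightarrow> bool" where
  "ball_cover A L \<longleftrightarrow> (\<forall>q\<in>set L. 0 < snd q) \<and> A \<subseteq> (\<Union>q\<in>set L. ball (fst q) (snd q))"

definition cover_cost :: "real \<Rightarrow> (real \<times> real) list \<Rightarrow> real" where
  "cover_cost s L = (\<Sum>q\<leftarrow>L. snd q powr s)"

lemma cover_cost_nonneg [simp]: "0 \<le> cover_cost s L"
  unfolding cover_cost_def by (rule sum_list_nonneg) auto

lemma cover_cost_Cons: "cover_cost s (q # L) = snd q powr s + cover_cost s L"
  by (simp add: cover_cost_def)

lemma member_le_cover_cost: "q \<in> set L \<Longrightarrow> snd q powr s \<le> cover_cost s L"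
  unfolding cover_cost_def by (rule member_le_sum_list) auto

lemma ball_cover_of_net:
  assumes "finite S" "A \<subseteq> (\<Union>x\<in>S. cball x \<delta>)" "0 < \<delta>"
  obtains L where "ball_cover A L" "cover_cost s L = real (card S) * (2*\<delta>) powr s"
    "\<forall>q\<in>set L. snd q = 2*\<delta>"
proof -
  obtain xs where xs: "set xs = S" "distinct xs"
    using assms(1) finite_distinct_list by blast
  \<comment> \<open>The radius is doubled because nets use closed balls and covers open ones.\<close>
  define L where "L = map (\<lambda>x. (x, 2*\<delta>)) xs"
  have "cball x \<delta> \<subseteq> ball x (2*\<delta>)" for x :: real
    using assms(3) by auto
  then have "ball_cover A L"
    using assms(2,3) xs(1) unfolding ball_cover_def L_def by (auto dest!: subsetD)
  moreover have "cover_cost s L = real (card S) * (2*\<delta>) powr s"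
    using distinct_card[OF xs(2)] xs
    by (simp add: cover_cost_def L_def o_def sum_list_triv)
  moreover have "\<forall>q\<in>set L. snd q = 2*\<delta>"
    by (auto simp: L_def)
  ultimately show ?thesis using that by blast
qed

lemma hausdorff_premeasure_le_cover_cost:
  assumes "ball_cover A L" "\<forall>q\<in>set L. 2 * snd q \<le> \<delta>" "0 \<le> \<delta>"
  shows "hausdorff_premeasure s \<delta> A \<le> ennreal (2 powr s * cover_cost s L)"
proof -
  define U where "U n = (if n < length L then ball (fst (L!n)) (snd (L!n)) else {})" for n
  have pos: "0 < snd (L!n)" if "n < length L" for n
    using assms(1) that by (auto simp: ball_cover_def)
  have "A \<subseteq> (\<Union>n. U n)"
  proof
    fix x assume "x \<in> A"
    then obtain q where "q \<in> set L" "x \<in> ball (fst q) (snd q)"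
      using assms(1) by (auto simp: ball_cover_def)
    then obtain n where "n < length L" "x \<in> U n"
      by (auto simp: U_def in_set_conv_nth)
    then show "x \<in> (\<Union>n. U n)" by blast
  qed
  moreover have "bounded (U n) \<and> diameter (U n) \<le> \<delta>" for n
    using assms pos[of n] by (auto simp: U_def)
  ultimately have "hausdorff_premeasure s \<delta> A \<le> (\<Sum>n. diam_powr s (U n))"
    unfolding hausdorff_premeasure_def by (intro INF_lower) auto
  also have "(\<Sum>n. diam_powr s (U n)) = (\<Sum>n<length L. diam_powr s (U n))"
    by (rule suminf_finite) (auto simp: U_def diam_powr_def)
  also have "\<dots> = (\<Sum>n<length L. ennreal ((2 * snd (L!n)) powr s))"
    by (rule sum.cong) (use pos in \<open>force simp: U_def diam_powr_def\<close>)+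
  also have "\<dots> = ennreal (\<Sum>n<length L. (2 * snd (L!n)) powr s)"
    by (simp add: sum_ennreal)
  also have "(\<Sum>n<length L. (2 * snd (L!n)) powr s) = (\<Sum>n<length L. 2 powr s * (snd (L!n) powr s))"
    by (rule sum.cong) (use pos in \<open>force simp: powr_mult\<close>)+
  also have "\<dots> = 2 powr s * cover_cost s L"
    by (simp add: cover_cost_def sum_list_sum_nth sum_distrib_left atLeast0LessThan)
  finally show ?thesis .
qed

text \<open>
  A cover of small total cost consists of small balls, since each single ball costs no more than the
  total. This is why the mesh restriction \<open>\<delta>\<close> of the premeasure can be ignored when the
  measure is to be shown to vanish; for \<open>s = 0\<close> the argument breaks down.
\<close>
lemma hausdorff_measure_eq_0I:
  assumes "0 < s" and small: "\<And>\<epsilon>. 0 < \<epsilon> \<Longrightarrow> \<exists>L. ball_cover A L \<and> cover_cost s L < \<epsilon>"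
  shows "hausdorff_measure s A = 0"
proof -
  have "hausdorff_premeasure s \<delta> A = 0" if "0 < \<delta>" for \<delta>
  proof -
    have "hausdorff_premeasure s \<delta> A \<le> 0 + ennreal \<epsilon>" if "0 < \<epsilon>" for \<epsilon>
    proof -
      obtain L where L: "ball_cover A L" "cover_cost s L < min (\<epsilon> / 2 powr s) ((\<delta>/2) powr s)"
        using small[of "min (\<epsilon> / 2 powr s) ((\<delta>/2) powr s)"] \<open>0 < \<epsilon>\<close> \<open>0 < \<delta>\<close> by auto
      have "2 * snd q \<le> \<delta>" if "q \<in> set L" for q
      proof (rule ccontr)
        assume "\<not> ?thesis"
        then have "(\<delta>/2) powr s \<le> snd q powr s"
          using \<open>0 < \<delta>\<close> \<open>0 < s\<close> by (intro powr_mono2) auto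
        then show False using member_le_cover_cost[OF that, of s] L by simp
      qed
      then have "hausdorff_premeasure s \<delta> A \<le> ennreal (2 powr s * cover_cost s L)"
        using L \<open>0 < \<delta>\<close> by (intro hausdorff_premeasure_le_cover_cost) auto
      also have "\<dots> \<le> ennreal \<epsilon>"
        using L by (intro ennreal_leI) (simp add: field_simps)
      finally show ?thesis by simp
    qed
    then have "hausdorff_premeasure s \<delta> A \<le> 0"
      by (rule ennreal_le_epsilon)
    then show ?thesis by simp
  qed
  then show ?thesis unfolding hausdorff_measure_def by (simp add: SUP_eq_const)
qed

text \<open>
  The converse for compact sets: the sets of a nearly optimal countable cover are enlarged to open
  balls at a total extra cost below \<open>c/2\<close>, and finitely many of these balls suffice.
\<close>
lemma hausdorff_measure_neq_0:
  assumes "compact A" "0 \<le> s" "0 < c" and lower: "\<And>L. ball_cover A L \<Longrightarrow> c \<le> cover_cost s L"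
  shows "hausdorff_measure s A \<noteq> 0"
proof
  assume "hausdorff_measure s A = 0"
  then have "hausdorff_premeasure s 1 A \<le> 0"
    unfolding hausdorff_measure_def by (metis SUP_upper greaterThan_iff zero_less_one)
  then have "hausdorff_premeasure s 1 A < ennreal (c/2)"
    using assms(3) by (simp add: order_le_less_trans)
  then obtain U :: "nat \<Rightarrow> real set" where U: "A \<subseteq> (\<Union>n. U n)" "\<And>n. bounded (U n)"
    and sum: "(\<Sum>n. diam_powr s (U n)) < ennreal (c/2)"
    unfolding hausdorff_premeasure_def INF_less_iff by auto
  have ex: "\<exists>q. U n \<subseteq> ball (fst q) (snd q) \<and> 0 < snd q \<and>
      ennreal (snd q powr s) \<le> diam_powr s (U n) + ennreal (c/4 * (1/2)^n)" if ne: "U n \<noteq> {}" for n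
  proof -
    define d where "d = diameter (U n)"
    have "0 \<le> d" using U(2) by (simp add: d_def diameter_ge_0)
    obtain p where "p \<in> U n" using ne by blast
    have sub: "U n \<subseteq> ball p e" if "d < e" for e
      using diameter_bounded_bound[OF U(2) \<open>p \<in> U n\<close>] that unfolding d_def by fastforce
    show ?thesis
    proof (cases "s = 0")
      case True
      then show ?thesis using sub[of "d+1"] \<open>0 \<le> d\<close> ne
        by (intro exI[of _ "(p, d+1)"]) (auto simp: diam_powr_def)
    next
      case False
      \<comment> \<open>The radius for which the enlarged set costs exactly \<open>c/4 * (1/2)^n\<close> more.\<close>
      define e where "e = (d powr s + c/4 * (1/2)^n) powr (1/s)"
      have "d = (d powr s) powr (1/s)"
        using False \<open>0 \<le> d\<close> by (simp add: powr_powr)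
      also have "\<dots> < e"
        unfolding e_def using False assms by (intro powr_less_mono2) auto
      finally have "d < e" .
      have "e powr s = d powr s + c/4 * (1/2)^n"
        using False assms(3) unfolding e_def by (simp add: powr_powr)
      then have "ennreal (e powr s) = diam_powr s (U n) + ennreal (c/4 * (1/2)^n)"
        using False ne assms(3) by (simp add: diam_powr_def d_def flip: ennreal_plus)
      then show ?thesis using sub[OF \<open>d < e\<close>] \<open>d < e\<close> \<open>0 \<le> d\<close>
        by (intro exI[of _ "(p, e)"]) auto
    qed
  qed
  then obtain q where q: "\<And>n. U n \<noteq> {} \<Longrightarrow> U n \<subseteq> ball (fst (q n)) (snd (q n)) \<and> 0 < snd (q n) \<and>
      ennreal (snd (q n) powr s) \<le> diam_powr s (U n) + ennreal (c/4 * (1/2)^n)"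
    by metis
  have "A \<subseteq> (\<Union>n\<in>{n. U n \<noteq> {}}. ball (fst (q n)) (snd (q n)))"
  proof
    fix x assume "x \<in> A"
    then obtain n where "x \<in> U n" using U(1) by blast
    then show "x \<in> (\<Union>n\<in>{n. U n \<noteq> {}}. ball (fst (q n)) (snd (q n)))" using q[of n] by blast
  qed
  then obtain I where I: "I \<subseteq> {n. U n \<noteq> {}}" "finite I" "A \<subseteq> (\<Union>n\<in>I. ball (fst (q n)) (snd (q n)))"
    using compactE_image[OF assms(1), of "{n. U n \<noteq> {}}" "\<lambda>n. ball (fst (q n)) (snd (q n))"] by auto
  obtain xs where xs: "set xs = I" "distinct xs"
    using I(2) finite_distinct_list by blast
  have "ball_cover A (map q xs)"
    using I q xs by (auto simp: ball_cover_def)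
  then have "ennreal c \<le> ennreal (cover_cost s (map q xs))"
    by (intro ennreal_leI lower)
  also have "cover_cost s (map q xs) = (\<Sum>n\<in>I. snd (q n) powr s)"
    using xs by (simp add: cover_cost_def o_def sum_list_distinct_conv_sum_set)
  also have "ennreal \<dots> = (\<Sum>n\<in>I. ennreal (snd (q n) powr s))"
    by (simp add: sum_ennreal)
  also have "\<dots> \<le> (\<Sum>n\<in>I. diam_powr s (U n) + ennreal (c/4 * (1/2)^n))"
    using I q by (intro sum_mono) auto
  also have "\<dots> = (\<Sum>n\<in>I. diam_powr s (U n)) + ennreal (\<Sum>n\<in>I. c/4 * (1/2)^n)"
    using assms(3) by (simp add: sum.distrib sum_ennreal)
  also have "\<dots> \<le> (\<Sum>n. diam_powr s (U n)) + ennreal (c/2)"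
  proof (intro add_mono sum_le_suminf I ennreal_leI)
    have "(\<Sum>n\<in>I. (1/2)^n) \<le> (\<Sum>n. (1/2)^n :: real)"
      by (rule sum_le_suminf) (use I in auto)
    then have "(\<Sum>n\<in>I. (1/2)^n) \<le> (2::real)"
      by (simp add: suminf_geometric)
    then have "c/4 * (\<Sum>n\<in>I. (1/2)^n) \<le> c/4 * 2"
      using assms(3) by (intro mult_left_mono) auto
    then show "(\<Sum>n\<in>I. c/4 * (1/2)^n) \<le> c/2"
      by (simp add: sum_distrib_left)
  qed auto
  also have "\<dots> = ennreal (c/2) + (\<Sum>n. diam_powr s (U n))"
    by (rule add.commute)
  also have "\<dots> < ennreal (c/2) + ennreal (c/2)"
    using sum by (subst ennreal_add_left_cancel_less) simp
  also have "\<dots> = ennreal c"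
    using assms(3) by (simp flip: ennreal_plus)
  finally show False by simp
qed

text \<open>
  The set has \<open>\<delta>\<close>-nets with \<open>O(\<delta>\<^sup>-\<^sup>s)\<close> points at all scales, which is the upper box
  dimension bound without a loss of \<open>\<epsilon>\<close> in the exponent. Exactly this uniform form is what gives
  finite \<open>s\<close>-dimensional measure.
\<close>
definition net_bounded :: "real \<Rightarrow> real set \<Rightarrow> bool" where
  "net_bounded s A \<longleftrightarrow> (\<exists>C. \<forall>\<delta>\<in>{0<..1}. \<exists>S. finite S \<and> real (card S) \<le> C * \<delta> powr (-s) \<and>
     A \<subseteq> (\<Union>x\<in>S. cball x \<delta>))"

lemma net_bounded_one:
  assumes "bounded (A :: real set)"
  shows "net_bounded 1 A"
proof -
  obtain B where B: "0 < B" "\<And>x. x \<in> A \<Longrightarrow> \<bar>x\<bar> \<le> B"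
    using assms by (metis bounded_pos real_norm_def)
  have "\<exists>S. finite S \<and> real (card S) \<le> (2*B+4) * \<delta> powr (-1) \<and> A \<subseteq> (\<Union>x\<in>S. cball x \<delta>)"
    if \<delta>: "\<delta> \<in> {0<..1}" for \<delta>
  proof -
    define S where "S = (\<lambda>k::int. of_int k * \<delta>) ` {\<lfloor>-B/\<delta>\<rfloor>..\<lfloor>B/\<delta>\<rfloor>}"
    have "card S \<le> card {\<lfloor>-B/\<delta>\<rfloor>..\<lfloor>B/\<delta>\<rfloor>}"
      unfolding S_def by (rule card_image_le) simp
    also have "\<dots> = nat (\<lfloor>B/\<delta>\<rfloor> + 1 - \<lfloor>-B/\<delta>\<rfloor>)" by simp
    finally have "real (card S) \<le> of_int (\<lfloor>B/\<delta>\<rfloor> + 1 - \<lfloor>-B/\<delta>\<rfloor>)"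
      using B \<delta> by (smt (verit) divide_nonneg_nonneg divide_pos_pos floor_mono floor_of_int greaterThanAtMost_iff minus_divide_left nat_0_le of_nat_le_iff of_nat_nat of_int_of_nat_eq of_nat_0_le_iff of_int_le_iff)
    also have "\<dots> \<le> 2*B/\<delta> + 2" by linarith
    also have "\<dots> \<le> (2*B+4) * \<delta> powr (-1)"
      using \<delta> B by (simp add: powr_minus_divide field_simps)
    finally have "real (card S) \<le> (2*B+4) * \<delta> powr (-1)" .
    moreover have "A \<subseteq> (\<Union>x\<in>S. cball x \<delta>)"
    proof
      fix x assume "x \<in> A"
      then have "-B/\<delta> \<le> x/\<delta>" "x/\<delta> \<le> B/\<delta>"
        using B(2)[of x] \<delta> by (auto simp: field_simps)
      then have "of_int \<lfloor>x/\<delta>\<rfloor> * \<delta> \<in> S"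
        unfolding S_def by (intro imageI) (auto intro: floor_mono)
      moreover have "x \<in> cball (of_int \<lfloor>x/\<delta>\<rfloor> * \<delta>) \<delta>"
      proof -
        have "of_int \<lfloor>x/\<delta>\<rfloor> * \<delta> \<le> x" "x \<le> of_int \<lfloor>x/\<delta>\<rfloor> * \<delta> + \<delta>"
          using \<delta> floor_divide_lower[of \<delta> x] floor_divide_upper[of \<delta> x]
          by (auto simp: algebra_simps)
        then show ?thesis by (auto simp: dist_real_def)
      qed
      ultimately show "x \<in> (\<Union>x\<in>S. cball x \<delta>)" by blast
    qed
    ultimately show ?thesis unfolding S_def by (intro exI[of _ S]) (auto simp: S_def)
  qed
  then show ?thesis unfolding net_bounded_def by blast
qed

lemma net_bounded_imp_small_covers:
  assumes "net_bounded s A" "s < s'" "0 < \<epsilon>"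
  shows "\<exists>L. ball_cover A L \<and> cover_cost s' L < \<epsilon>"
proof -
  obtain C where C: "\<And>\<delta>. \<delta> \<in> {0<..1} \<Longrightarrow> \<exists>S. finite S \<and> real (card S) \<le> C * \<delta> powr (-s) \<and>
     A \<subseteq> (\<Union>x\<in>S. cball x \<delta>)"
    using assms(1) unfolding net_bounded_def by blast
  have "((\<lambda>\<delta>. C * 2 powr s' * \<delta> powr (s'-s)) \<longlongrightarrow> C * 2 powr s' * 0) (at_right 0)"
    by (intro tendsto_mult tendsto_const tendsto_zero_powrI[where b="s'-s"] tendsto_ident_at)
      (use assms in \<open>auto simp: eventually_at_filter\<close>)
  then have "eventually (\<lambda>\<delta>. C * 2 powr s' * \<delta> powr (s'-s) < \<epsilon>) (at_right 0)"
    using assms(3) by (intro order_tendstoD) auto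
  moreover have "eventually (\<lambda>\<delta>::real. \<delta> \<in> {0<..<1}) (at_right 0)"
    by (rule eventually_at_right_real) simp
  ultimately have "eventually (\<lambda>\<delta>. C * 2 powr s' * \<delta> powr (s'-s) < \<epsilon> \<and> \<delta> \<in> {0<..<1}) (at_right 0)"
    by (rule eventually_conj)
  then obtain \<delta> :: real where \<delta>: "C * 2 powr s' * \<delta> powr (s'-s) < \<epsilon>" "\<delta> \<in> {0<..<1}"
    using eventually_happens' trivial_limit_at_right_real by blast
  obtain S where S: "finite S" "real (card S) \<le> C * \<delta> powr (-s)" "A \<subseteq> (\<Union>x\<in>S. cball x \<delta>)"
    using C[of \<delta>] \<delta> by auto
  obtain L where L: "ball_cover A L" "cover_cost s' L = real (card S) * (2*\<delta>) powr s'"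
    using ball_cover_of_net[OF S(1,3)] \<delta> by (metis greaterThanLessThan_iff)
  have "real (card S) * (2*\<delta>) powr s' \<le> C * \<delta> powr (-s) * (2*\<delta>) powr s'"
    using S by (intro mult_right_mono) auto
  also have "\<dots> = C * 2 powr s' * \<delta> powr (s'-s)"
    using \<delta> by (simp add: powr_mult powr_diff powr_minus field_simps)
  finally show ?thesis using L \<delta> by auto
qed

lemma hausdorff_dim_le:
  assumes "net_bounded s A" "0 \<le> s"
  shows "hausdorff_dim A \<le> s"
proof (rule field_le_epsilon)
  fix e :: real assume "0 < e"
  then have "hausdorff_measure (s+e) A = 0"
    using assms by (intro hausdorff_measure_eq_0I net_bounded_imp_small_covers[of s]) auto
  then show "hausdorff_dim A \<le> s + e"
    unfolding hausdorff_dim_def using assms \<open>0 < e\<close>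
    by (intro cInf_lower bdd_belowI[of _ 0]) auto
qed

text \<open>
  A lower bound on the cost for the exponent \<open>s\<close> passes to all smaller exponents, because for radii
  below \<open>1\<close> lowering the exponent raises the cost, and a ball of radius at least \<open>1\<close> already costs \<open>1\<close>.
\<close>
lemma hausdorff_dim_ge:
  assumes "compact A" "0 \<le> s" "0 < c" and lower: "\<And>L. ball_cover A L \<Longrightarrow> c \<le> cover_cost s L"
  shows "s \<le> hausdorff_dim A"
  unfolding hausdorff_dim_def
proof (rule cInf_greatest)
  have nb: "net_bounded 1 A"
    by (rule net_bounded_one[OF compact_imp_bounded[OF assms(1)]])
  have "hausdorff_measure 2 A = 0"
    by (rule hausdorff_measure_eq_0I) (use net_bounded_imp_small_covers[OF nb] in simp_all)
  then have "2 \<in> {s. 0 \<le> s \<and> hausdorff_measure s A = 0}" by simp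
  then show "{s. 0 \<le> s \<and> hausdorff_measure s A = 0} \<noteq> {}" by blast
next
  fix u assume "u \<in> {s. 0 \<le> s \<and> hausdorff_measure s A = 0}"
  then have u: "0 \<le> u" "hausdorff_measure u A = 0" by auto
  show "s \<le> u"
  proof (rule ccontr)
    assume "\<not> s \<le> u"
    have "min 1 c \<le> cover_cost u L" if L: "ball_cover A L" for L
    proof (cases "\<exists>q\<in>set L. 1 \<le> snd q")
      case True
      then obtain q where "q \<in> set L" "1 \<le> snd q" by blast
      then have "1 \<le> snd q powr u" using u by (simp add: ge_one_powr_ge_zero)
      then show ?thesis using member_le_cover_cost[OF \<open>q \<in> set L\<close>, of u] by linarith
    next
      case False
      have "cover_cost s L \<le> cover_cost u L"
        unfolding cover_cost_def
        by (rule sum_list_mono, rule powr_mono') (use L False \<open>\<not> s \<le> u\<close> in \<open>auto simp: ball_cover_def intro: less_imp_le\<close>)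
      then show ?thesis using lower[OF L] by linarith
    qed
    then show False
      using hausdorff_measure_neq_0[OF assms(1) u(1), of "min 1 c"] assms(3) u(2) by auto
  qed
qed

lemma covering_number_le:
  assumes "finite S" "A \<subseteq> (\<Union>x\<in>S. cball x (\<delta>/2))" "0 < \<delta>"
  shows "covering_number \<delta> (A :: real set) \<le> card S"
proof -
  let ?C = "(\<lambda>x. cball x (\<delta>/2)) ` S"
  have "covering_number \<delta> A \<le> card ?C"
    unfolding covering_number_def
    by (rule Least_le) (use assms in \<open>auto intro!: exI[of _ ?C]\<close>)
  also have "\<dots> \<le> card S" using assms(1) by (rule card_image_le)
  finally show ?thesis .
qed

text \<open>
  The net only serves to know that some finite cover exists, so that the least cardinality in the
  definition of the covering number is attained.
\<close>
lemma covering_number_cover: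
  assumes "finite S" "A \<subseteq> (\<Union>x\<in>S. cball x (\<delta>/2))" "0 < \<delta>"
  obtains L where "ball_cover (A :: real set) L"
    "cover_cost s L \<le> real (covering_number \<delta> A) * (2*\<delta>) powr s"
proof -
  let ?P = "\<lambda>n. \<exists>C. finite C \<and> card C = n \<and> A \<subseteq> \<Union>C \<and> (\<forall>U\<in>C. bounded U \<and> diameter U \<le> \<delta>)"
  have "?P (card ((\<lambda>x. cball x (\<delta>/2)) ` S))"
    using assms by (auto intro!: exI[of _ "(\<lambda>x. cball x (\<delta>/2)) ` S"])
  then have "?P (covering_number \<delta> A)"
    unfolding covering_number_def by (rule LeastI)
  then obtain C where C: "finite C" "card C = covering_number \<delta> A" "A \<subseteq> \<Union>C"
    "\<And>U. U \<in> C \<Longrightarrow> bounded U \<and> diameter U \<le> \<delta>" by blast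
  define p where "p U = (SOME x. x \<in> U)" for U :: "real set"
  have "A \<subseteq> (\<Union>x\<in>p ` C. cball x \<delta>)"
  proof
    fix x assume "x \<in> A"
    then obtain U where U: "x \<in> U" "U \<in> C" using C by blast
    then have "p U \<in> U" unfolding p_def by (metis someI)
    then have "dist (p U) x \<le> \<delta>"
      using diameter_bounded_bound[of U "p U" x] C(4)[OF U(2)] U by auto
    then show "x \<in> (\<Union>x\<in>p ` C. cball x \<delta>)" using U by auto
  qed
  then obtain L where L: "ball_cover A L" "cover_cost s L = real (card (p ` C)) * (2*\<delta>) powr s"
    using ball_cover_of_net[of "p ` C" A \<delta>] C(1) assms(3) by (metis finite_imageI)
  have "card (p ` C) \<le> covering_number \<delta> A"
    using card_image_le[OF C(1), of p] C(2) by simp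
  then show ?thesis using that L by (simp add: mult_right_mono)
qed

lemma cover_cost_0: "cover_cost 0 L \<ge> 1" if "ball_cover A L" "A \<noteq> {}"
proof -
  have "set L \<noteq> {}" using that by (auto simp: ball_cover_def)
  then obtain q where "q \<in> set L" by (metis ex_in_conv)
  then show ?thesis
    using member_le_cover_cost[of q L 0] that by (auto simp: ball_cover_def)
qed

lemma hausdorff_dim_nonneg: "0 \<le> hausdorff_dim A" if "compact A" "A \<noteq> {}"
  using hausdorff_dim_ge[OF that(1), of 0 1] cover_cost_0[OF _ that(2)] by auto

lemma hausdorff_measure_finite:
  assumes "net_bounded s A"
  shows "hausdorff_measure s A < \<infinity>"
proof -
  obtain C where C: "\<And>\<delta>. \<delta> \<in> {0<..1} \<Longrightarrow> \<exists>S. finite S \<and> real (card S) \<le> C * \<delta> powr (-s) \<and>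
     A \<subseteq> (\<Union>x\<in>S. cball x \<delta>)"
    using assms(1) unfolding net_bounded_def by blast
  have "hausdorff_premeasure s \<delta> A \<le> ennreal (2 powr s * (C * 2 powr s))" if "0 < \<delta>" for \<delta>
  proof -
    define d where "d = min 1 (\<delta>/4)"
    have d: "d \<in> {0<..1}" "4 * d \<le> \<delta>" using that by (auto simp: d_def)
    obtain S where S: "finite S" "real (card S) \<le> C * d powr (-s)" "A \<subseteq> (\<Union>x\<in>S. cball x d)"
      using C[OF d(1)] by blast
    obtain L where L: "ball_cover A L" "cover_cost s L = real (card S) * (2*d) powr s" "\<forall>q\<in>set L. snd q = 2*d"
      using ball_cover_of_net[OF S(1,3)] d by (metis greaterThanAtMost_iff)
    have "hausdorff_premeasure s \<delta> A \<le> ennreal (2 powr s * cover_cost s L)"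
      using L d that by (intro hausdorff_premeasure_le_cover_cost) auto
    also have "cover_cost s L \<le> C * d powr (-s) * (2*d) powr s"
      unfolding L using S by (intro mult_right_mono) auto
    also have "\<dots> = C * 2 powr s"
      using d by (simp add: powr_mult powr_minus field_simps)
    finally show ?thesis by (simp add: ennreal_leI mult_left_mono)
  qed
  then have "hausdorff_measure s A \<le> ennreal (2 powr s * (C * 2 powr s))"
    unfolding hausdorff_measure_def by (intro SUP_least) auto
  then show ?thesis by (simp add: order_le_less_trans)
qed

lemma tendsto_const_divide_neg_ln: "((\<lambda>\<delta>::real. K / (- ln \<delta>)) \<longlongrightarrow> 0) (at_right 0)"
  by (rule tendsto_divide_0[OF tendsto_const])
    (intro filterlim_at_top_imp_at_infinity, use ln_at_0 in \<open>simp add: filterlim_uminus_at_bot\<close>)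

text \<open>
  The net bound controls the covering numbers from above with exponent \<open>s\<close>. From below, for any
  \<open>\<sigma> < s\<close> the \<open>\<sigma>\<close>-dimensional measure is not zero, so covers by sets of one size \<open>\<delta>\<close> cost at least a
  constant and must be numerous.
\<close>
lemma has_box_dim_hausdorff_dim:
  assumes "compact A" "A \<noteq> {}" "net_bounded (hausdorff_dim A) A"
  shows "has_box_dim A (hausdorff_dim A)"
proof -
  define s where "s = hausdorff_dim A"
  have "0 \<le> s" unfolding s_def using hausdorff_dim_nonneg assms by blast
  obtain C0 where C0: "\<And>\<delta>. \<delta> \<in> {0<..1} \<Longrightarrow> \<exists>S. finite S \<and> real (card S) \<le> C0 * \<delta> powr (-s) \<and>
     A \<subseteq> (\<Union>x\<in>S. cball x \<delta>)"
    using assms(3) unfolding net_bounded_def s_def by blast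
  define C where "C = max 1 C0 * 2 powr s"
  define N where "N \<delta> = real (covering_number \<delta> A)" for \<delta>
  have "0 < C" by (simp add: C_def)
  have net: "\<exists>S. finite S \<and> real (card S) \<le> C * \<delta> powr (-s) \<and> A \<subseteq> (\<Union>x\<in>S. cball x (\<delta>/2))"
    if "\<delta> \<in> {0<..<1}" for \<delta>
  proof -
    have half: "\<delta>/2 \<in> {0<..1}" using that by auto
    obtain S where S: "finite S" "real (card S) \<le> C0 * (\<delta>/2) powr (-s)" "A \<subseteq> (\<Union>x\<in>S. cball x (\<delta>/2))"
      using C0[OF half] by blast
    have "C0 * (\<delta>/2) powr (-s) \<le> max 1 C0 * (\<delta>/2) powr (-s)" by (intro mult_right_mono) auto
    also have "\<dots> = C * \<delta> powr (-s)"
      using that by (simp add: C_def powr_divide powr_minus field_simps)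
    finally show ?thesis using S by fastforce
  qed
  have N_le: "N \<delta> \<le> C * \<delta> powr (-s)" if \<delta>: "\<delta> \<in> {0<..<1}" for \<delta>
    using net[OF \<delta>] covering_number_le[of _ A \<delta>] \<delta> unfolding N_def by fastforce
  have cov: "\<exists>L. ball_cover A L \<and> cover_cost \<sigma> L \<le> N \<delta> * (2*\<delta>) powr \<sigma>" if \<delta>: "\<delta> \<in> {0<..<1}" for \<delta> \<sigma>
    using net[OF \<delta>] covering_number_cover[of _ A \<delta> \<sigma>] \<delta> unfolding N_def by force
  have N_ge_1: "1 \<le> N \<delta>" if \<delta>: "\<delta> \<in> {0<..<1}" for \<delta>
    using cov[OF \<delta>, of 0] cover_cost_0[OF _ assms(2)] \<delta> by fastforce
  have small: "eventually (\<lambda>\<delta>::real. \<delta> \<in> {0<..<1}) (at_right 0)"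
    by (rule eventually_at_right_real) simp
  have "((\<lambda>\<delta>. ln (N \<delta>) / (- ln \<delta>)) \<longlongrightarrow> s) (at_right 0)"
  proof (rule order_tendstoI)
    fix a assume "a < s"
    show "eventually (\<lambda>\<delta>. a < ln (N \<delta>) / (- ln \<delta>)) (at_right 0)"
    proof (cases "a < 0")
      case True
      show ?thesis using small
      proof eventually_elim
        case (elim \<delta>)
        then have "0 \<le> ln (N \<delta>) / (- ln \<delta>)"
          using N_ge_1[OF elim] by (intro divide_nonneg_nonneg) auto
        then show ?case using True by simp
      qed
    next
      case False
      define \<sigma> where "\<sigma> = (a + s)/2"
      have \<sigma>: "0 < \<sigma>" "a < \<sigma>" "\<sigma> < s" using False \<open>a < s\<close> by (auto simp: \<sigma>_def)
      have "hausdorff_measure \<sigma> A \<noteq> 0"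
      proof
        assume "hausdorff_measure \<sigma> A = 0"
        then have "s \<le> \<sigma>" unfolding s_def hausdorff_dim_def
          using \<sigma> by (intro cInf_lower bdd_belowI[of _ 0]) auto
        then show False using \<sigma> by simp
      qed
      then obtain c where c: "0 < c" "\<And>L. ball_cover A L \<Longrightarrow> c \<le> cover_cost \<sigma> L"
        using hausdorff_measure_eq_0I[OF \<sigma>(1), of A] by (meson not_le)
      have "((\<lambda>\<delta>. \<sigma> + (ln c - \<sigma> * ln 2) / (- ln \<delta>)) \<longlongrightarrow> \<sigma> + 0) (at_right 0)"
        by (intro tendsto_add tendsto_const tendsto_const_divide_neg_ln)
      then have "eventually (\<lambda>\<delta>. a < \<sigma> + (ln c - \<sigma> * ln 2) / (- ln \<delta>)) (at_right 0)"
        using \<sigma> by (intro order_tendstoD) auto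
      then show ?thesis using small
      proof eventually_elim
        case (elim \<delta>)
        have "ln \<delta> < 0" using elim by auto
        obtain L where "ball_cover A L" "cover_cost \<sigma> L \<le> N \<delta> * (2*\<delta>) powr \<sigma>"
          using cov[OF elim(2)] by blast
        then have "c \<le> N \<delta> * (2*\<delta>) powr \<sigma>" using c(2) by fastforce
        then have "ln c \<le> ln (N \<delta> * (2*\<delta>) powr \<sigma>)" using c(1) by simp
        also have "\<dots> = ln (N \<delta>) + \<sigma> * (ln 2 + ln \<delta>)"
          using N_ge_1[OF elim(2)] elim(2) by (simp add: ln_mult ln_powr)
        finally have "(ln c - \<sigma> * (ln 2 + ln \<delta>)) / (- ln \<delta>) \<le> ln (N \<delta>) / (- ln \<delta>)"
          using \<open>ln \<delta> < 0\<close> by (intro divide_right_mono) auto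
        moreover have "\<sigma> + (ln c - \<sigma> * ln 2) / (- ln \<delta>) = (ln c - \<sigma> * (ln 2 + ln \<delta>)) / (- ln \<delta>)"
          using \<open>ln \<delta> < 0\<close> by (simp add: field_simps)
        ultimately have "\<sigma> + (ln c - \<sigma> * ln 2) / (- ln \<delta>) \<le> ln (N \<delta>) / (- ln \<delta>)" by simp
        then show ?case using elim by linarith
      qed
    qed
  next
    fix a assume "s < a"
    have "((\<lambda>\<delta>. s + ln C / (- ln \<delta>)) \<longlongrightarrow> s + 0) (at_right 0)"
      by (intro tendsto_add tendsto_const tendsto_const_divide_neg_ln)
    then have "eventually (\<lambda>\<delta>. s + ln C / (- ln \<delta>) < a) (at_right 0)"
      using \<open>s < a\<close> by (intro order_tendstoD) auto
    then show "eventually (\<lambda>\<delta>. ln (N \<delta>) / (- ln \<delta>) < a) (at_right 0)" using small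
    proof eventually_elim
      case (elim \<delta>)
      have "ln \<delta> < 0" using elim by auto
      have "ln (N \<delta>) \<le> ln (C * \<delta> powr (-s))"
        using N_le[OF elim(2)] N_ge_1[OF elim(2)] by simp
      also have "\<dots> = ln C - s * ln \<delta>"
        using \<open>0 < C\<close> elim(2) by (simp add: ln_mult ln_powr)
      finally have "ln (N \<delta>) / (- ln \<delta>) \<le> (ln C - s * ln \<delta>) / (- ln \<delta>)"
        using \<open>ln \<delta> < 0\<close> by (intro divide_right_mono) auto
      moreover have "(ln C - s * ln \<delta>) / (- ln \<delta>) = s + ln C / (- ln \<delta>)"
        using \<open>ln \<delta> < 0\<close> by (simp add: field_simps)
      ultimately have "ln (N \<delta>) / (- ln \<delta>) \<le> s + ln C / (- ln \<delta>)" by simp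
      then show ?case using elim by linarith
    qed
  qed
  then show ?thesis unfolding has_box_dim_def N_def s_def .
qed

section \<open>The blow-up principle\<close>

definition scale_cover :: "real \<Rightarrow> real \<Rightarrow> (real \<times> real) list \<Rightarrow> (real \<times> real) list" where
  "scale_cover c e L = map (\<lambda>q. (c * fst q + e, \<bar>c\<bar> * snd q)) L"

lemma ball_cover_scale:
  assumes "ball_cover A L" "c \<noteq> 0"
  shows "ball_cover ((\<lambda>z. c * z + e) ` A) (scale_cover c e L)"
  unfolding ball_cover_def
proof (intro conjI subsetI)
  show "\<forall>q\<in>set (scale_cover c e L). 0 < snd q"
    using assms by (auto simp: ball_cover_def scale_cover_def)
  fix x assume "x \<in> (\<lambda>z. c * z + e) ` A"
  then obtain z where z: "x = c * z + e" "z \<in> A" by blast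
  then obtain q where q: "q \<in> set L" "\<bar>fst q - z\<bar> < snd q"
    using assms(1) by (auto simp: ball_cover_def dist_real_def)
  have "\<bar>c * fst q + e - x\<bar> = \<bar>c\<bar> * \<bar>fst q - z\<bar>"
    by (simp add: z abs_mult[symmetric] algebra_simps)
  also have "\<dots> < \<bar>c\<bar> * snd q" using q assms by simp
  finally show "x \<in> (\<Union>q\<in>set (scale_cover c e L). ball (fst q) (snd q))"
    using q(1) by (force simp: scale_cover_def dist_real_def)
qed

lemma cover_cost_scale:
  assumes "\<forall>q\<in>set L. 0 < snd q"
  shows "cover_cost s (scale_cover c e L) = \<bar>c\<bar> powr s * cover_cost s L"
  using assms by (induction L) (auto simp: cover_cost_def scale_cover_def powr_mult algebra_simps)

lemma ball_cover_unscale: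
  assumes "ball_cover ((\<lambda>z. c * z + e) ` A) L" "c \<noteq> 0"
  shows "ball_cover A (scale_cover (1/c) (-e/c) L)"
proof -
  have "(\<lambda>z. (1/c) * z + (-e/c)) ` (\<lambda>z. c * z + e) ` A = A"
    using assms(2) by (force simp: image_image field_simps)
  then show ?thesis using ball_cover_scale[OF assms(1), of "1/c" "-e/c"] assms(2) by simp
qed

text \<open>
  If every ball of a cover is assigned to at most one index, splitting the cover does not increase the
  total cost.
\<close>
lemma sum_cover_cost_filter_le:
  assumes "finite I" "\<And>q i j. q \<in> set L \<Longrightarrow> i \<in> I \<Longrightarrow> j \<in> I \<Longrightarrow> P i q \<Longrightarrow> P j q \<Longrightarrow> i = j"
  shows "(\<Sum>i\<in>I. cover_cost s (filter (P i) L)) \<le> cover_cost s L"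
  using assms(2)
proof (induction L)
  case (Cons q L)
  have "(\<Sum>i\<in>I. cover_cost s (filter (P i) (q # L))) =
      (\<Sum>i\<in>I. (if P i q then snd q powr s else 0) + cover_cost s (filter (P i) L))"
    by (rule sum.cong) (auto simp: cover_cost_Cons)
  also have "\<dots> = (\<Sum>i\<in>I. if P i q then snd q powr s else 0) + (\<Sum>i\<in>I. cover_cost s (filter (P i) L))"
    by (rule sum.distrib)
  also have "(\<Sum>i\<in>I. if P i q then snd q powr s else 0) = real (card {i\<in>I. P i q}) * snd q powr s"
    using assms(1) by (simp add: sum.If_cases Int_def)
  also have "card {i\<in>I. P i q} \<le> 1"
    using Cons.prems[of q] assms(1) by (simp add: card_le_Suc0_iff_eq)
  then have "real (card {i\<in>I. P i q}) * snd q powr s \<le> 1 * snd q powr s"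
    by (intro mult_right_mono) auto
  also have "(\<Sum>i\<in>I. cover_cost s (filter (P i) L)) \<le> cover_cost s L"
    using Cons by auto
  finally show ?case by (simp add: cover_cost_Cons)
qed (simp add: cover_cost_def)

text \<open>
  The source of all lower bounds for dimensions below. The sets \<open>A x\<close> contain copies of one another
  that are \<open>g\<close>-separated, so a ball of radius below \<open>g/2\<close> meets at most one copy and a cover by such
  balls splits into covers of the copies. After rescaling, these are covers of sets \<open>A y\<close> by larger balls,
  and the weights \<open>w\<close> certify that nothing is lost on average. Rescaling is repeated until some ball
  has radius at least \<open>g/2\<close>; that ball alone pays for the bound. No measure has to be constructed:
  the induction runs on how far the smallest radius is below \<open>g/2\<close>, measured in powers of \<open>\<kappa>\<close>.

  The weights allow individual steps to lose, as long as their product stays bounded by \<open>W\<close>.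
\<close>
theorem self_reproducing_cover_bound:
  fixes A :: "'x \<Rightarrow> real set" and w :: "'x \<Rightarrow> real"
  assumes "0 < g" "0 < \<kappa>" "\<kappa> < 1" "0 \<le> s" "0 \<le> W"
    and w: "\<And>x. x \<in> X \<Longrightarrow> 0 \<le> w x \<and> w x \<le> W"
    and ne: "\<And>x. x \<in> X \<Longrightarrow> A x \<noteq> {}"
    and pieces: "\<And>x. x \<in> X \<Longrightarrow> \<exists>(I::'i set) c e y. finite I \<and>
        (\<forall>i\<in>I. y i \<in> X \<and> 0 < \<bar>c i\<bar> \<and> \<bar>c i\<bar> \<le> \<kappa> \<and> (\<lambda>z. c i * z + e i) ` A (y i) \<subseteq> A x) \<and>
        (\<forall>i\<in>I. \<forall>j\<in>I. i \<noteq> j \<longrightarrow> (\<forall>p\<in>A (y i). \<forall>q\<in>A (y j). g \<le> \<bar>(c i * p + e i) - (c j * q + e j)\<bar>)) \<and>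
        w x \<le> (\<Sum>i\<in>I. \<bar>c i\<bar> powr s * w (y i))"
    and "x \<in> X" "ball_cover (A x) L"
  shows "w x * (g/2) powr s \<le> W * cover_cost s L"
proof -
  have big: "w x * (g/2) powr s \<le> W * cover_cost s L"
    if "x \<in> X" "q \<in> set L" "g/2 \<le> snd q" for x L q
  proof -
    have "(g/2) powr s \<le> snd q powr s" using that assms by (intro powr_mono2) auto
    also have "\<dots> \<le> cover_cost s L" using that by (intro member_le_cover_cost)
    finally show ?thesis using w[OF that(1)] by (intro mult_mono) auto
  qed
  have main: "w x * (g/2) powr s \<le> W * cover_cost s L"
    if "x \<in> X" "ball_cover (A x) L" "\<forall>q\<in>set L. (g/2) * \<kappa>^n \<le> snd q" for n x L
    using that
  proof (induction n arbitrary: x L)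
    case 0
    have "set L \<noteq> {}" using 0 ne[of x] by (auto simp: ball_cover_def)
    then obtain q where "q \<in> set L" by (metis ex_in_conv)
    then show ?case using big 0 by auto
  next
    case (Suc n)
    show ?case
    proof (cases "\<exists>q\<in>set L. g/2 \<le> snd q")
      case True
      then show ?thesis using big Suc.prems by blast
    next
      case False
      obtain I :: "'i set" and c e y where I: "finite I"
        and I': "\<forall>i\<in>I. y i \<in> X \<and> 0 < \<bar>c i\<bar> \<and> \<bar>c i\<bar> \<le> \<kappa> \<and> (\<lambda>z. c i * z + e i) ` A (y i) \<subseteq> A x"
        and sep': "\<forall>i\<in>I. \<forall>j\<in>I. i \<noteq> j \<longrightarrow>
          (\<forall>p\<in>A (y i). \<forall>q\<in>A (y j). g \<le> \<bar>(c i * p + e i) - (c j * q + e j)\<bar>)"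
        and sum: "w x \<le> (\<Sum>i\<in>I. \<bar>c i\<bar> powr s * w (y i))"
        using pieces[OF Suc.prems(1)] by (elim exE conjE) (rule that; assumption)
      note I2 = I'[rule_format] and sep = sep'[rule_format]
      \<comment> \<open>\<open>P i q\<close>: the ball \<open>q\<close> is needed for the \<open>i\<close>-th copy. No ball is needed for two of them.\<close>
      define P where "P i q \<longleftrightarrow> ball (fst q) (snd q) \<inter> (\<lambda>z. c i * z + e i) ` A (y i) \<noteq> {}" for i and q :: "real \<times> real"
      have disj: "i = j" if h: "q \<in> set L" "i \<in> I" "j \<in> I" "P i q" "P j q" for q i j
      proof (rule ccontr)
        assume "i \<noteq> j"
        obtain u v where "u \<in> A (y i)" "v \<in> A (y j)" "\<bar>fst q - (c i * u + e i)\<bar> < snd q" "\<bar>fst q - (c j * v + e j)\<bar> < snd q"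
          using h(4,5) unfolding P_def by (auto simp: dist_real_def)
        moreover have "snd q < g/2" using False h(1) by auto
        ultimately show False using sep[OF h(2,3) \<open>i \<noteq> j\<close>, of u v] by linarith
      qed
      have step: "w (y i) * (g/2) powr s \<le> W * cover_cost s (scale_cover (1/c i) (-e i/c i) (filter (P i) L))"
        if i: "i \<in> I" for i
      proof (rule Suc.IH)
        show "y i \<in> X" using I2[OF i] by blast
        have "ball_cover ((\<lambda>z. c i * z + e i) ` A (y i)) (filter (P i) L)"
          unfolding ball_cover_def
        proof (intro conjI subsetI)
          fix p assume p: "p \<in> (\<lambda>z. c i * z + e i) ` A (y i)"
          then have "p \<in> A x" using I2[OF i] by blast
          then obtain q where q: "q \<in> set L" "p \<in> ball (fst q) (snd q)"
            using Suc.prems(2) by (auto simp: ball_cover_def)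
          then have "q \<in> set (filter (P i) L)" using p by (auto simp: P_def)
          then show "p \<in> (\<Union>q\<in>set (filter (P i) L). ball (fst q) (snd q))"
            using q by blast
        qed (use Suc.prems(2) in \<open>auto simp: ball_cover_def\<close>)
        then show "ball_cover (A (y i)) (scale_cover (1/c i) (-e i/c i) (filter (P i) L))"
          using I2[OF i] by (intro ball_cover_unscale) auto
        show "\<forall>q\<in>set (scale_cover (1/c i) (-e i/c i) (filter (P i) L)). (g/2) * \<kappa>^n \<le> snd q"
        proof
          fix q' assume "q' \<in> set (scale_cover (1/c i) (-e i/c i) (filter (P i) L))"
          then obtain q where q: "q \<in> set L" "snd q' = \<bar>1/c i\<bar> * snd q"
            by (auto simp: scale_cover_def)
          have "(g/2) * \<kappa>^n * \<bar>c i\<bar> \<le> (g/2) * \<kappa>^n * \<kappa>"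
            using I2[OF i] assms by (intro mult_left_mono) auto
          also have "\<dots> \<le> snd q" using Suc.prems(3) q(1) by (auto simp: algebra_simps)
          also have "\<dots> = snd q' * \<bar>c i\<bar>"
            using I2[OF i] q(2) by (simp add: abs_divide)
          finally show "(g/2) * \<kappa>^n \<le> snd q'"
            using I2[OF i] by (simp only: mult_le_cancel_right_pos)
        qed
      qed
      have cost: "cover_cost s (scale_cover (1/c i) (-e i/c i) (filter (P i) L)) =
          cover_cost s (filter (P i) L) / \<bar>c i\<bar> powr s" for i
        using Suc.prems(2) by (subst cover_cost_scale) (auto simp: ball_cover_def powr_divide abs_divide)
      have "w x * (g/2) powr s \<le> (\<Sum>i\<in>I. \<bar>c i\<bar> powr s * w (y i)) * (g/2) powr s"
        using sum by (intro mult_right_mono) auto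
      also have "\<dots> = (\<Sum>i\<in>I. \<bar>c i\<bar> powr s * (w (y i) * (g/2) powr s))"
        by (simp add: sum_distrib_right mult.assoc)
      also have "\<dots> \<le> (\<Sum>i\<in>I. \<bar>c i\<bar> powr s * (W * (cover_cost s (filter (P i) L) / \<bar>c i\<bar> powr s)))"
        using step unfolding cost by (intro sum_mono mult_left_mono) auto
      also have "\<dots> = (\<Sum>i\<in>I. W * cover_cost s (filter (P i) L))"
        by (rule sum.cong) (use I2 in auto)
      also have "\<dots> = W * (\<Sum>i\<in>I. cover_cost s (filter (P i) L))"
        by (simp add: sum_distrib_left)
      also have "\<dots> \<le> W * cover_cost s L"
        using sum_cover_cost_filter_le[OF I disj] assms by (intro mult_left_mono) auto
      finally show ?thesis .
    qed
  qed
  have "\<exists>n. \<forall>q\<in>set L. (g/2) * \<kappa>^n \<le> snd q"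
  proof -
    have "\<exists>d>0. \<forall>q\<in>set L. d \<le> snd q"
    proof (cases "L = []")
      case False
      then show ?thesis using assms(10) 
        by (intro exI[of _ "Min (snd ` set L)"]) (auto simp: ball_cover_def)
    qed (auto intro: exI[of _ 1])
    then obtain d where d: "0 < d" "\<forall>q\<in>set L. d \<le> snd q" by blast
    obtain n where "\<kappa>^n < d/(g/2)"
      using real_arch_pow_inv[of "d/(g/2)" \<kappa>] assms d by auto
    then have "(g/2) * \<kappa>^n \<le> d" using assms by (simp add: field_simps)
    then show ?thesis using d by (meson order_trans)
  qed
  then show ?thesis using main assms(9,10) by blast
qed

section \<open>Affine Cantor sets\<close>

text \<open>
  \<open>K\<close> contains separated translates of \<open>R K\<close>, all of the same size and orientation, and at least
  \<open>R\<^sup>-\<^sup>\<sigma>\<close> of them.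
\<close>
definition homogeneous_ratio :: "real set \<Rightarrow> real \<Rightarrow> real \<Rightarrow> bool" where
  "homogeneous_ratio K \<sigma> R \<longleftrightarrow> 0 < R \<and> R < 1 \<and>
     (\<exists>B g. finite B \<and> 0 < g \<and> (\<forall>b\<in>B. \<forall>x\<in>K. R * x + b \<in> K) \<and>
        (\<forall>b\<in>B. \<forall>b'\<in>B. \<forall>x\<in>K. \<forall>y\<in>K. b \<noteq> b' \<longrightarrow> g \<le> \<bar>(R * x + b) - (R * y + b')\<bar>) \<and>
        1 \<le> real (card B) * R powr \<sigma>)"

locale affine_cantor =
  fixes M :: nat and r t :: "nat \<Rightarrow> real" and a :: real and K :: "real set"
  assumes cantor: "affine_cantor_set M r t a K"
begin

lemma M_ge_2: "2 \<le> M" and K_ne: "K \<noteq> {}" and compact_K: "compact K" and a_pos: "0 < a"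
  and r_bounds: "i \<in> {1..M} \<Longrightarrow> 0 < \<bar>r i\<bar> \<and> \<bar>r i\<bar> < 1"
  using cantor unfolding affine_cantor_set_def is_attractor_def by auto

lemma K_eq: "K = (\<Union>i\<in>{1..M}. (\<lambda>x. r i * x + t i) ` K)"
  using cantor unfolding affine_cantor_set_def is_attractor_def by blast

lemma K_sub: "K \<subseteq> {0..a}"
  using cantor hull_subset[of K convex] unfolding affine_cantor_set_def by simp

lemma K_step: "i \<in> {1..M} \<Longrightarrow> x \<in> K \<Longrightarrow> r i * x + t i \<in> K"
  using K_eq by blast

lemma K_cases: assumes "x \<in> K" obtains i y where "i \<in> {1..M}" "y \<in> K" "x = r i * y + t i"
  using assms K_eq by blast

lemma ratio_upper: obtains \<kappa> where "0 < \<kappa>" "\<kappa> < 1" "\<And>i. i \<in> {1..M} \<Longrightarrow> \<bar>r i\<bar> \<le> \<kappa>"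
proof (rule that)
  let ?S = "(\<lambda>i. \<bar>r i\<bar>) ` {1..M}"
  have "?S \<noteq> {}" using M_ge_2 by auto
  then have "Max ?S \<in> ?S" by (intro Max_in) auto
  then show "0 < Max ?S" "Max ?S < 1" using r_bounds by auto
  show "\<bar>r i\<bar> \<le> Max ?S" if "i \<in> {1..M}" for i using that by (intro Max_ge) auto
qed

lemma ratio_lower: obtains \<rho> where "0 < \<rho>" "\<rho> < 1" "\<And>i. i \<in> {1..M} \<Longrightarrow> \<rho> \<le> \<bar>r i\<bar>"
proof (rule that)
  let ?S = "(\<lambda>i. \<bar>r i\<bar>) ` {1..M}"
  have "?S \<noteq> {}" using M_ge_2 by auto
  then have "Min ?S \<in> ?S" by (intro Min_in) auto
  then show "0 < Min ?S" "Min ?S < 1" using r_bounds by auto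
  show "Min ?S \<le> \<bar>r i\<bar>" if "i \<in> {1..M}" for i using that by (intro Min_le) auto
qed

lemma gap: obtains g where "0 < g"
  "\<And>i j x y. i \<in> {1..M} \<Longrightarrow> j \<in> {1..M} \<Longrightarrow> i \<noteq> j \<Longrightarrow> x \<in> K \<Longrightarrow> y \<in> K \<Longrightarrow>
     g \<le> \<bar>(r i * x + t i) - (r j * y + t j)\<bar>"
proof -
  let ?F = "\<lambda>i. (\<lambda>x. r i * x + t i) ` {0..a}"
  let ?P = "{(i, j). i \<in> {1..M} \<and> j \<in> {1..M} \<and> i \<noteq> j}"
  have "\<exists>d>0. \<forall>x\<in>?F i. \<forall>y\<in>?F j. d \<le> dist x y" if "(i, j) \<in> ?P" for i j
  proof (rule separate_compact_closed)
    show "compact (?F i)" "closed (?F j)"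
      by (intro compact_imp_closed compact_continuous_image continuous_intros compact_Icc)+
    show "?F i \<inter> ?F j = {}"
      using that cantor unfolding affine_cantor_set_def disjoint_family_on_def by blast
  qed
  then have "\<forall>p\<in>?P. \<exists>d>0. \<forall>x\<in>?F (fst p). \<forall>y\<in>?F (snd p). d \<le> dist x y" by force
  from bchoice[OF this] obtain d
    where d': "\<forall>p\<in>?P. 0 < d p \<and> (\<forall>x\<in>?F (fst p). \<forall>y\<in>?F (snd p). d p \<le> dist x y)"
    by blast
  note d = d'[rule_format]
  have "?P \<subseteq> {1..M} \<times> {1..M}" by auto
  then have fin: "finite ?P" by (rule finite_subset) auto
  have "(1, 2) \<in> ?P" using M_ge_2 by simp
  then have ne: "?P \<noteq> {}" by blast
  show ?thesis
  proof (rule that)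
    show "0 < Min (d ` ?P)" using fin ne d by (subst Min_gr_iff) auto
    fix i j x y assume h: "i \<in> {1..M}" "j \<in> {1..M}" "i \<noteq> j" "x \<in> K" "y \<in> K"
    have "Min (d ` ?P) \<le> d (i, j)" using fin h by (intro Min_le) auto
    also have "\<dots> \<le> dist (r i * x + t i) (r j * y + t j)"
      using d[of "(i, j)"] h K_sub by auto
    finally show "Min (d ` ?P) \<le> \<bar>(r i * x + t i) - (r j * y + t j)\<bar>"
      by (simp add: dist_real_def)
  qed
qed

definition word_map :: "nat list \<Rightarrow> real \<Rightarrow> real" where
  "word_map w x = foldr (\<lambda>i y. r i * y + t i) w x"

definition word_ratio :: "nat list \<Rightarrow> real" where
  "word_ratio w = prod_list (map r w)"

definition words :: "nat \<Rightarrow> nat list set" where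
  "words n = {w. set w \<subseteq> {1..M} \<and> length w = n}"

lemma word_map_simps [simp]: "word_map [] x = x" "word_map (i # w) x = r i * word_map w x + t i"
  "word_map (v @ w) x = word_map v (word_map w x)"
  by (simp_all add: word_map_def)

lemma word_ratio_simps [simp]: "word_ratio [] = 1" "word_ratio (i # w) = r i * word_ratio w"
  "word_ratio (v @ w) = word_ratio v * word_ratio w"
  by (simp_all add: word_ratio_def)

lemma word_map_affine: "word_map w x = word_ratio w * x + word_map w 0"
  by (induction w) (auto simp: algebra_simps)

lemma word_map_in: "set w \<subseteq> {1..M} \<Longrightarrow> x \<in> K \<Longrightarrow> word_map w x \<in> K"
  by (induction w) (auto simp: K_step)

lemma word_ratio_nz: "set w \<subseteq> {1..M} \<Longrightarrow> word_ratio w \<noteq> 0"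
  using r_bounds by (induction w) force+

lemma word_ratio_le:
  assumes "0 < \<kappa>" "\<And>i. i \<in> {1..M} \<Longrightarrow> \<bar>r i\<bar> \<le> \<kappa>" "set w \<subseteq> {1..M}"
  shows "\<bar>word_ratio w\<bar> \<le> \<kappa> ^ length w"
  using assms(3)
proof (induction w)
  case (Cons i w)
  have "\<bar>r i\<bar> * \<bar>word_ratio w\<bar> \<le> \<kappa> * \<kappa> ^ length w"
    using Cons assms by (intro mult_mono) auto
  then show ?case by (simp add: abs_mult)
qed simp

lemma word_gap: obtains h where "0 < h"
  "\<forall>v\<in>words n. \<forall>w\<in>words n. \<forall>x\<in>K. \<forall>y\<in>K. v \<noteq> w \<longrightarrow> h \<le> \<bar>word_map v x - word_map w y\<bar>"
proof -
  obtain \<rho> where \<rho>: "0 < \<rho>" "\<rho> < 1" "\<And>i. i \<in> {1..M} \<Longrightarrow> \<rho> \<le> \<bar>r i\<bar>"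
    using ratio_lower by blast
  obtain g where g: "0 < g"
    "\<And>i j x y. i \<in> {1..M} \<Longrightarrow> j \<in> {1..M} \<Longrightarrow> i \<noteq> j \<Longrightarrow> x \<in> K \<Longrightarrow> y \<in> K \<Longrightarrow>
       g \<le> \<bar>(r i * x + t i) - (r j * y + t j)\<bar>"
    using gap by metis
  have main: "g * \<rho> ^ length v \<le> \<bar>word_map v x - word_map w y\<bar>"
    if "length v = length w" "set v \<subseteq> {1..M}" "set w \<subseteq> {1..M}" "v \<noteq> w" and xy: "x \<in> K" "y \<in> K" for v w x y
    using that(1-4)
  proof (induction v w rule: list_induct2)
    case (Cons i v j w)
    show ?case
    proof (cases "i = j")
      case True
      have "g * \<rho> ^ length (i # v) = \<rho> * (g * \<rho> ^ length v)" by simp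
      also have "\<dots> \<le> \<bar>r i\<bar> * \<bar>word_map v x - word_map w y\<bar>"
        using Cons True g \<rho> by (intro mult_mono) auto
      also have "\<dots> = \<bar>word_map (i # v) x - word_map (j # w) y\<bar>"
        using True by (simp add: abs_mult[symmetric] algebra_simps)
      finally show ?thesis .
    next
      case False
      have "\<rho> ^ length (i # v) \<le> 1" using \<rho> by (intro power_le_one) auto
      then have "g * \<rho> ^ length (i # v) \<le> g" using g(1) by (simp add: mult_left_le)
      also have "\<dots> \<le> \<bar>word_map (i # v) x - word_map (j # w) y\<bar>"
        using g(2)[of i j "word_map v x" "word_map w y"] False Cons.prems xy
        by (simp add: word_map_in)
      finally show ?thesis .
    qed
  qed simp
  show ?thesis
  proof (rule that[of "g * \<rho> ^ n"])
    show "0 < g * \<rho> ^ n" using g \<rho> by simp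
    show "\<forall>v\<in>words n. \<forall>w\<in>words n. \<forall>x\<in>K. \<forall>y\<in>K. v \<noteq> w \<longrightarrow>
        g * \<rho> ^ n \<le> \<bar>word_map v x - word_map w y\<bar>"
      using main unfolding words_def by force
  qed
qed

text \<open>
  The sum is \<open>M \<ge> 2\<close> at exponent \<open>0\<close> and at most \<open>1\<close> for large exponents.
\<close>
lemma similarity_dim_exists: "\<exists>s>0. (\<Sum>i\<in>{1..M}. \<bar>r i\<bar> powr s) = 1"
proof -
  obtain \<kappa> where \<kappa>: "0 < \<kappa>" "\<kappa> < 1" "\<And>i. i \<in> {1..M} \<Longrightarrow> \<bar>r i\<bar> \<le> \<kappa>"
    using ratio_upper by blast
  obtain n where n: "\<kappa> ^ n < 1 / real M"
    using real_arch_pow_inv[of "1 / real M" \<kappa>] \<kappa> M_ge_2 by auto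
  let ?f = "\<lambda>s. \<Sum>i\<in>{1..M}. \<bar>r i\<bar> powr s"
  have "?f (real n) \<le> (\<Sum>i\<in>{1..M}. \<kappa> ^ n)"
  proof (rule sum_mono)
    fix i assume i: "i \<in> {1..M}"
    have "\<bar>r i\<bar> powr real n \<le> \<kappa> powr real n" using \<kappa> i by (intro powr_mono2) auto
    then show "\<bar>r i\<bar> powr real n \<le> \<kappa> ^ n" using \<kappa> by (simp add: powr_realpow)
  qed
  also have "\<dots> \<le> 1" using n M_ge_2 by (simp add: field_simps)
  finally have "?f (real n) \<le> 1" .
  moreover have f0: "?f 0 = real M"
  proof -
    have "?f 0 = (\<Sum>i\<in>{1..M}. 1)" by (rule sum.cong) (use r_bounds in auto)
    then show ?thesis by simp
  qed
  moreover have "continuous_on {0..real n} ?f"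
    using r_bounds by (intro continuous_intros) auto
  ultimately obtain s where s: "0 \<le> s" "?f s = 1"
    using IVT2'[of ?f "real n" 1 0] M_ge_2 by auto
  then have "s \<noteq> 0" using f0 M_ge_2 by auto
  then show ?thesis using s by (intro exI[of _ s]) auto
qed

definition similarity_dim :: real where
  "similarity_dim = (SOME s. 0 < s \<and> (\<Sum>i\<in>{1..M}. \<bar>r i\<bar> powr s) = 1)"

lemma similarity_dim: "0 < similarity_dim" "(\<Sum>i\<in>{1..M}. \<bar>r i\<bar> powr similarity_dim) = 1"
  using someI_ex[OF similarity_dim_exists] unfolding similarity_dim_def by auto

text \<open>
  A net of \<open>K\<close> at scale \<open>\<delta>\<close> is assembled from nets of the pieces, which are nets of \<open>K\<close> at the coarser
  scales \<open>\<delta>/\<bar>r i\<bar>\<close>. The bound \<open>C \<delta>\<^sup>-\<^sup>s\<close> reproduces itself exactly because \<open>\<Sum>\<bar>r i\<bar>\<^sup>s = 1\<close>; the induction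
  starts at scales between \<open>a\<close> and \<open>a/\<rho>\<close>, where one point is a net.
\<close>
lemma net_bounded_K: "net_bounded similarity_dim K"
proof -
  define s where "s = similarity_dim"
  have s: "0 < s" "(\<Sum>i\<in>{1..M}. \<bar>r i\<bar> powr s) = 1" using similarity_dim by (auto simp: s_def)
  obtain \<kappa> where \<kappa>: "0 < \<kappa>" "\<kappa> < 1" "\<And>i. i \<in> {1..M} \<Longrightarrow> \<bar>r i\<bar> \<le> \<kappa>"
    using ratio_upper by blast
  obtain \<rho> where \<rho>: "0 < \<rho>" "\<rho> < 1" "\<And>i. i \<in> {1..M} \<Longrightarrow> \<rho> \<le> \<bar>r i\<bar>"
    using ratio_lower by blast
  define C where "C = (a/\<rho>) powr s"
  have triv: "K \<subseteq> (\<Union>x\<in>{0}. cball x \<delta>)" if "a \<le> \<delta>" for \<delta>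
    using K_sub that by (auto simp: dist_real_def)
  have main: "\<exists>S. finite S \<and> real (card S) \<le> C * \<delta> powr (-s) \<and> K \<subseteq> (\<Union>x\<in>S. cball x \<delta>)"
    if "0 < \<delta>" "\<delta> \<le> a/\<rho>" "a * \<kappa> ^ n \<le> \<delta>" for n \<delta>
    using that
  proof (induction n arbitrary: \<delta>)
    have base: "\<exists>S. finite S \<and> real (card S) \<le> C * \<delta> powr (-s) \<and> K \<subseteq> (\<Union>x\<in>S. cball x \<delta>)"
      if "a \<le> \<delta>" "0 < \<delta>" "\<delta> \<le> a/\<rho>" for \<delta>
    proof -
      have "\<delta> powr s \<le> C" unfolding C_def using that s by (intro powr_mono2) auto
      then have "1 \<le> C * \<delta> powr (-s)" using that by (simp add: powr_minus field_simps)
      then show ?thesis using triv[OF that(1)] by (intro exI[of _ "{0}"]) simp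
    qed
    {
      case 0
      then show ?case using base by simp
    next
      case (Suc n)
      show ?case
      proof (cases "a \<le> \<delta>")
        case True
        then show ?thesis using base Suc.prems by blast
      next
        case False
        have "\<exists>S. finite S \<and> real (card S) \<le> C * (\<delta>/\<bar>r i\<bar>) powr (-s) \<and> K \<subseteq> (\<Union>x\<in>S. cball x (\<delta>/\<bar>r i\<bar>))"
          if i: "i \<in> {1..M}" for i
        proof (rule Suc.IH)
          have ri: "0 < \<bar>r i\<bar>" using r_bounds[OF i] by simp
          show "0 < \<delta>/\<bar>r i\<bar>" using Suc.prems ri by simp
          show "\<delta>/\<bar>r i\<bar> \<le> a/\<rho>"
            using False Suc.prems \<rho>(1) \<rho>(3)[OF i] a_pos by (intro frac_le) auto
          have "a * \<kappa> ^ n * \<bar>r i\<bar> \<le> a * \<kappa> ^ n * \<kappa>"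
            using \<kappa> i a_pos by (intro mult_left_mono) auto
          also have "\<dots> \<le> \<delta>" using Suc.prems by (simp add: algebra_simps)
          finally show "a * \<kappa> ^ n \<le> \<delta>/\<bar>r i\<bar>" using ri by (simp add: field_simps)
        qed
        then obtain S where S: "\<And>i. i \<in> {1..M} \<Longrightarrow> finite (S i) \<and>
            real (card (S i)) \<le> C * (\<delta>/\<bar>r i\<bar>) powr (-s) \<and> K \<subseteq> (\<Union>x\<in>S i. cball x (\<delta>/\<bar>r i\<bar>))"
          by metis
        define T where "T = (\<Union>i\<in>{1..M}. (\<lambda>x. r i * x + t i) ` S i)"
        have "real (card T) \<le> real (\<Sum>i\<in>{1..M}. card (S i))"
          unfolding T_def using S
          by (intro of_nat_mono order_trans[OF card_UN_le] sum_mono card_image_le) auto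
        also have "\<dots> \<le> (\<Sum>i\<in>{1..M}. C * (\<delta>/\<bar>r i\<bar>) powr (-s))"
          unfolding of_nat_sum using S by (intro sum_mono) blast
        also have "\<dots> = (\<Sum>i\<in>{1..M}. C * \<delta> powr (-s) * \<bar>r i\<bar> powr s)"
          using Suc.prems r_bounds by (intro sum.cong refl) (force simp: powr_divide powr_minus field_simps)
        also have "\<dots> = C * \<delta> powr (-s)"
          using s(2) by (simp flip: sum_distrib_left)
        finally have "real (card T) \<le> C * \<delta> powr (-s)" .
        moreover have "K \<subseteq> (\<Union>x\<in>T. cball x \<delta>)"
        proof
          fix x assume "x \<in> K"
          then obtain i y where i: "i \<in> {1..M}" "y \<in> K" "x = r i * y + t i" by (rule K_cases)
          then obtain z where z: "z \<in> S i" "dist z y \<le> \<delta>/\<bar>r i\<bar>" using S[OF i(1)] by auto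
          have "dist (r i * z + t i) x = \<bar>r i\<bar> * dist z y"
            by (simp add: i dist_real_def abs_mult[symmetric] algebra_simps)
          also have "\<dots> \<le> \<delta>" using z r_bounds[OF i(1)] by (simp add: field_simps)
          finally show "x \<in> (\<Union>x\<in>T. cball x \<delta>)" using z(1) i(1) unfolding T_def by force
        qed
        moreover have "finite T" unfolding T_def using S by auto
        ultimately show ?thesis by blast
      qed
    }
  qed
  have "\<exists>S. finite S \<and> real (card S) \<le> max 1 C * \<delta> powr (-s) \<and> K \<subseteq> (\<Union>x\<in>S. cball x \<delta>)"
    if \<delta>: "\<delta> \<in> {0<..1}" for \<delta>
  proof (cases "\<delta> \<le> a/\<rho>")
    case True
    obtain n where "\<kappa> ^ n < \<delta>/a" using real_arch_pow_inv[of "\<delta>/a" \<kappa>] \<kappa> \<delta> a_pos by auto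
    then have "a * \<kappa> ^ n \<le> \<delta>" using a_pos by (simp add: field_simps)
    moreover have "0 < \<delta>" using \<delta> by simp
    ultimately obtain S where "finite S" "real (card S) \<le> C * \<delta> powr (-s)" "K \<subseteq> (\<Union>x\<in>S. cball x \<delta>)"
      using main[OF _ True] by blast
    moreover have "C * \<delta> powr (-s) \<le> max 1 C * \<delta> powr (-s)" by (intro mult_right_mono) auto
    ultimately show ?thesis by fastforce
  next
    case False
    have "a \<le> a/\<rho>" using \<rho> a_pos by (simp add: field_simps)
    then have "a \<le> \<delta>" using False by simp
    moreover have "1 \<le> max 1 C * \<delta> powr (-s)"
    proof -
      have "\<delta> powr s \<le> 1" using \<delta> s by (simp add: powr_le1)
      then have "1 \<le> \<delta> powr (-s)" using \<delta> by (simp add: powr_minus field_simps)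
      then have "1 * 1 \<le> max 1 C * \<delta> powr (-s)" by (intro mult_mono) auto
      then show ?thesis by simp
    qed
    ultimately show ?thesis using triv by (intro exI[of _ "{0}"]) simp
  qed
  then show ?thesis unfolding net_bounded_def s_def by blast
qed

text \<open>
  The blow-up principle applies to \<open>K\<close> itself with constant weight, since the first-level pieces are
  separated and \<open>\<Sum>\<bar>r i\<bar>\<^sup>s = 1\<close>.
\<close>
lemma similarity_dim_le_hausdorff_dim: "similarity_dim \<le> hausdorff_dim K"
proof -
  obtain \<kappa> where \<kappa>: "0 < \<kappa>" "\<kappa> < 1" "\<And>i. i \<in> {1..M} \<Longrightarrow> \<bar>r i\<bar> \<le> \<kappa>"
    using ratio_upper by blast
  obtain g where g: "0 < g"
    "\<And>i j x y. i \<in> {1..M} \<Longrightarrow> j \<in> {1..M} \<Longrightarrow> i \<noteq> j \<Longrightarrow> x \<in> K \<Longrightarrow> y \<in> K \<Longrightarrow>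
       g \<le> \<bar>(r i * x + t i) - (r j * y + t j)\<bar>"
    using gap by metis
  have "(g/2) powr similarity_dim \<le> cover_cost similarity_dim L" if "ball_cover K L" for L
  proof -
    have "1 * (g/2) powr similarity_dim \<le> 1 * cover_cost similarity_dim L"
    proof (rule self_reproducing_cover_bound[where X = "{()}" and A = "\<lambda>_. K" and w = "\<lambda>_. 1" and x = "()" and \<kappa> = \<kappa>])
      show "\<exists>(I::nat set) c e y. finite I \<and>
        (\<forall>i\<in>I. y i \<in> {()} \<and> 0 < \<bar>c i\<bar> \<and> \<bar>c i\<bar> \<le> \<kappa> \<and> (\<lambda>z. c i * z + e i) ` K \<subseteq> K) \<and>
        (\<forall>i\<in>I. \<forall>j\<in>I. i \<noteq> j \<longrightarrow> (\<forall>p\<in>K. \<forall>q\<in>K. g \<le> \<bar>(c i * p + e i) - (c j * q + e j)\<bar>)) \<and>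
        (1::real) \<le> (\<Sum>i\<in>I. \<bar>c i\<bar> powr similarity_dim * 1)"
        using \<kappa> r_bounds K_step g(2) similarity_dim(2)
        by (intro exI[of _ "{1..M}"] exI[of _ r] exI[of _ t] exI[of _ "\<lambda>_. ()"]) auto
    qed (use g \<kappa> that similarity_dim K_ne in auto)
    then show ?thesis by simp
  qed
  then show ?thesis
    using g similarity_dim(1) by (intro hausdorff_dim_ge[OF compact_K, of _ "(g/2) powr similarity_dim"]) auto
qed

lemma small_cylinder:
  assumes "0 < \<rho>" "\<And>i. i \<in> {1..M} \<Longrightarrow> \<rho> \<le> \<bar>r i\<bar>" "x \<in> K" "0 < \<delta>" "\<delta> \<le> 1"
  obtains u y where "set u \<subseteq> {1..M}" "u \<noteq> []" "y \<in> K" "x = word_map u y"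
    "\<rho> * \<delta> \<le> \<bar>word_ratio u\<bar>" "\<bar>word_ratio u\<bar> \<le> \<delta>"
proof -
  obtain \<kappa> where \<kappa>: "0 < \<kappa>" "\<kappa> < 1" "\<And>i. i \<in> {1..M} \<Longrightarrow> \<bar>r i\<bar> \<le> \<kappa>"
    using ratio_upper by blast
  have main: "\<exists>u y. set u \<subseteq> {1..M} \<and> u \<noteq> [] \<and> y \<in> K \<and> x = word_map u y \<and>
      \<rho> * \<delta> \<le> \<bar>word_ratio u\<bar> \<and> \<bar>word_ratio u\<bar> \<le> \<delta>" if "x \<in> K" "0 < \<delta>" "\<delta> \<le> 1" "\<kappa> ^ n \<le> \<delta>" for n x \<delta>
    using that
  proof (induction n arbitrary: x \<delta>)
    have base: "\<exists>u y. set u \<subseteq> {1..M} \<and> u \<noteq> [] \<and> y \<in> K \<and> x = word_map u y \<and>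
      \<rho> * \<delta> \<le> \<bar>word_ratio u\<bar> \<and> \<bar>word_ratio u\<bar> \<le> \<delta>"
      if "i \<in> {1..M}" "y \<in> K" "x = r i * y + t i" "\<bar>r i\<bar> \<le> \<delta>" "\<delta> \<le> 1" for x \<delta> i y
    proof -
      have "\<rho> * \<delta> \<le> \<rho> * 1" using that assms(1) by (intro mult_left_mono) auto
      also have "\<dots> \<le> \<bar>r i\<bar>" using assms(2)[OF that(1)] by simp
      finally show ?thesis using that by (intro exI[of _ "[i]"] exI[of _ y]) auto
    qed
    {
      case 0
      obtain i y where i: "i \<in> {1..M}" "y \<in> K" "x = r i * y + t i" using K_cases[OF 0(1)] .
      show ?case by (rule base[OF i]) (use 0 r_bounds[OF i(1)] in auto)
    next
      case (Suc n)
      obtain i y where i: "i \<in> {1..M}" "y \<in> K" "x = r i * y + t i" using K_cases[OF Suc.prems(1)] .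
      show ?case
      proof (cases "\<bar>r i\<bar> \<le> \<delta>")
        case True
        then show ?thesis using base[OF i] Suc by auto
      next
        case False
        have ri: "0 < \<bar>r i\<bar>" using r_bounds[OF i(1)] by simp
        have "\<kappa> ^ n * \<bar>r i\<bar> \<le> \<kappa> ^ n * \<kappa>" using \<kappa> i by (intro mult_left_mono) auto
        also have "\<dots> \<le> \<delta>" using Suc.prems by (simp add: mult.commute)
        finally have "\<kappa> ^ n \<le> \<delta> / \<bar>r i\<bar>" using ri by (simp add: field_simps)
        moreover have "0 < \<delta> / \<bar>r i\<bar>" "\<delta> / \<bar>r i\<bar> \<le> 1" using ri False Suc.prems by auto
        ultimately obtain u z where u: "set u \<subseteq> {1..M}" "z \<in> K" "y = word_map u z"
          "\<rho> * (\<delta> / \<bar>r i\<bar>) \<le> \<bar>word_ratio u\<bar>" "\<bar>word_ratio u\<bar> \<le> \<delta> / \<bar>r i\<bar>"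
          using Suc.IH[OF i(2)] by blast
        then have "\<rho> * \<delta> \<le> \<bar>word_ratio (i # u)\<bar>" "\<bar>word_ratio (i # u)\<bar> \<le> \<delta>"
          using ri by (auto simp: abs_mult field_simps)
        then show ?thesis using u i by (intro exI[of _ "i # u"] exI[of _ z]) auto
      qed
    }
  qed
  obtain n where "\<kappa> ^ n < \<delta>" using real_arch_pow_inv[of \<delta> \<kappa>] \<kappa> assms by auto
  then show ?thesis using main[OF assms(3-5), of n] that by auto
qed

lemma homogeneous_ratio_of_words:
  assumes V: "finite V" "\<And>w. w \<in> V \<Longrightarrow> set w \<subseteq> {1..M} \<and> length w = m \<and> word_ratio w = R"
    and R: "0 < R" "R < 1" and card: "1 \<le> real (card V) * R powr \<sigma>"
  shows "homogeneous_ratio K \<sigma> R"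
proof -
  obtain h where h: "0 < h"
    "\<forall>v\<in>words m. \<forall>w\<in>words m. \<forall>x\<in>K. \<forall>y\<in>K. v \<noteq> w \<longrightarrow> h \<le> \<bar>word_map v x - word_map w y\<bar>"
    using word_gap[of m] .
  have sep: "h \<le> \<bar>(R * x + word_map v 0) - (R * y + word_map w 0)\<bar>"
    if "v \<in> V" "w \<in> V" "v \<noteq> w" "x \<in> K" "y \<in> K" for v w x y
  proof -
    have "v \<in> words m" "w \<in> words m" using V(2) that(1,2) by (auto simp: words_def)
    then have "h \<le> \<bar>word_map v x - word_map w y\<bar>" using h(2) that by blast
    then show ?thesis
      using V(2)[OF that(1)] V(2)[OF that(2)] word_map_affine[of v x] word_map_affine[of w y] by simp
  qed
  obtain x0 where x0: "x0 \<in> K" using K_ne by blast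
  have "inj_on (\<lambda>w. word_map w 0) V"
  proof (rule inj_onI, rule ccontr)
    fix v w assume vw: "v \<in> V" "w \<in> V" "word_map v 0 = word_map w 0" "v \<noteq> w"
    then show False using sep[OF vw(1,2,4) x0 x0] h(1) by simp
  qed
  then have c: "card ((\<lambda>w. word_map w 0) ` V) = card V" by (rule card_image)
  show ?thesis
    unfolding homogeneous_ratio_def
  proof (intro conjI exI[of _ "(\<lambda>w. word_map w 0) ` V"] exI[of _ h] ballI impI)
    fix b x assume "b \<in> (\<lambda>w. word_map w 0) ` V" "x \<in> K"
    then obtain w where w: "w \<in> V" "b = word_map w 0" by blast
    then have "R * x + b = word_map w x" using V(2)[OF w(1)] word_map_affine[of w x] by simp
    then show "R * x + b \<in> K" using V(2)[OF w(1)] word_map_in[of w x] \<open>x \<in> K\<close> by simp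
  next
    fix b b' x y assume "b \<in> (\<lambda>w. word_map w 0) ` V" "b' \<in> (\<lambda>w. word_map w 0) ` V"
      and xy: "x \<in> K" "y \<in> K" and ne: "b \<noteq> b'"
    then obtain v w where vw: "v \<in> V" "w \<in> V" "b = word_map v 0" "b' = word_map w 0" by blast
    then have "v \<noteq> w" using ne by blast
    then show "h \<le> \<bar>R * x + b - (R * y + b')\<bar>" using sep[OF vw(1,2) _ xy] vw by simp
  qed (use V R h card c in auto)
qed

lemma sum_words: "(\<Sum>w\<in>words n. \<bar>word_ratio w\<bar> powr similarity_dim) = 1"
proof (induction n)
  case 0
  have "words 0 = {[]}" by (auto simp: words_def)
  then show ?case by simp
next
  case (Suc n)
  have eq: "words (Suc n) = (\<lambda>(i, w). i # w) ` ({1..M} \<times> words n)"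
  proof (intro equalityI subsetI)
    fix w assume w: "w \<in> words (Suc n)"
    then obtain i v where "w = i # v" by (cases w) (auto simp: words_def)
    then show "w \<in> (\<lambda>(i, w). i # w) ` ({1..M} \<times> words n)"
      using w by (intro image_eqI[of _ _ "(i, v)"]) (auto simp: words_def)
  qed (auto simp: words_def)
  have "(\<Sum>w\<in>words (Suc n). \<bar>word_ratio w\<bar> powr similarity_dim) =
      (\<Sum>(i, w)\<in>{1..M} \<times> words n. \<bar>r i\<bar> powr similarity_dim * \<bar>word_ratio w\<bar> powr similarity_dim)"
    unfolding eq by (subst sum.reindex) (auto simp: inj_on_def abs_mult powr_mult intro!: sum.cong)
  also have "\<dots> = (\<Sum>i\<in>{1..M}. \<bar>r i\<bar> powr similarity_dim * 1)"
    by (simp add: Suc flip: sum.cartesian_product sum_distrib_left)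
  finally show ?case using similarity_dim(2) by simp
qed

lemma finite_words: "finite (words n)"
  unfolding words_def by (rule finite_lists_length_eq) simp

text \<open>
  A word ratio depends only on how often each letter occurs. Words of length \<open>n\<close> therefore have only
  polynomially many different ratios.
\<close>
lemma card_word_ratios: "card (word_ratio ` words n) \<le> (n + 1) ^ M"
proof -
  have eq: "word_ratio w = (\<Prod>i\<in>{1..M}. r i ^ count_list w i)" if "set w \<subseteq> {1..M}" for w
    using that
  proof (induction w)
    case (Cons j w)
    have "(\<Prod>i\<in>{1..M}. r i ^ count_list (j # w) i) =
        (\<Prod>i\<in>{1..M}. (if i = j then r i else 1) * r i ^ count_list w i)"
      by (rule prod.cong) auto
    then show ?case using Cons by (simp add: prod.distrib prod.delta)
  qed simp
  let ?P = "PiE {1..M} (\<lambda>_. {..n})"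
  have "word_ratio ` words n \<subseteq> (\<lambda>c. \<Prod>i\<in>{1..M}. r i ^ c i) ` ?P"
  proof
    fix z assume "z \<in> word_ratio ` words n"
    then obtain w where w: "z = word_ratio w" "set w \<subseteq> {1..M}" "length w = n" by (auto simp: words_def)
    have "restrict (count_list w) {1..M} \<in> ?P"
      using w count_le_length by fastforce
    moreover have "z = (\<Prod>i\<in>{1..M}. r i ^ restrict (count_list w) {1..M} i)"
      unfolding w(1) eq[OF w(2)] by (rule prod.cong) auto
    ultimately show "z \<in> (\<lambda>c. \<Prod>i\<in>{1..M}. r i ^ c i) ` ?P" by blast
  qed
  moreover have "finite ?P" by (intro finite_PiE) auto
  ultimately have "card (word_ratio ` words n) \<le> card ?P" by (rule surj_card_le[rotated])
  also have "\<dots> = (n + 1) ^ M" by (simp add: card_PiE)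
  finally show ?thesis .
qed

text \<open>
  The weights \<open>\<bar>word_ratio w\<bar>\<^sup>s\<close> of the words of length \<open>n\<close> sum to \<open>1\<close> and fall into polynomially many
  classes of equal ratio, so some class has weight at least \<open>1/(n+1)\<^sup>M\<close>. Lowering the exponent to
  \<open>\<sigma>\<close> gains a factor exponential in \<open>n\<close>, which beats any constant \<open>Z\<close>.
\<close>
lemma many_words_of_equal_ratio:
  assumes "\<sigma> < similarity_dim"
  obtains n \<rho> where "0 < n" "\<rho> \<noteq> 0" "\<bar>\<rho>\<bar> < 1" "Z \<le> real (card {w \<in> words n. word_ratio w = \<rho>}) * \<bar>\<rho>\<bar> powr \<sigma>"
proof -
  define s where "s = similarity_dim"
  obtain \<kappa> where \<kappa>: "0 < \<kappa>" "\<kappa> < 1" "\<And>i. i \<in> {1..M} \<Longrightarrow> \<bar>r i\<bar> \<le> \<kappa>"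
    using ratio_upper by blast
  define q where "q = \<kappa> powr (s - \<sigma>)"
  have q: "0 < q" "q < 1"
    using \<kappa> assms powr_less_mono2[of "s - \<sigma>" \<kappa> 1] by (auto simp: q_def s_def)
  have "(\<lambda>n. (real n + 1) ^ M * q ^ n) \<longlonglongrightarrow> 0"
  proof -
    \<comment> \<open>The sequence is the \<open>M\<close>-th power of \<open>(n + 1) p^n\<close>, which tends to zero.\<close>
    define p where "p = root M q"
    have p: "0 < p" "p < 1" "p ^ M = q" using q M_ge_2 by (auto simp: p_def)
    have "(\<lambda>n. (real n * p ^ n + p ^ n) ^ M) \<longlonglongrightarrow> (0 + 0) ^ M"
      using p by (intro tendsto_power tendsto_add powser_times_n_limit_0 LIMSEQ_power_zero) auto
    moreover have "(real n * p ^ n + p ^ n) ^ M = (real n + 1) ^ M * q ^ n" for n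
    proof -
      have "(real n * p ^ n + p ^ n) ^ M = ((real n + 1) * p ^ n) ^ M" by (simp add: algebra_simps)
      also have "\<dots> = (real n + 1) ^ M * (p ^ M) ^ n"
        by (simp add: power_mult_distrib mult.commute flip: power_mult)
      finally show ?thesis using p by simp
    qed
    ultimately show ?thesis using M_ge_2 by (simp add: power_0_left)
  qed
  then have "eventually (\<lambda>n. (real n + 1) ^ M * q ^ n < 1 / max 1 Z) sequentially"
    by (intro order_tendstoD) auto
  then have "eventually (\<lambda>n. (real n + 1) ^ M * q ^ n < 1 / max 1 Z \<and> 0 < n) sequentially"
    using eventually_gt_at_top[of 0] by eventually_elim auto
  from eventually_happens'[OF sequentially_bot this]
  obtain n where n: "(real n + 1) ^ M * q ^ n < 1 / max 1 Z" "0 < n"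
    by blast
  define N where "N \<rho> = real (card {w \<in> words n. word_ratio w = \<rho>})" for \<rho>
  have "1 = (\<Sum>w\<in>words n. \<bar>word_ratio w\<bar> powr s)" using sum_words by (simp add: s_def)
  also have "\<dots> = (\<Sum>\<rho>\<in>word_ratio ` words n. \<Sum>w\<in>{w \<in> words n. word_ratio w = \<rho>}. \<bar>word_ratio w\<bar> powr s)"
    by (rule sum.image_gen[OF finite_words])
  also have "\<dots> = (\<Sum>\<rho>\<in>word_ratio ` words n. N \<rho> * \<bar>\<rho>\<bar> powr s)"
    by (rule sum.cong) (auto simp: N_def)
  finally have sum1: "(\<Sum>\<rho>\<in>word_ratio ` words n. N \<rho> * \<bar>\<rho>\<bar> powr s) = 1" by simp
  have "\<exists>\<rho>\<in>word_ratio ` words n. 1 / (real n + 1) ^ M \<le> N \<rho> * \<bar>\<rho>\<bar> powr s"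
  proof (rule ccontr)
    assume "\<not> ?thesis"
    then have lt: "\<And>\<rho>. \<rho> \<in> word_ratio ` words n \<Longrightarrow> N \<rho> * \<bar>\<rho>\<bar> powr s < 1 / (real n + 1) ^ M" by force
    have ne: "word_ratio ` words n \<noteq> {}" using sum1 by auto
    have "(\<Sum>\<rho>\<in>word_ratio ` words n. N \<rho> * \<bar>\<rho>\<bar> powr s) < (\<Sum>\<rho>\<in>word_ratio ` words n. 1 / (real n + 1) ^ M)"
      using lt ne finite_words by (intro sum_strict_mono) auto
    also have "\<dots> = real (card (word_ratio ` words n)) / (real n + 1) ^ M" by simp
    also have "\<dots> \<le> real ((n + 1) ^ M) / (real n + 1) ^ M"
      using card_word_ratios by (intro divide_right_mono of_nat_mono) auto
    also have "\<dots> = 1" by (simp add: add.commute)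
    finally show False using sum1 by simp
  qed
  then obtain w where w: "w \<in> words n" "1 / (real n + 1) ^ M \<le> N (word_ratio w) * \<bar>word_ratio w\<bar> powr s" by blast
  define \<rho> where "\<rho> = word_ratio w"
  have "\<rho> \<noteq> 0" using w word_ratio_nz by (auto simp: \<rho>_def words_def)
  have \<rho>_le: "\<bar>\<rho>\<bar> \<le> \<kappa> ^ n" using word_ratio_le[OF \<kappa>(1) \<kappa>(3)] w by (auto simp: \<rho>_def words_def)
  also have "\<kappa> ^ n < 1" using \<kappa> n(2) by (simp add: power_less_one_iff)
  finally have "\<bar>\<rho>\<bar> < 1" .
  have "\<bar>\<rho>\<bar> powr (s - \<sigma>) \<le> (\<kappa> ^ n) powr (s - \<sigma>)"
    using \<rho>_le assms by (intro powr_mono2) (auto simp: s_def)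
  also have "\<dots> = q ^ n"
    using \<kappa> by (simp add: q_def powr_powr powr_realpow[symmetric] mult.commute)
  finally have "\<bar>\<rho>\<bar> powr (s - \<sigma>) \<le> q ^ n" .
  moreover have "\<bar>\<rho>\<bar> powr s = \<bar>\<rho>\<bar> powr \<sigma> * \<bar>\<rho>\<bar> powr (s - \<sigma>)" by (simp flip: powr_add)
  ultimately have "N \<rho> * \<bar>\<rho>\<bar> powr s \<le> N \<rho> * (\<bar>\<rho>\<bar> powr \<sigma> * q ^ n)"
    by (simp add: N_def mult_left_mono)
  then have "1 / (real n + 1) ^ M \<le> N \<rho> * \<bar>\<rho>\<bar> powr \<sigma> * q ^ n"
    using w(2) by (simp add: \<rho>_def mult.assoc)
  then have "1 \<le> N \<rho> * \<bar>\<rho>\<bar> powr \<sigma> * ((real n + 1) ^ M * q ^ n)"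
    by (simp add: field_simps)
  also have "\<dots> \<le> N \<rho> * \<bar>\<rho>\<bar> powr \<sigma> * (1 / max 1 Z)"
    using n(1) by (intro mult_left_mono) (auto simp: N_def)
  finally have "max 1 Z \<le> N \<rho> * \<bar>\<rho>\<bar> powr \<sigma>" by (simp add: field_simps)
  then have "Z \<le> N \<rho> * \<bar>\<rho>\<bar> powr \<sigma>" by simp
  then show ?thesis using that[of n \<rho>] n \<open>\<rho> \<noteq> 0\<close> \<open>\<bar>\<rho>\<bar> < 1\<close> by (simp add: N_def)
qed

text \<open>
  Words of equal ratio \<open>\<rho>\<close> are paired to make the ratio \<open>\<rho>\<^sup>2\<close> positive; appending the letter \<open>i\<close> twice
  changes the ratio by \<open>(r i)\<^sup>2\<close> at the cost of a constant factor in the cardinality bound, for which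
  the constant \<open>Z\<close> makes room. Having both ratios available allows an incommensurable pair to be
  selected later.
\<close>
lemma homogeneous_ratio_exists:
  assumes "0 \<le> \<sigma>" "\<sigma> < similarity_dim" "i \<in> {1..M}"
  obtains R where "homogeneous_ratio K \<sigma> R" "homogeneous_ratio K \<sigma> (R * (r i)\<^sup>2)"
proof -
  \<comment> \<open>Two words of the class are concatenated, so \<open>Z\<close> enters squared and makes up for the two letters \<open>i\<close>.\<close>
  define Z where "Z = max 1 (\<bar>r i\<bar> powr (-\<sigma>))"
  obtain n \<rho> where n: "0 < n" "\<rho> \<noteq> 0" "\<bar>\<rho>\<bar> < 1" "Z \<le> real (card {w \<in> words n. word_ratio w = \<rho>}) * \<bar>\<rho>\<bar> powr \<sigma>"
    using many_words_of_equal_ratio[OF assms(2)] .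
  define U where "U = {w \<in> words n. word_ratio w = \<rho>}"
  have fU: "finite U" unfolding U_def using finite_words by simp
  have main: "homogeneous_ratio K \<sigma> (\<rho>\<^sup>2 * (r i) ^ (2 * k))" if "k \<le> 1" for k
  proof (rule homogeneous_ratio_of_words)
    let ?z = "replicate (2 * k) i"
    let ?V = "(\<lambda>(v, w). v @ w @ ?z) ` (U \<times> U)"
    have rz: "word_ratio (replicate m i) = r i ^ m" for m by (induction m) auto
    show "finite ?V" using fU by simp
    show "set w \<subseteq> {1..M} \<and> length w = 2 * n + 2 * k \<and> word_ratio w = \<rho>\<^sup>2 * (r i) ^ (2 * k)" if wV: "w \<in> ?V" for w
    proof -
      obtain v u where w: "w = v @ u @ ?z" and "v \<in> U" "u \<in> U" using wV by auto
      then have "set v \<subseteq> {1..M}" "set u \<subseteq> {1..M}" "length v = n" "length u = n"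
        "word_ratio v = \<rho>" "word_ratio u = \<rho>" by (auto simp: U_def words_def)
      then show ?thesis
        using assms(3) by (simp add: w rz power2_eq_square set_replicate_conv_if)
    qed
    have ri: "0 < \<bar>r i\<bar>" "\<bar>r i\<bar> < 1" using r_bounds[OF assms(3)] by auto
    have p1: "(r i) ^ (2 * k) = \<bar>r i\<bar> ^ (2 * k)" by (simp add: power_mult)
    have p2: "\<bar>r i\<bar> ^ (2 * k) \<le> 1" using ri by (intro power_le_one) auto
    show "0 < \<rho>\<^sup>2 * (r i) ^ (2 * k)" using n ri unfolding p1 by simp
    have "\<rho>\<^sup>2 < 1" using n by (simp add: abs_square_less_1)
    then have "\<rho>\<^sup>2 * \<bar>r i\<bar> ^ (2 * k) < 1" using p2 by (smt (verit) mult_left_le zero_le_power2)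
    then show "\<rho>\<^sup>2 * (r i) ^ (2 * k) < 1" unfolding p1 .
    have "inj_on (\<lambda>(v, w). v @ w @ ?z) (U \<times> U)" by (auto simp: inj_on_def U_def words_def)
    then have cV: "card ?V = card U * card U" by (simp add: card_image card_cartesian_product)
    have "1 \<le> (Z * \<bar>r i\<bar> powr \<sigma>) * (Z * \<bar>r i\<bar> powr \<sigma>)"
    proof -
      have "1 = \<bar>r i\<bar> powr (-\<sigma>) * \<bar>r i\<bar> powr \<sigma>" using ri by (simp flip: powr_add)
      also have "\<dots> \<le> Z * \<bar>r i\<bar> powr \<sigma>" by (intro mult_right_mono) (auto simp: Z_def)
      finally show ?thesis by (metis mult_mono mult_1 zero_le_one order_trans)
    qed
    also have "\<dots> = Z * Z * (\<bar>r i\<bar> powr (2 * \<sigma>))" by (simp add: powr_add[symmetric] ac_simps)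
    also have "\<dots> \<le> Z * Z * (\<bar>r i\<bar> powr (real (2 * k) * \<sigma>))"
    proof (intro mult_left_mono powr_mono')
      have "real k * \<sigma> \<le> 1 * \<sigma>" using that assms(1) by (intro mult_right_mono) auto
      then show "real (2 * k) * \<sigma> \<le> 2 * \<sigma>" by simp
    qed (use ri in \<open>auto simp: Z_def\<close>)
    also have "\<dots> \<le> (real (card U) * \<bar>\<rho>\<bar> powr \<sigma>) * (real (card U) * \<bar>\<rho>\<bar> powr \<sigma>) * (\<bar>r i\<bar> powr (real (2 * k) * \<sigma>))"
      using n(4) by (intro mult_right_mono mult_mono) (auto simp: U_def Z_def)
    also have "\<dots> = real (card ?V) * (\<rho>\<^sup>2 * (r i) ^ (2 * k)) powr \<sigma>"
    proof -
      have "(\<bar>r i\<bar> ^ (2 * k)) powr \<sigma> = \<bar>r i\<bar> powr (real (2 * k) * \<sigma>)"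
        using ri by (simp only: powr_realpow[symmetric] powr_powr)
      moreover have "(\<rho>\<^sup>2) powr \<sigma> = \<bar>\<rho>\<bar> powr \<sigma> * \<bar>\<rho>\<bar> powr \<sigma>"
        by (metis power2_abs power2_eq_square powr_mult abs_ge_zero)
      ultimately show ?thesis unfolding p1 cV by (simp add: powr_mult)
    qed
    finally show "1 \<le> real (card ?V) * (\<rho>\<^sup>2 * (r i) ^ (2 * k)) powr \<sigma>" .
  qed
  show ?thesis using that[of "\<rho>\<^sup>2"] main[of 0] main[of 1] by simp
qed

end

section \<open>Difference sets\<close>

lemma net_bounded_difference:
  assumes "net_bounded s A" "net_bounded s' B"
  shows "net_bounded (s + s') (arith_difference A B)"
proof -
  obtain C where C: "\<And>\<delta>. \<delta> \<in> {0<..1} \<Longrightarrow> \<exists>S. finite S \<and> real (card S) \<le> C * \<delta> powr (-s) \<and>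
     A \<subseteq> (\<Union>x\<in>S. cball x \<delta>)" using assms(1) unfolding net_bounded_def by blast
  obtain C' where C': "\<And>\<delta>. \<delta> \<in> {0<..1} \<Longrightarrow> \<exists>S. finite S \<and> real (card S) \<le> C' * \<delta> powr (-s') \<and>
     B \<subseteq> (\<Union>x\<in>S. cball x \<delta>)" using assms(2) unfolding net_bounded_def by blast
  have "\<exists>S. finite S \<and> real (card S) \<le> (C * C' * 2 powr (s + s')) * \<delta> powr (-(s + s')) \<and>
     arith_difference A B \<subseteq> (\<Union>x\<in>S. cball x \<delta>)" if \<delta>: "\<delta> \<in> {0<..1}" for \<delta>
  proof -
    have h: "\<delta>/2 \<in> {0<..1}" using \<delta> by auto
    obtain S where S: "finite S" "real (card S) \<le> C * (\<delta>/2) powr (-s)" "A \<subseteq> (\<Union>x\<in>S. cball x (\<delta>/2))"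
      using C[OF h] by blast
    obtain S' where S': "finite S'" "real (card S') \<le> C' * (\<delta>/2) powr (-s')" "B \<subseteq> (\<Union>x\<in>S'. cball x (\<delta>/2))"
      using C'[OF h] by blast
    let ?T = "(\<lambda>(x, y). x - y) ` (S \<times> S')"
    have "real (card ?T) \<le> real (card (S \<times> S'))" using S S' by (intro of_nat_mono card_image_le) auto
    also have "\<dots> = real (card S) * real (card S')" by (simp add: card_cartesian_product)
    also have "\<dots> \<le> (C * (\<delta>/2) powr (-s)) * (C' * (\<delta>/2) powr (-s'))"
      using S S' by (intro mult_mono) (auto intro: order_trans[OF of_nat_0_le_iff])
    also have "\<dots> = (C * C' * 2 powr (s + s')) * \<delta> powr (-(s + s'))"
    proof -
      have "\<delta> powr (-(s + s')) = \<delta> powr (-s) * \<delta> powr (-s')" by (simp flip: powr_add)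
      moreover have "(\<delta>/2) powr (-u) = 2 powr u * \<delta> powr (-u)" for u
        using \<delta> by (simp add: powr_divide powr_minus field_simps)
      ultimately show ?thesis by (simp add: powr_add)
    qed
    finally have "real (card ?T) \<le> (C * C' * 2 powr (s + s')) * \<delta> powr (-(s + s'))" .
    moreover have "arith_difference A B \<subseteq> (\<Union>x\<in>?T. cball x \<delta>)"
    proof
      fix z assume "z \<in> arith_difference A B"
      then obtain x y where z: "z = x - y" "x \<in> A" "y \<in> B" by (auto simp: scaled_difference_def)
      obtain u v where uv: "u \<in> S" "dist u x \<le> \<delta>/2" "v \<in> S'" "dist v y \<le> \<delta>/2"
        using S(3) S'(3) z by fastforce
      then have "dist (u - v) z \<le> \<delta>" unfolding z dist_real_def by linarith
      then show "z \<in> (\<Union>x\<in>?T. cball x \<delta>)" using uv by force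
    qed
    moreover have "finite ?T" using S S' by simp
    ultimately show ?thesis by blast
  qed
  then show ?thesis unfolding net_bounded_def by blast
qed

lemma compact_scaled_difference:
  assumes "compact A" "compact B"
  shows "compact (scaled_difference c A B)"
proof -
  have "scaled_difference c A B = (\<lambda>p. fst p - c * snd p) ` (A \<times> B)"
    by (force simp: scaled_difference_def)
  moreover have "compact ((\<lambda>p. fst p - c * snd p) ` (A \<times> B))"
    by (intro compact_continuous_image continuous_intros compact_Times assms)
  ultimately show ?thesis by simp
qed

section \<open>Vanishing content in the incommensurable case\<close>

text \<open>
  For compact sets and positive exponents the content vanishes together with the Hausdorff measure. Unlike the
  measure it is finite on bounded sets, and it is upper semicontinuous.
\<close>
definition ball_content :: "real \<Rightarrow> real set \<Rightarrow> real" where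
  "ball_content s A = Inf (cover_cost s ` {L. ball_cover A L})"

lemma ball_cover_exists: assumes "\<And>x. x \<in> A \<Longrightarrow> \<bar>x\<bar> < B" "0 < B"
  shows "ball_cover A [(0, B)]"
  using assms by (auto simp: ball_cover_def)

lemma ball_cover_exists_bounded: assumes "bounded A" shows "\<exists>L. ball_cover A L"
proof -
  obtain B where "\<And>x. x \<in> A \<Longrightarrow> \<bar>x\<bar> \<le> B" "0 < B"
    using assms by (metis bounded_pos real_norm_def)
  then have "ball_cover A [(0, B + 1)]" by (intro ball_cover_exists) force+
  then show ?thesis by blast
qed

lemma content_le: "ball_cover A L \<Longrightarrow> ball_content s A \<le> cover_cost s L"
  unfolding ball_content_def by (intro cInf_lower bdd_belowI[of _ 0]) auto

lemma content_nonneg: "bounded A \<Longrightarrow> 0 \<le> ball_content s A"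
  unfolding ball_content_def using ball_cover_exists_bounded by (intro cInf_greatest) auto

lemma content_lessD: "bounded A \<Longrightarrow> ball_content s A < v \<Longrightarrow> \<exists>L. ball_cover A L \<and> cover_cost s L < v"
  using cInf_lessD[of "cover_cost s ` {L. ball_cover A L}" v] ball_cover_exists_bounded
  unfolding ball_content_def by auto

lemma hausdorff_measure_eq_0_of_content:
  "0 < s \<Longrightarrow> bounded A \<Longrightarrow> ball_content s A \<le> 0 \<Longrightarrow> hausdorff_measure s A = 0"
  by (rule hausdorff_measure_eq_0I) (auto intro: content_lessD)

lemma content_UN_le:
  fixes B :: "'i \<Rightarrow> real set"
  assumes "finite I" "A \<subseteq> (\<Union>i\<in>I. (\<lambda>z. c i * z + e i) ` B i)"
    and "\<And>i. i \<in> I \<Longrightarrow> c i \<noteq> 0 \<and> bounded (B i)"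
  shows "ball_content s A \<le> (\<Sum>i\<in>I. \<bar>c i\<bar> powr s * ball_content s (B i))"
proof (rule field_le_epsilon)
  fix \<epsilon> :: real assume "0 < \<epsilon>"
  define T where "T = (\<Sum>i\<in>I. \<bar>c i\<bar> powr s) + 1"
  have "0 < T" unfolding T_def by (intro add_nonneg_pos sum_nonneg) auto
  have "\<exists>L. ball_cover (B i) L \<and> cover_cost s L < ball_content s (B i) + \<epsilon>/T" if "i \<in> I" for i
    using assms(3)[OF that] \<open>0 < \<epsilon>\<close> \<open>0 < T\<close> by (intro content_lessD) auto
  then obtain L where L: "\<And>i. i \<in> I \<Longrightarrow> ball_cover (B i) (L i) \<and> cover_cost s (L i) < ball_content s (B i) + \<epsilon>/T"
    by metis
  obtain xs where xs: "set xs = I" "distinct xs" using assms(1) finite_distinct_list by blast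
  define L' where "L' = concat (map (\<lambda>i. scale_cover (c i) (e i) (L i)) xs)"
  have sc: "ball_cover ((\<lambda>z. c i * z + e i) ` B i) (scale_cover (c i) (e i) (L i))" if "i \<in> I" for i
    using L[OF that] assms(3)[OF that] by (intro ball_cover_scale) auto
  have "ball_cover A L'"
    unfolding ball_cover_def
  proof (intro conjI subsetI)
    show "\<forall>q\<in>set L'. 0 < snd q" using sc xs unfolding L'_def ball_cover_def by auto
    fix x assume "x \<in> A"
    then obtain i where i: "i \<in> I" "x \<in> (\<lambda>z. c i * z + e i) ` B i" using assms(2) by blast
    then obtain q where "q \<in> set (scale_cover (c i) (e i) (L i))" "x \<in> ball (fst q) (snd q)"
      using sc[OF i(1)] unfolding ball_cover_def by blast
    then show "x \<in> (\<Union>q\<in>set L'. ball (fst q) (snd q))" using i(1) xs unfolding L'_def by auto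
  qed
  then have "ball_content s A \<le> cover_cost s L'" by (rule content_le)
  also have "cover_cost s L' = (\<Sum>i\<leftarrow>xs. cover_cost s (scale_cover (c i) (e i) (L i)))"
    unfolding L'_def by (induction xs) (auto simp: cover_cost_def)
  also have "\<dots> = (\<Sum>i\<in>I. cover_cost s (scale_cover (c i) (e i) (L i)))"
    using xs by (simp add: sum_list_distinct_conv_sum_set)
  also have "\<dots> = (\<Sum>i\<in>I. \<bar>c i\<bar> powr s * cover_cost s (L i))"
    using L by (intro sum.cong refl cover_cost_scale) (auto simp: ball_cover_def)
  also have "\<dots> \<le> (\<Sum>i\<in>I. \<bar>c i\<bar> powr s * (ball_content s (B i) + \<epsilon>/T))"
    using L by (intro sum_mono mult_left_mono) (auto intro: less_imp_le)
  also have "\<dots> = (\<Sum>i\<in>I. \<bar>c i\<bar> powr s * ball_content s (B i)) + (T - 1) * (\<epsilon>/T)"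
  proof -
    have "(\<Sum>i\<in>I. \<bar>c i\<bar> powr s) = T - 1" by (simp add: T_def)
    then show ?thesis by (simp only: distrib_left sum.distrib sum_distrib_right[symmetric])
  qed
  also have "(T - 1) * (\<epsilon>/T) \<le> \<epsilon>"
    using \<open>0 < T\<close> \<open>0 < \<epsilon>\<close> by (simp add: field_simps)
  finally show "ball_content s A \<le> (\<Sum>i\<in>I. \<bar>c i\<bar> powr s * ball_content s (B i)) + \<epsilon>" by simp
qed

text \<open>
  The finitely many open balls that cover \<open>K - c K'\<close> still cover \<open>K - c' K'\<close> for \<open>c'\<close> close to \<open>c\<close>.
\<close>
lemma content_scaled_difference_usc:
  assumes "compact K" "compact K'" "ball_content s (scaled_difference c K K') < v"
  obtains d where "0 < d" "\<And>c'. \<bar>c' - c\<bar> < d \<Longrightarrow> ball_content s (scaled_difference c' K K') < v"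
proof -
  have cpt: "compact (scaled_difference c K K')" using assms by (intro compact_scaled_difference)
  obtain L where L: "ball_cover (scaled_difference c K K') L" "cover_cost s L < v"
    using content_lessD[OF compact_imp_bounded[OF cpt] assms(3)] by blast
  have "open (\<Union>q\<in>set L. ball (fst q) (snd q))" by auto
  then obtain \<epsilon> where \<epsilon>: "0 < \<epsilon>"
      "(\<Union>x\<in>scaled_difference c K K'. ball x \<epsilon>) \<subseteq> (\<Union>q\<in>set L. ball (fst q) (snd q))"
    using compact_subset_open_imp_ball_epsilon_subset[OF cpt] L(1) unfolding ball_cover_def by metis
  obtain B where B: "\<And>x. x \<in> K' \<Longrightarrow> \<bar>x\<bar> \<le> B" "0 < B"
    using compact_imp_bounded[OF assms(2)] by (metis bounded_pos real_norm_def)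
  show ?thesis
  proof (rule that[of "\<epsilon>/B"])
    show "0 < \<epsilon>/B" using \<epsilon> B by simp
    fix c' assume c': "\<bar>c' - c\<bar> < \<epsilon>/B"
    have "scaled_difference c' K K' \<subseteq> (\<Union>x\<in>scaled_difference c K K'. ball x \<epsilon>)"
    proof
      fix z assume "z \<in> scaled_difference c' K K'"
      then obtain x y where z: "z = x - c' * y" "x \<in> K" "y \<in> K'" by (auto simp: scaled_difference_def)
      have "\<bar>(x - c * y) - z\<bar> = \<bar>c' - c\<bar> * \<bar>y\<bar>" by (simp add: z abs_mult[symmetric] algebra_simps)
      also have "\<dots> \<le> \<bar>c' - c\<bar> * B" using B z by (intro mult_left_mono) auto
      also have "\<dots> < \<epsilon>" using c' B by (simp add: field_simps)
      finally have "z \<in> ball (x - c * y) \<epsilon>" by (simp add: dist_real_def)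
      then show "z \<in> (\<Union>x\<in>scaled_difference c K K'. ball x \<epsilon>)"
        using z by (auto simp: scaled_difference_def)
    qed
    then have "scaled_difference c' K K' \<subseteq> (\<Union>q\<in>set L. ball (fst q) (snd q))" using \<epsilon>(2) by blast
    then have "ball_cover (scaled_difference c' K K') L"
      using L(1) unfolding ball_cover_def by blast
    then show "ball_content s (scaled_difference c' K K') < v"
      using content_le[of _ L s] L(2) by (meson le_less_trans)
  qed
qed

lemma upper_semicontinuous_attains_sup:
  fixes h :: "'a::metric_space \<Rightarrow> real"
  assumes "compact S" "S \<noteq> {}"
    and usc: "\<And>y v. y \<in> S \<Longrightarrow> h y < v \<Longrightarrow> \<exists>d>0. \<forall>y'\<in>S. dist y y' < d \<longrightarrow> h y' < v"
  obtains y where "y \<in> S" "\<And>z. z \<in> S \<Longrightarrow> h z \<le> h y"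
proof (rule ccontr)
  assume *: "\<not> thesis"
  note witness = that
  have "\<exists>z\<in>S. h y < h z" if "y \<in> S" for y
  proof (rule ccontr)
    assume "\<not> (\<exists>z\<in>S. h y < h z)"
    then have "\<And>z. z \<in> S \<Longrightarrow> h z \<le> h y" by force
    then show False using * witness[OF that] by blast
  qed
  then obtain z where z: "\<And>y. y \<in> S \<Longrightarrow> z y \<in> S \<and> h y < h (z y)" by metis
  then have "\<forall>y\<in>S. \<exists>d>0. \<forall>y'\<in>S. dist y y' < d \<longrightarrow> h y' < h (z y)" using usc by blast
  from bchoice[OF this] obtain d
    where d: "\<forall>y\<in>S. 0 < d y \<and> (\<forall>y'\<in>S. dist y y' < d y \<longrightarrow> h y' < h (z y))" by blast
  have "S \<subseteq> (\<Union>y\<in>S. ball y (d y))" using d by auto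
  then obtain F where F: "F \<subseteq> S" "finite F" "S \<subseteq> (\<Union>y\<in>F. ball y (d y))"
    using compactE_image[OF assms(1), of S "\<lambda>y. ball y (d y)"] by auto
  have "F \<noteq> {}" using F assms(2) by auto
  obtain y0 where y0: "y0 \<in> F" "\<And>y. y \<in> F \<Longrightarrow> h (z y) \<le> h (z y0)"
  proof -
    have "Max ((\<lambda>y. h (z y)) ` F) \<in> (\<lambda>y. h (z y)) ` F" using F \<open>F \<noteq> {}\<close> by (intro Max_in) auto
    then obtain y0 where "y0 \<in> F" "h (z y0) = Max ((\<lambda>y. h (z y)) ` F)" by auto
    then show ?thesis using that[of y0] F(2) by (simp add: Max_ge)
  qed
  have "z y0 \<in> S" using z y0 F by blast
  then obtain y1 where "y1 \<in> F" "dist y1 (z y0) < d y1" using F(3) by auto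
  then have "h (z y0) < h (z y1)" using d \<open>z y0 \<in> S\<close> F(1) by blast
  then show False using y0(2)[OF \<open>y1 \<in> F\<close>] by simp
qed

lemma convex_combination_eq_max:
  fixes p h :: "'i \<Rightarrow> real"
  assumes "finite I" "\<And>i. i \<in> I \<Longrightarrow> 0 < p i" "sum p I = 1" "\<And>i. i \<in> I \<Longrightarrow> h i \<le> m"
    and "m \<le> (\<Sum>i\<in>I. p i * h i)" "i \<in> I"
  shows "h i = m"
proof -
  have "(\<Sum>i\<in>I. p i * (m - h i)) = m * sum p I - (\<Sum>i\<in>I. p i * h i)"
    by (simp add: right_diff_distrib sum_subtractf sum_distrib_left mult.commute)
  then have "(\<Sum>i\<in>I. p i * (m - h i)) \<le> 0" using assms(3,5) by simp
  moreover have nn: "\<And>i. i \<in> I \<Longrightarrow> 0 \<le> p i * (m - h i)"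
    using assms(2,4) by (simp add: less_imp_le)
  ultimately have "(\<Sum>i\<in>I. p i * (m - h i)) = 0" by (meson order_antisym sum_nonneg)
  then have "p i * (m - h i) = 0" using nn assms(1,6) by (simp add: sum_nonneg_eq_0_iff)
  then show ?thesis using assms(2)[OF assms(6)] by simp
qed

text \<open>
  Kronecker's theorem gives the approximation with \<open>q\<close> an integer. Starting from a multiple \<open>m\<alpha>\<close> that
  exceeds \<open>\<bar>x\<bar> + \<epsilon>\<close> forces \<open>q\<close> to be positive.
\<close>
lemma multiples_difference_dense:
  fixes \<alpha> \<beta> x \<epsilon> :: real
  assumes "0 < \<alpha>" "0 < \<beta>" "\<alpha> / \<beta> \<notin> \<rat>" "0 < \<epsilon>"
  obtains p q :: nat where "\<bar>real p * \<alpha> - real q * \<beta> - x\<bar> < \<epsilon>"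
proof -
  define \<theta> where "\<theta> = \<alpha> / \<beta>"
  obtain m :: nat where m: "(\<bar>x\<bar> + \<epsilon>) / \<alpha> < real m" using reals_Archimedean2 by blast
  define \<xi> where "\<xi> = (x - real m * \<alpha>) / \<beta>"
  obtain k :: nat where k: "\<bar>frac (real k * \<theta>) - frac \<xi>\<bar> < \<epsilon> / \<beta>"
    using Kronecker_approx_1_explicit[of \<theta> "frac \<xi>" "\<epsilon> / \<beta>"] assms
    by (metis \<theta>_def divide_pos_pos frac_ge_0 frac_lt_1 less_imp_le)
  define z where "z = \<lfloor>real k * \<theta>\<rfloor> - \<lfloor>\<xi>\<rfloor>"
  have "\<bar>real k * \<theta> - of_int z - \<xi>\<bar> < \<epsilon> / \<beta>" using k by (simp add: z_def frac_def algebra_simps)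
  then have "\<bar>real k * \<theta> - of_int z - \<xi>\<bar> * \<beta> < \<epsilon>" using assms by (simp add: field_simps)
  moreover have "\<bar>real k * \<theta> - of_int z - \<xi>\<bar> * \<beta> = \<bar>(real k * \<theta> - of_int z - \<xi>) * \<beta>\<bar>"
    using assms by (simp add: abs_mult)
  moreover have "(real k * \<theta> - of_int z - \<xi>) * \<beta> = real (k + m) * \<alpha> - of_int z * \<beta> - x"
    using assms by (simp add: \<theta>_def \<xi>_def field_simps)
  ultimately have *: "\<bar>real (k + m) * \<alpha> - of_int z * \<beta> - x\<bar> < \<epsilon>" by simp
  have "\<bar>x\<bar> + \<epsilon> < real m * \<alpha>" using m assms by (simp add: field_simps)
  moreover have "real m * \<alpha> \<le> real (k + m) * \<alpha>" using assms by (intro mult_right_mono) auto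
  ultimately have "0 < of_int z * \<beta>" using * by linarith
  then have "0 < z" using assms by (simp add: zero_less_mult_iff)
  then show ?thesis using * by (intro that[of "k + m" "nat z"]) simp
qed

text \<open>
  The cylinders of two words \<open>v\<close> and \<open>w\<close> contribute to \<open>K - c K'\<close> a translate of the set
  \<open>K - c' K'\<close>, \<open>c' = c \<cdot> word_ratio w / word_ratio v\<close>, scaled by \<open>word_ratio v\<close>. Zooming in thus replaces
  \<open>K - c K'\<close> by another member of the same family, and everything depends on how \<open>c\<close> moves.
\<close>
locale affine_cantor_pair =
  A: affine_cantor M r t a K + B: affine_cantor N r' t' b K'
  for M r t a K N r' t' b K'
begin

abbreviation "\<sigma>\<^sub>1 \<equiv> A.similarity_dim"
abbreviation "\<sigma>\<^sub>2 \<equiv> B.similarity_dim"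

lemma bounded_difference: "bounded (scaled_difference c K K')"
  using compact_scaled_difference[OF A.compact_K B.compact_K] compact_imp_bounded by blast

end

lemma (in affine_cantor) K_words: "K \<subseteq> (\<Union>w\<in>words n. word_map w ` K)"
proof (induction n)
  case 0
  have "[] \<in> words 0" by (simp add: words_def)
  moreover have "K \<subseteq> word_map [] ` K" by auto
  ultimately show ?case by blast
next
  case (Suc n)
  show ?case
  proof
    fix x assume "x \<in> K"
    then obtain i y where i: "i \<in> {1..M}" "y \<in> K" "x = r i * y + t i" by (rule K_cases)
    then obtain w z where "w \<in> words n" "z \<in> K" "y = word_map w z" using Suc by blast
    then have "i # w \<in> words (Suc n)" "x = word_map (i # w) z" "z \<in> K"
      using i by (auto simp: words_def)
    then show "x \<in> (\<Union>w\<in>words (Suc n). word_map w ` K)" by blast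
  qed
qed

text \<open>
  The words \<open>12\<close> and \<open>21\<close> have the same ratio but disjoint cylinders. Such pairs exist in every system
  and produce exact overlaps of projections.
\<close>
lemma (in affine_cantor) words_12_translations_differ:
  "word_map [1, 2] 0 \<noteq> word_map [2, 1] 0"
proof
  assume eq: "word_map [1, 2] 0 = word_map [2, 1] 0"
  obtain x where x: "x \<in> K" using K_ne by blast
  obtain h where h: "0 < h"
    "\<forall>v\<in>words 2. \<forall>w\<in>words 2. \<forall>x\<in>K. \<forall>y\<in>K. v \<noteq> w \<longrightarrow> h \<le> \<bar>word_map v x - word_map w y\<bar>"
    using word_gap[of 2] .
  have "[1, 2] \<in> words 2" "[2, 1] \<in> words 2" using M_ge_2 by (auto simp: words_def)
  then have "h \<le> \<bar>word_map [1, 2] x - word_map [2, 1] x\<bar>" using h(2) x by (metis list.inject one_eq_numeral_iff semiring_norm(85))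
  moreover have "word_map [1, 2] x = word_map [2, 1] x"
    using eq by (simp add: algebra_simps)
  ultimately show False using h(1) by simp
qed

context affine_cantor_pair begin

text \<open>
  The factor \<open>y\<^sup>-\<^sup>\<sigma>\<^sup>2\<close> turns the scaling factors \<open>(word_ratio v)\<^sup>\<sigma>\<^sup>1\<^sup>+\<^sup>\<sigma>\<^sup>2\<close> of the content into the product
  weights \<open>(word_ratio v)\<^sup>\<sigma>\<^sup>1 (word_ratio w)\<^sup>\<sigma>\<^sup>2\<close>, whose sum over all pairs of words of fixed lengths is \<open>1\<close>.
  Subadditivity of the content thus becomes a subharmonicity property of \<open>h\<close>. The set \<open>J\<close> need not
  contain all pairs of words: pairs that are redundant for covering the difference may be left out.
\<close>
lemma normalised_content_cylinders:
  assumes y: "0 < y" and c: "c \<noteq> 0"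
    and pos: "\<And>i. i \<in> {1..M} \<Longrightarrow> 0 < r i" "\<And>j. j \<in> {1..N} \<Longrightarrow> 0 < r' j"
    and J: "J \<subseteq> A.words n \<times> B.words n'"
    and cover: "scaled_difference (c * y) K K' \<subseteq>
      (\<Union>(v, w)\<in>J. (\<lambda>(p, q). A.word_map v p - c * y * B.word_map w q) ` (K \<times> K'))"
  defines "h \<equiv> \<lambda>y. ball_content (\<sigma>\<^sub>1 + \<sigma>\<^sub>2) (scaled_difference (c * y) K K') * y powr (-\<sigma>\<^sub>2)"
  shows "h y \<le> (\<Sum>(v, w)\<in>J. (A.word_ratio v powr \<sigma>\<^sub>1 * B.word_ratio w powr \<sigma>\<^sub>2) *
      h (y * B.word_ratio w / A.word_ratio v))"
proof -
  have posA: "0 < A.word_ratio v" if "set v \<subseteq> {1..M}" for v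
    using that by (induction v) (auto intro!: mult_pos_pos pos)
  have posB: "0 < B.word_ratio v" if "set v \<subseteq> {1..N}" for v
    using that by (induction v) (auto intro!: mult_pos_pos pos)
  have J_pos: "0 < A.word_ratio (fst u)" "0 < B.word_ratio (snd u)" if "u \<in> J" for u
    using that J posA posB by (auto simp: A.words_def B.words_def)
  let ?D = "\<lambda>u. scaled_difference (c * (y * B.word_ratio (snd u) / A.word_ratio (fst u))) K K'"
  let ?e = "\<lambda>u. A.word_map (fst u) 0 - c * y * B.word_map (snd u) 0"
  have fin: "finite J"
    using J A.finite_words B.finite_words by (meson finite_SigmaI finite_subset)
  have "ball_content (\<sigma>\<^sub>1 + \<sigma>\<^sub>2) (scaled_difference (c * y) K K') \<le>
      (\<Sum>u\<in>J. \<bar>A.word_ratio (fst u)\<bar> powr (\<sigma>\<^sub>1 + \<sigma>\<^sub>2) * ball_content (\<sigma>\<^sub>1 + \<sigma>\<^sub>2) (?D u))"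
  proof (rule content_UN_le[OF fin, where e = ?e])
    show "scaled_difference (c * y) K K' \<subseteq> (\<Union>u\<in>J. (\<lambda>z. A.word_ratio (fst u) * z + ?e u) ` ?D u)"
    proof
      fix z assume "z \<in> scaled_difference (c * y) K K'"
      then have "z \<in> (\<Union>(v, w)\<in>J. (\<lambda>(p, q). A.word_map v p - c * y * B.word_map w q) ` (K \<times> K'))"
        using cover by blast
      then obtain v w p q where u: "(v, w) \<in> J" "p \<in> K" "q \<in> K'"
        "z = A.word_map v p - c * y * B.word_map w q" by auto
      have "z = A.word_ratio v * (p - c * (y * B.word_ratio w / A.word_ratio v) * q) + ?e (v, w)"
        unfolding u(4) using J_pos[OF u(1)]
        by (subst A.word_map_affine, subst B.word_map_affine) (simp add: field_simps)
      moreover have "p - c * (y * B.word_ratio w / A.word_ratio v) * q \<in> ?D (v, w)"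
        using u by (auto simp: scaled_difference_def)
      ultimately show "z \<in> (\<Union>u\<in>J. (\<lambda>z. A.word_ratio (fst u) * z + ?e u) ` ?D u)"
        using u(1) by force
    qed
  qed (use J_pos bounded_difference in force)
  then have "h y \<le> (\<Sum>u\<in>J. \<bar>A.word_ratio (fst u)\<bar> powr (\<sigma>\<^sub>1 + \<sigma>\<^sub>2) * ball_content (\<sigma>\<^sub>1 + \<sigma>\<^sub>2) (?D u)) * y powr (-\<sigma>\<^sub>2)"
    unfolding h_def by (intro mult_right_mono) auto
  also have "\<dots> = (\<Sum>u\<in>J. (A.word_ratio (fst u) powr \<sigma>\<^sub>1 * B.word_ratio (snd u) powr \<sigma>\<^sub>2) *
      h (y * B.word_ratio (snd u) / A.word_ratio (fst u)))"
    unfolding sum_distrib_right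
  proof (rule sum.cong[OF refl])
    fix u assume u: "u \<in> J"
    define R where "R = A.word_ratio (fst u)"
    define R' where "R' = B.word_ratio (snd u)"
    have R: "0 < R" "0 < R'" using J_pos[OF u] by (auto simp: R_def R'_def)
    have "R powr \<sigma>\<^sub>1 * R' powr \<sigma>\<^sub>2 * (y * R' / R) powr (-\<sigma>\<^sub>2) = R powr (\<sigma>\<^sub>1 + \<sigma>\<^sub>2) * y powr (-\<sigma>\<^sub>2)"
      using R y by (simp add: powr_mult powr_divide powr_minus powr_add field_simps)
    then show "\<bar>A.word_ratio (fst u)\<bar> powr (\<sigma>\<^sub>1 + \<sigma>\<^sub>2) * ball_content (\<sigma>\<^sub>1 + \<sigma>\<^sub>2) (?D u) * y powr (-\<sigma>\<^sub>2) =
      (A.word_ratio (fst u) powr \<sigma>\<^sub>1 * B.word_ratio (snd u) powr \<sigma>\<^sub>2) *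
      h (y * B.word_ratio (snd u) / A.word_ratio (fst u))"
      using R unfolding h_def R_def[symmetric] R'_def[symmetric]
      by (simp add: algebra_simps)
  qed
  finally show ?thesis by (simp add: case_prod_beta)
qed

text \<open>
  A maximum principle. The function \<open>h\<close> is subharmonic for the steps \<open>y \<mapsto> y / r i\<close> and
  \<open>y \<mapsto> y * r' j\<close>. These steps lead every \<open>y > 0\<close> into a compact window, where \<open>h\<close> attains its maximum
  \<open>m\<close> by semicontinuity, so \<open>m\<close> is a global maximum. Subharmonicity propagates the value \<open>m\<close> along the orbit
  of the maximum point, which is dense because the logarithms are incommensurable, and semicontinuity
  then gives \<open>h = m\<close> everywhere. For suitable \<open>y\<close> the cylinders \<open>12\<close> and \<open>21\<close> of \<open>K\<close> combine with two such
  cylinders of \<open>K'\<close> into exactly overlapping projections; one of them can be dropped, and \<open>h\<close> is at most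
  a proper fraction of \<open>m\<close> there. Hence \<open>m = 0\<close>.
\<close>
theorem content_difference_eq_0:
  assumes c: "c \<noteq> 0"
    and pos: "\<And>i. i \<in> {1..M} \<Longrightarrow> 0 < r i" "\<And>j. j \<in> {1..N} \<Longrightarrow> 0 < r' j"
    and irr: "i0 \<in> {1..M}" "j0 \<in> {1..N}" "ln (r i0) / ln (r' j0) \<notin> \<rat>"
  shows "ball_content (\<sigma>\<^sub>1 + \<sigma>\<^sub>2) (scaled_difference c K K') = 0"
proof -
  define h where "h y = ball_content (\<sigma>\<^sub>1 + \<sigma>\<^sub>2) (scaled_difference (c * y) K K') * y powr (-\<sigma>\<^sub>2)" for y
  note cyl = normalised_content_cylinders[OF _ c pos, folded h_def]
  have rA: "\<bar>r i\<bar> = r i" "r i < 1" if "i \<in> {1..M}" for i using pos(1)[OF that] A.r_bounds[OF that] by auto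
  have rB: "\<bar>r' j\<bar> = r' j" "r' j < 1" if "j \<in> {1..N}" for j using pos(2)[OF that] B.r_bounds[OF that] by auto
  have sumA: "(\<Sum>i\<in>{1..M}. r i powr \<sigma>\<^sub>1) = 1"
    unfolding A.similarity_dim(2)[symmetric] by (rule sum.cong[OF refl]) (simp only: rA)
  have sumB: "(\<Sum>j\<in>{1..N}. r' j powr \<sigma>\<^sub>2) = 1"
    unfolding B.similarity_dim(2)[symmetric] by (rule sum.cong[OF refl]) (simp only: rB)
  have posA: "0 < A.word_ratio v" if "set v \<subseteq> {1..M}" for v
    using that by (induction v) (auto intro!: mult_pos_pos pos)
  have posB: "0 < B.word_ratio v" if "set v \<subseteq> {1..N}" for v
    using that by (induction v) (auto intro!: mult_pos_pos pos)
  have subA: "h y \<le> (\<Sum>i\<in>{1..M}. r i powr \<sigma>\<^sub>1 * h (y / r i))" if y: "0 < y" for y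
  proof -
    have "h y \<le> (\<Sum>(v, w)\<in>(\<lambda>i. ([i], [])) ` {1..M}. (A.word_ratio v powr \<sigma>\<^sub>1 * B.word_ratio w powr \<sigma>\<^sub>2) *
      h (y * B.word_ratio w / A.word_ratio v))"
    proof (rule cyl[OF y, where n = 1 and n' = 0])
      show "scaled_difference (c * y) K K' \<subseteq> (\<Union>(v, w)\<in>(\<lambda>i. ([i], [])) ` {1..M}.
          (\<lambda>(p, q). A.word_map v p - c * y * B.word_map w q) ` (K \<times> K'))"
      proof
        fix z assume "z \<in> scaled_difference (c * y) K K'"
        then obtain p q where z: "z = p - c * y * q" "p \<in> K" "q \<in> K'" by (auto simp: scaled_difference_def)
        obtain i p' where "i \<in> {1..M}" "p' \<in> K" "p = r i * p' + t i" using A.K_cases[OF z(2)] .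
        then show "z \<in> (\<Union>(v, w)\<in>(\<lambda>i. ([i], [])) ` {1..M}.
          (\<lambda>(p, q). A.word_map v p - c * y * B.word_map w q) ` (K \<times> K'))"
          using z by (auto intro!: bexI[of _ i] image_eqI[of _ _ "(p', q)"])
      qed
    qed (auto simp: A.words_def B.words_def)
    also have "\<dots> = (\<Sum>i\<in>{1..M}. r i powr \<sigma>\<^sub>1 * h (y / r i))"
      by (subst sum.reindex) (auto simp: inj_on_def)
    finally show ?thesis .
  qed
  have subB: "h y \<le> (\<Sum>j\<in>{1..N}. r' j powr \<sigma>\<^sub>2 * h (y * r' j))" if y: "0 < y" for y
  proof -
    have "h y \<le> (\<Sum>(v, w)\<in>(\<lambda>j. ([], [j])) ` {1..N}. (A.word_ratio v powr \<sigma>\<^sub>1 * B.word_ratio w powr \<sigma>\<^sub>2) *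
      h (y * B.word_ratio w / A.word_ratio v))"
    proof (rule cyl[OF y, where n = 0 and n' = 1])
      show "scaled_difference (c * y) K K' \<subseteq> (\<Union>(v, w)\<in>(\<lambda>j. ([], [j])) ` {1..N}.
          (\<lambda>(p, q). A.word_map v p - c * y * B.word_map w q) ` (K \<times> K'))"
      proof
        fix z assume "z \<in> scaled_difference (c * y) K K'"
        then obtain p q where z: "z = p - c * y * q" "p \<in> K" "q \<in> K'" by (auto simp: scaled_difference_def)
        obtain j q' where "j \<in> {1..N}" "q' \<in> K'" "q = r' j * q' + t' j" using B.K_cases[OF z(3)] .
        then show "z \<in> (\<Union>(v, w)\<in>(\<lambda>j. ([], [j])) ` {1..N}.
          (\<lambda>(p, q). A.word_map v p - c * y * B.word_map w q) ` (K \<times> K'))"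
          using z by (auto intro!: bexI[of _ j] image_eqI[of _ _ "(p, q')"])
      qed
    qed (auto simp: A.words_def B.words_def)
    also have "\<dots> = (\<Sum>j\<in>{1..N}. r' j powr \<sigma>\<^sub>2 * h (y * r' j))"
      by (subst sum.reindex) (auto simp: inj_on_def)
    finally show ?thesis .
  qed
  have usc: "\<exists>d>0. \<forall>y'>0. \<bar>y' - y\<bar> < d \<longrightarrow> h y' < v" if y: "0 < y" and v: "h y < v" for y v
  proof -
    define C where "C y = ball_content (\<sigma>\<^sub>1 + \<sigma>\<^sub>2) (scaled_difference (c * y) K K')" for y
    have Cn: "0 \<le> C y" for y unfolding C_def by (intro content_nonneg bounded_difference)
    obtain u where u: "C y < u" "u * y powr (-\<sigma>\<^sub>2) < v"
    proof -
      have "C y < v * y powr \<sigma>\<^sub>2" using v y by (simp add: h_def C_def powr_minus field_simps)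
      then obtain u where "C y < u" "u < v * y powr \<sigma>\<^sub>2" using dense by blast
      then show ?thesis using that[of u] y by (simp add: powr_minus field_simps)
    qed
    obtain d1 where d1: "0 < d1" "\<And>c'. \<bar>c' - c * y\<bar> < d1 \<Longrightarrow> ball_content (\<sigma>\<^sub>1 + \<sigma>\<^sub>2) (scaled_difference c' K K') < u"
      using content_scaled_difference_usc[OF A.compact_K B.compact_K u(1)[unfolded C_def]] by blast
    have "((\<lambda>y'. u * y' powr (-\<sigma>\<^sub>2)) \<longlongrightarrow> u * y powr (-\<sigma>\<^sub>2)) (at y)"
      using y by (intro tendsto_intros) auto
    then have "eventually (\<lambda>y'. u * y' powr (-\<sigma>\<^sub>2) < v) (at y)" using u(2) by (rule order_tendstoD)
    then obtain d2 where d2: "0 < d2" "\<And>y'. y' \<noteq> y \<Longrightarrow> \<bar>y' - y\<bar> < d2 \<Longrightarrow> u * y' powr (-\<sigma>\<^sub>2) < v"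
      unfolding eventually_at by (auto simp: dist_real_def)
    show ?thesis
    proof (intro exI[of _ "min d2 (d1 / \<bar>c\<bar>)"] conjI allI impI)
      fix y' assume y': "0 < y'" "\<bar>y' - y\<bar> < min d2 (d1 / \<bar>c\<bar>)"
      have "\<bar>c * y' - c * y\<bar> = \<bar>c\<bar> * \<bar>y' - y\<bar>" by (simp add: abs_mult[symmetric] algebra_simps)
      also have "\<dots> < d1" using y' c by (simp add: field_simps)
      finally have "C y' < u" unfolding C_def by (rule d1(2))
      then have "h y' \<le> u * y' powr (-\<sigma>\<^sub>2)" unfolding h_def C_def by (intro mult_right_mono) auto
      also have "\<dots> < v" using d2(2)[of y'] y' u(2) by (cases "y' = y") auto
      finally show "h y' < v" .
    qed (use d1 d2 c in auto)
  qed
  obtain \<rho>1 where \<rho>1: "0 < \<rho>1" "\<rho>1 < 1" "\<And>i. i \<in> {1..M} \<Longrightarrow> \<rho>1 \<le> \<bar>r i\<bar>"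
    using A.ratio_lower by blast
  obtain \<rho>2 where \<rho>2: "0 < \<rho>2" "\<rho>2 < 1" "\<And>j. j \<in> {1..N} \<Longrightarrow> \<rho>2 \<le> \<bar>r' j\<bar>"
    using B.ratio_lower by blast
  \<comment> \<open>A step from outside cannot jump over the window \<open>[1, \<Lambda>]\<close>, since it changes \<open>y\<close> by a factor of at most \<open>\<Lambda>\<close>.\<close>
  define \<Lambda> where "\<Lambda> = 1 / min \<rho>1 \<rho>2"
  have \<Lambda>_ge: "1 \<le> \<Lambda> * z" if "min \<rho>1 \<rho>2 \<le> z" for z
    using that \<rho>1(1) \<rho>2(1) by (simp add: \<Lambda>_def)
  have \<Lambda>: "1 \<le> \<Lambda>" "\<And>i. i \<in> {1..M} \<Longrightarrow> 1 \<le> \<Lambda> * r i" "\<And>j. j \<in> {1..N} \<Longrightarrow> 1 \<le> \<Lambda> * r' j"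
  proof -
    show "1 \<le> \<Lambda>" using \<Lambda>_ge[of 1] \<rho>1(2) by simp
    show "1 \<le> \<Lambda> * r i" if "i \<in> {1..M}" for i
      using \<rho>1(3)[OF that] rA(1)[OF that] by (intro \<Lambda>_ge) linarith
    show "1 \<le> \<Lambda> * r' j" if "j \<in> {1..N}" for j
      using \<rho>2(3)[OF that] rB(1)[OF that] by (intro \<Lambda>_ge) linarith
  qed
  obtain ym where ym: "ym \<in> {1..\<Lambda>}" "\<And>y. y \<in> {1..\<Lambda>} \<Longrightarrow> h y \<le> h ym"
  proof (rule upper_semicontinuous_attains_sup[of "{1..\<Lambda>}" h])
    show "{1..\<Lambda>} \<noteq> {}" using \<Lambda>(1) by simp
    show "\<exists>d>0. \<forall>y'\<in>{1..\<Lambda>}. dist y y' < d \<longrightarrow> h y' < v" if "y \<in> {1..\<Lambda>}" "h y < v" for y v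
    proof -
      have "0 < y" "h y < v" using that by auto
      then obtain d where "0 < d" "\<forall>y'>0. \<bar>y' - y\<bar> < d \<longrightarrow> h y' < v" using usc[of y v] by auto
      then show ?thesis by (intro exI[of _ d]) (auto simp: dist_real_def abs_minus_commute)
    qed
  qed auto
  define m where "m = h ym"
  obtain \<kappa>1 where \<kappa>1: "0 < \<kappa>1" "\<kappa>1 < 1" "\<And>i. i \<in> {1..M} \<Longrightarrow> \<bar>r i\<bar> \<le> \<kappa>1"
    using A.ratio_upper by blast
  obtain \<kappa>2 where \<kappa>2: "0 < \<kappa>2" "\<kappa>2 < 1" "\<And>j. j \<in> {1..N} \<Longrightarrow> \<bar>r' j\<bar> \<le> \<kappa>2"
    using B.ratio_upper by blast
  have up: "h y \<le> m" if "1 \<le> y" "y * \<kappa>2 ^ n \<le> \<Lambda>" for n y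
    using that
  proof (induction n arbitrary: y)
    case (Suc n)
    show ?case
    proof (cases "y \<le> \<Lambda>")
      case False
      have "h y \<le> (\<Sum>j\<in>{1..N}. r' j powr \<sigma>\<^sub>2 * h (y * r' j))" using subB Suc.prems by simp
      also have "\<dots> \<le> (\<Sum>j\<in>{1..N}. r' j powr \<sigma>\<^sub>2 * m)"
      proof (intro sum_mono mult_left_mono Suc.IH)
        fix j assume j: "j \<in> {1..N}"
        have "\<Lambda> * r' j \<le> y * r' j" using False pos(2)[OF j] by (intro mult_right_mono) auto
        then show "1 \<le> y * r' j" using \<Lambda>(3)[OF j] by simp
        have "y * r' j * \<kappa>2 ^ n \<le> y * \<kappa>2 * \<kappa>2 ^ n"
          using \<kappa>2 rB[OF j] j Suc.prems by (intro mult_right_mono mult_left_mono) force+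
        also have "\<dots> \<le> \<Lambda>" using Suc.prems by (simp add: mult.assoc)
        finally show "y * r' j * \<kappa>2 ^ n \<le> \<Lambda>" .
      qed auto
      also have "\<dots> = m" using sumB by (simp flip: sum_distrib_right)
      finally show ?thesis .
    qed (use ym(2) Suc.prems m_def in auto)
  qed (use ym(2) m_def in auto)
  have down: "h y \<le> m" if "y \<le> \<Lambda>" "\<kappa>1 ^ n \<le> y" for n y
    using that
  proof (induction n arbitrary: y)
    case (Suc n)
    have "0 < y" using Suc.prems \<kappa>1 by (meson less_le_trans zero_less_power)
    show ?case
    proof (cases "1 \<le> y")
      case False
      have "h y \<le> (\<Sum>i\<in>{1..M}. r i powr \<sigma>\<^sub>1 * h (y / r i))" using subA \<open>0 < y\<close> by simp
      also have "\<dots> \<le> (\<Sum>i\<in>{1..M}. r i powr \<sigma>\<^sub>1 * m)"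
      proof (intro sum_mono mult_left_mono Suc.IH)
        fix i assume i: "i \<in> {1..M}"
        show "y / r i \<le> \<Lambda>" using \<Lambda>(2)[OF i] False pos(1)[OF i] by (simp add: field_simps)
        have "\<kappa>1 ^ n * r i \<le> \<kappa>1 ^ n * \<kappa>1" using \<kappa>1 rA[OF i] i by (intro mult_left_mono) force+
        then have "\<kappa>1 ^ n * r i \<le> y" using Suc.prems by (simp add: mult.commute)
        then show "\<kappa>1 ^ n \<le> y / r i" using pos(1)[OF i] by (simp add: field_simps)
      qed auto
      also have "\<dots> = m" using sumA by (simp flip: sum_distrib_right)
      finally show ?thesis .
    qed (use ym(2) Suc.prems m_def in auto)
  qed (use ym(2) m_def in auto)
  have h_le: "h y \<le> m" if y: "0 < y" for y
  proof (cases "y \<le> \<Lambda>")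
    case True
    obtain n where "\<kappa>1 ^ n < y" using real_arch_pow_inv[OF y \<kappa>1(2)] by blast
    then show ?thesis using down[OF True, of n] by simp
  next
    case False
    obtain n where "\<kappa>2 ^ n < \<Lambda> / y" using real_arch_pow_inv[of "\<Lambda> / y" \<kappa>2] \<kappa>2(2) y \<Lambda>(1) by auto
    then have "y * \<kappa>2 ^ n \<le> \<Lambda>" using that by (simp add: field_simps)
    then show ?thesis using up[of y n] False \<Lambda>(1) by simp
  qed
  have eqA: "h (y / r i) = m" if y: "0 < y" and hy: "h y = m" and i: "i \<in> {1..M}" for y i
  proof (rule convex_combination_eq_max[where I = "{1..M}" and p = "\<lambda>i. r i powr \<sigma>\<^sub>1" and h = "\<lambda>i. h (y / r i)"])
    show "0 < r k powr \<sigma>\<^sub>1" if "k \<in> {1..M}" for k using pos(1)[OF that] by simp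
    show "h (y / r k) \<le> m" if "k \<in> {1..M}" for k using pos(1)[OF that] y by (intro h_le) simp
    show "m \<le> (\<Sum>i\<in>{1..M}. r i powr \<sigma>\<^sub>1 * h (y / r i))" using subA[OF y] hy by simp
  qed (use i sumA in auto)
  have eqB: "h (y * r' j) = m" if y: "0 < y" and hy: "h y = m" and j: "j \<in> {1..N}" for y j
  proof (rule convex_combination_eq_max[where I = "{1..N}" and p = "\<lambda>j. r' j powr \<sigma>\<^sub>2" and h = "\<lambda>j. h (y * r' j)"])
    show "0 < r' k powr \<sigma>\<^sub>2" if "k \<in> {1..N}" for k using pos(2)[OF that] by simp
    show "h (y * r' k) \<le> m" if "k \<in> {1..N}" for k using pos(2)[OF that] y by (intro h_le) simp
    show "m \<le> (\<Sum>j\<in>{1..N}. r' j powr \<sigma>\<^sub>2 * h (y * r' j))" using subB[OF y] hy by simp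
  qed (use j sumB in auto)
  define \<alpha> where "\<alpha> = - ln (r i0)"
  define \<beta> where "\<beta> = - ln (r' j0)"
  have \<alpha>\<beta>: "0 < \<alpha>" "0 < \<beta>" "\<alpha> / \<beta> \<notin> \<rat>"
    using pos(1)[OF irr(1)] pos(2)[OF irr(2)] rA[OF irr(1)] rB[OF irr(2)] irr(3)
    by (auto simp: \<alpha>_def \<beta>_def)
  have exp\<alpha>: "exp \<alpha> = 1 / r i0" "exp (-\<beta>) = r' j0"
    using pos(1)[OF irr(1)] pos(2)[OF irr(2)] by (auto simp: \<alpha>_def \<beta>_def exp_minus field_simps)
  have ym0: "0 < ym" using ym by simp
  have orbit1: "h (ym * exp (real p * \<alpha>)) = m" for p
  proof (induction p)
    case (Suc p)
    have "h ((ym * exp (real p * \<alpha>)) / r i0) = m" using Suc ym0 irr by (intro eqA) auto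
    moreover have "ym * exp (real (Suc p) * \<alpha>) = (ym * exp (real p * \<alpha>)) / r i0"
      using exp\<alpha> by (simp add: distrib_right exp_add)
    ultimately show ?case by simp
  qed (simp add: m_def)
  have orbit: "h (ym * exp (real p * \<alpha> - real q * \<beta>)) = m" for p q
  proof (induction q)
    case (Suc q)
    have "h ((ym * exp (real p * \<alpha> - real q * \<beta>)) * r' j0) = m" using Suc ym0 irr by (intro eqB) auto
    moreover have "ym * exp (real p * \<alpha> - real (Suc q) * \<beta>) = (ym * exp (real p * \<alpha> - real q * \<beta>)) * r' j0"
    proof -
      have "real p * \<alpha> - real (Suc q) * \<beta> = (real p * \<alpha> - real q * \<beta>) + (-\<beta>)" by (simp add: algebra_simps)
      then show ?thesis by (simp only: exp_add exp\<alpha> mult.assoc)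
    qed
    ultimately show ?case by (simp only:)
  qed (use orbit1 in simp)
  have h_ge: "m \<le> h y" if y: "0 < y" for y
  proof (rule ccontr)
    assume "\<not> m \<le> h y"
    then obtain d where d: "0 < d" "\<And>y'. 0 < y' \<Longrightarrow> \<bar>y' - y\<bar> < d \<Longrightarrow> h y' < m"
      using usc[OF y, of m] by auto
    define x where "x = ln (y / ym)"
    have yx: "ym * exp x = y" using y ym0 by (simp add: x_def)
    have "isCont (\<lambda>x. ym * exp x) x" by (intro continuous_intros)
    then obtain e where e: "0 < e" "\<And>x'. \<bar>x' - x\<bar> < e \<Longrightarrow> \<bar>ym * exp x' - ym * exp x\<bar> < d"
      using d(1) unfolding continuous_at_eps_delta by (auto simp: dist_real_def)
    obtain p q :: nat where "\<bar>real p * \<alpha> - real q * \<beta> - x\<bar> < e"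
      using multiples_difference_dense[OF \<alpha>\<beta> e(1)] .
    then have "h (ym * exp (real p * \<alpha> - real q * \<beta>)) < m"
      using e(2) ym0 unfolding yx by (intro d(2)) auto
    then show False using orbit by simp
  qed
  have "m \<le> 0"
  proof -
    define D where "D = A.word_map [1,2] 0 - A.word_map [2,1] 0"
    define D' where "D' = B.word_map [1,2] 0 - B.word_map [2,1] 0"
    have D: "D \<noteq> 0" "D' \<noteq> 0"
      using A.words_12_translations_differ B.words_12_translations_differ by (auto simp: D_def D'_def)
    \<comment> \<open>At this parameter the translation parts of two pairs of cylinders agree. The sign of \<open>D / (D' * c)\<close> decides
      which of the words \<open>12\<close>, \<open>21\<close> of the second system goes with the word \<open>12\<close> of the first.\<close>
    define y where "y = \<bar>D / (D' * c)\<bar>"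
    have y: "0 < y" using D c by (simp add: y_def)
    have cy: "c * y * D' = D \<or> c * y * D' = - D"
      using D c unfolding y_def by (auto simp: abs_if field_simps)
    define u where "u = (if c * y * D' = D then [1::nat, 2] else [2, 1])"
    define u' where "u' = (if c * y * D' = D then [2::nat, 1] else [1, 2])"
    have overlap: "A.word_map [1,2] 0 - c * y * B.word_map u 0 = A.word_map [2,1] 0 - c * y * B.word_map u' 0"
      using cy unfolding u_def u'_def D_def D'_def by (auto simp: algebra_simps)
    have inw: "[1,2] \<in> A.words 2" "[2,1] \<in> A.words 2" "u \<in> B.words 2" "u' \<in> B.words 2"
      using A.M_ge_2 B.M_ge_2 by (auto simp: A.words_def B.words_def u_def u'_def)
    have rat: "A.word_ratio [1,2] = A.word_ratio [2,1]" "B.word_ratio u = B.word_ratio u'"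
      by (auto simp: u_def u'_def)
    have split: "A.word_map v p - c * y * B.word_map w q =
        (A.word_ratio v * p - c * y * (B.word_ratio w * q)) + (A.word_map v 0 - c * y * B.word_map w 0)" for v w p q
      using A.word_map_affine[of v p] B.word_map_affine[of w q] by (simp add: algebra_simps)
    define J where "J = A.words 2 \<times> B.words 2 - {([1,2], u)}"
    let ?\<mu> = "\<lambda>p. A.word_ratio (fst p) powr \<sigma>\<^sub>1 * B.word_ratio (snd p) powr \<sigma>\<^sub>2"
    have "h y \<le> (\<Sum>(v, w)\<in>J. (A.word_ratio v powr \<sigma>\<^sub>1 * B.word_ratio w powr \<sigma>\<^sub>2) *
      h (y * B.word_ratio w / A.word_ratio v))"
    proof (rule cyl[OF y])
      show "J \<subseteq> A.words 2 \<times> B.words 2" by (auto simp: J_def)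
      show "scaled_difference (c * y) K K' \<subseteq>
        (\<Union>(v, w)\<in>J. (\<lambda>(p, q). A.word_map v p - c * y * B.word_map w q) ` (K \<times> K'))"
      proof
        fix z assume "z \<in> scaled_difference (c * y) K K'"
        then obtain p q where z: "z = p - c * y * q" "p \<in> K" "q \<in> K'" by (auto simp: scaled_difference_def)
        obtain v p' where v: "v \<in> A.words 2" "p' \<in> K" "p = A.word_map v p'" using A.K_words[of 2] z(2) by blast
        obtain w q' where w: "w \<in> B.words 2" "q' \<in> K'" "q = B.word_map w q'" using B.K_words[of 2] z(3) by blast
        have "\<exists>v w. (v, w) \<in> J \<and> z = A.word_map v p' - c * y * B.word_map w q'"
        proof (cases "(v, w) = ([1,2], u)")
          case True
          have "z = A.word_map [1,2] p' - c * y * B.word_map u q'" using z v w True by simp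
          also have "\<dots> = A.word_map [2,1] p' - c * y * B.word_map u' q'"
            unfolding split[of "[1,2]" p' u q'] split[of "[2,1]" p' u' q'] rat overlap ..
          finally show ?thesis using inw by (intro exI[of _ "[2,1]"] exI[of _ u']) (auto simp: J_def)
        qed (use z v w in \<open>auto simp: J_def\<close>)
        then obtain v' w' where J': "(v', w') \<in> J" and z': "z = A.word_map v' p' - c * y * B.word_map w' q'"
          by blast
        have "z \<in> (\<lambda>(p, q). A.word_map v' p - c * y * B.word_map w' q) ` (K \<times> K')"
          using z' v(2) w(2) by (intro image_eqI[of _ _ "(p', q')"]) auto
        then show "z \<in> (\<Union>(v, w)\<in>J. (\<lambda>(p, q). A.word_map v p - c * y * B.word_map w q) ` (K \<times> K'))"
          using J' by (intro UN_I[OF J']) simp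
      qed
    qed
    also have "\<dots> \<le> (\<Sum>p\<in>J. ?\<mu> p * m)"
      unfolding case_prod_beta
    proof (intro sum_mono mult_left_mono h_le)
      fix p assume "p \<in> J"
      then show "0 < y * B.word_ratio (snd p) / A.word_ratio (fst p)"
        using y by (auto simp: J_def A.words_def B.words_def intro!: posA posB divide_pos_pos mult_pos_pos)
    qed auto
    also have "\<dots> = (\<Sum>p\<in>J. ?\<mu> p) * m" by (simp add: sum_distrib_right)
    also have "(\<Sum>p\<in>J. ?\<mu> p) = (\<Sum>p\<in>A.words 2 \<times> B.words 2. ?\<mu> p) - ?\<mu> ([1,2], u)"
      unfolding J_def using inw A.finite_words B.finite_words by (subst sum_diff1) auto
    also have "(\<Sum>p\<in>A.words 2 \<times> B.words 2. ?\<mu> p) = 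
        (\<Sum>v\<in>A.words 2. A.word_ratio v powr \<sigma>\<^sub>1) * (\<Sum>w\<in>B.words 2. B.word_ratio w powr \<sigma>\<^sub>2)"
      by (simp add: sum_product sum.cartesian_product case_prod_beta)
    also have "\<dots> = 1"
    proof -
      have "(\<Sum>v\<in>A.words 2. A.word_ratio v powr \<sigma>\<^sub>1) = (\<Sum>v\<in>A.words 2. \<bar>A.word_ratio v\<bar> powr \<sigma>\<^sub>1)"
        by (rule sum.cong) (use posA in \<open>force simp: A.words_def\<close>)+
      moreover have "(\<Sum>v\<in>B.words 2. B.word_ratio v powr \<sigma>\<^sub>2) = (\<Sum>v\<in>B.words 2. \<bar>B.word_ratio v\<bar> powr \<sigma>\<^sub>2)"
        by (rule sum.cong) (use posB in \<open>force simp: B.words_def\<close>)+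
      ultimately show ?thesis using A.sum_words[of 2] B.sum_words[of 2] by simp
    qed
    finally have "h y \<le> (1 - ?\<mu> ([1,2], u)) * m" .
    then have "?\<mu> ([1,2], u) * m \<le> 0" using h_ge[OF y] by (simp add: algebra_simps)
    moreover have "0 < ?\<mu> ([1,2], u)"
    proof -
      have "0 < A.word_ratio [1,2]" "0 < B.word_ratio u"
        using inw(1,3) unfolding A.words_def B.words_def by (blast intro: posA posB)+
      then show ?thesis by (simp del: A.word_ratio_simps)
    qed
    ultimately show "m \<le> 0" by (metis mult_pos_pos not_less)
  qed
  then have "h 1 \<le> 0" using h_le[of 1] by simp
  then have "ball_content (\<sigma>\<^sub>1 + \<sigma>\<^sub>2) (scaled_difference c K K') \<le> 0" by (simp add: h_def)
  then show ?thesis using content_nonneg[OF bounded_difference] by (meson order_antisym)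
qed

end

section \<open>Commensurable contraction ratios\<close>

text \<open>
  Elements are added to \<open>S\<close> one by one, except those within \<open>d\<close> of an earlier one.
\<close>
lemma separated_subset:
  fixes f :: "'a \<Rightarrow> real"
  assumes "finite P" "0 \<le> d"
  obtains S where "S \<subseteq> P" "\<forall>p\<in>S. \<forall>q\<in>S. p \<noteq> q \<longrightarrow> d < \<bar>f p - f q\<bar>"
    "\<forall>p\<in>P. \<exists>s\<in>S. \<bar>f p - f s\<bar> \<le> d"
proof -
  have "\<exists>S\<subseteq>P. (\<forall>p\<in>S. \<forall>q\<in>S. p \<noteq> q \<longrightarrow> d < \<bar>f p - f q\<bar>) \<and> (\<forall>p\<in>P. \<exists>s\<in>S. \<bar>f p - f s\<bar> \<le> d)"
    using assms(1)
  proof (induction P)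
    case (insert x P)
    then obtain S where S: "S \<subseteq> P" "\<forall>p\<in>S. \<forall>q\<in>S. p \<noteq> q \<longrightarrow> d < \<bar>f p - f q\<bar>"
      "\<forall>p\<in>P. \<exists>s\<in>S. \<bar>f p - f s\<bar> \<le> d" by blast
    show ?case
    proof (cases "\<exists>s\<in>S. \<bar>f x - f s\<bar> \<le> d")
      case True
      then show ?thesis using S by (intro exI[of _ S]) auto
    next
      case False
      then have "\<forall>s\<in>S. d < \<bar>f x - f s\<bar> \<and> d < \<bar>f s - f x\<bar>" by (auto simp: abs_minus_commute not_le)
      then show ?thesis using S assms(2) by (intro exI[of _ "insert x S"]) auto
    qed
  qed simp
  then show ?thesis using that by blast
qed

lemma common_denominator:
  assumes "finite X" "X \<subseteq> (\<rat> :: real set)"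
  obtains L :: nat where "0 < L" "\<And>x. x \<in> X \<Longrightarrow> real L * x \<in> \<int>"
proof -
  have "\<exists>L::nat. 0 < L \<and> (\<forall>x\<in>X. real L * x \<in> \<int>)"
    using assms
  proof (induction X)
    case (insert x X)
    then obtain L :: nat where L: "0 < L" "\<forall>x\<in>X. real L * x \<in> \<int>" by auto
    obtain p q :: int where pq: "x = of_int p / of_int q" "0 < q"
      using insert.prems Rats_cases' by (metis insert_subset)
    have "real (L * nat q) * y \<in> \<int>" if "y \<in> insert x X" for y
    proof (cases "y = x")
      case True
      then have "real (L * nat q) * y = of_int (int L * p)" using pq by simp
      then show ?thesis by (metis Ints_of_int)
    next
      case False
      then have "real (L * nat q) * y = of_int q * (real L * y)" using pq by simp
      also have "\<dots> \<in> \<int>"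
      proof -
        have "y \<in> X" using False \<open>y \<in> insert x X\<close> by blast
        then show ?thesis using Ints_mult[OF Ints_of_int] L(2) by blast
      qed
      finally show ?thesis .
    qed
    then show ?case using L(1) pq(2) by (intro exI[of _ "L * nat q"]) auto
  qed (auto intro: exI[of _ 1])
  then show ?thesis using that by blast
qed

lemma (in affine_cantor) word_ratio_abs_less_1:
  assumes "set u \<subseteq> {1..M}" "u \<noteq> []"
  shows "\<bar>word_ratio u\<bar> < 1"
proof -
  obtain \<kappa> where \<kappa>: "0 < \<kappa>" "\<kappa> < 1" "\<And>i. i \<in> {1..M} \<Longrightarrow> \<bar>r i\<bar> \<le> \<kappa>"
    using ratio_upper by blast
  have "\<bar>word_ratio u\<bar> \<le> \<kappa> ^ length u" using word_ratio_le[OF \<kappa>(1,3)] assms by blast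
  also have "\<dots> < 1" using \<kappa> assms(2) by (simp add: power_less_one_iff)
  finally show ?thesis .
qed

lemma (in affine_cantor) word_ratio_power: "word_ratio (concat (replicate k u)) = word_ratio u ^ k"
  by (induction k) auto

lemma (in affine_cantor) ln_word_ratio:
  assumes "\<And>i. i \<in> {1..M} \<Longrightarrow> ln \<bar>r i\<bar> / \<theta> \<in> \<int>" "set u \<subseteq> {1..M}"
  shows "ln \<bar>word_ratio u\<bar> / \<theta> \<in> \<int>"
  using assms(2)
proof (induction u)
  case (Cons i u)
  then have "ln \<bar>word_ratio (i # u)\<bar> / \<theta> = ln \<bar>r i\<bar> / \<theta> + ln \<bar>word_ratio u\<bar> / \<theta>"
    using r_bounds[of i] word_ratio_nz[of u] by (simp add: abs_mult ln_mult add_divide_distrib)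
  then show ?case using Cons assms(1)[of i] by simp
qed simp

context affine_cantor_pair begin

abbreviation "\<Delta> \<equiv> arith_difference K K'"

lemma compact_\<Delta>: "compact \<Delta>"
  using compact_scaled_difference[OF A.compact_K B.compact_K] .

lemma \<Delta>_ne: "\<Delta> \<noteq> {}"
  using A.K_ne B.K_ne by (auto simp: scaled_difference_def)

text \<open>
  The quotients \<open>ln \<bar>r' j\<bar> / ln \<bar>r' 1\<bar>\<close> are rational as well, by comparison with \<open>ln \<bar>r 1\<bar>\<close>, so
  all logarithms are rational multiples of one number and a common denominator exists.
\<close>
lemma common_log_unit:
  assumes "\<And>i j. i \<in> {1..M} \<Longrightarrow> j \<in> {1..N} \<Longrightarrow> ln \<bar>r i\<bar> / ln \<bar>r' j\<bar> \<in> \<rat>"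
  obtains \<theta> where "0 < \<theta>" "\<And>i. i \<in> {1..M} \<Longrightarrow> ln \<bar>r i\<bar> / \<theta> \<in> \<int>" "\<And>j. j \<in> {1..N} \<Longrightarrow> ln \<bar>r' j\<bar> / \<theta> \<in> \<int>"
proof -
  define \<tau> where "\<tau> = ln \<bar>r' 1\<bar>"
  have 1: "1 \<in> {1..M}" "1 \<in> {1..N}" using A.M_ge_2 B.M_ge_2 by auto
  have \<tau>: "\<tau> < 0" using B.r_bounds[OF 1(2)] by (simp add: \<tau>_def)
  have nz: "ln \<bar>r 1\<bar> < 0" using A.r_bounds[OF 1(1)] by simp
  define X where "X = (\<lambda>i. ln \<bar>r i\<bar> / \<tau>) ` {1..M} \<union> (\<lambda>j. ln \<bar>r' j\<bar> / \<tau>) ` {1..N}"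
  have "X \<subseteq> \<rat>"
  proof -
    have "ln \<bar>r' j\<bar> / \<tau> \<in> \<rat>" if "j \<in> {1..N}" for j
    proof -
      have "ln \<bar>r' j\<bar> / \<tau> = (ln \<bar>r 1\<bar> / \<tau>) / (ln \<bar>r 1\<bar> / ln \<bar>r' j\<bar>)" using nz by simp
      also have "\<dots> \<in> \<rat>" using assms[OF 1] assms[OF 1(1) that] unfolding \<tau>_def by (rule Rats_divide)
      finally show ?thesis .
    qed
    then show ?thesis using assms[OF _ 1(2)] unfolding X_def \<tau>_def by blast
  qed
  moreover have "finite X" by (simp add: X_def)
  ultimately obtain L :: nat where L: "0 < L" "\<And>x. x \<in> X \<Longrightarrow> real L * x \<in> \<int>"
    using common_denominator by metis
  show ?thesis
  proof (rule that[of "-\<tau> / real L"])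
    show "0 < - \<tau> / real L" using \<tau> L by (simp add: divide_neg_pos)
    have eq: "z / (-\<tau> / real L) = - (real L * (z / \<tau>))" for z by simp
    show "ln \<bar>r i\<bar> / (-\<tau> / real L) \<in> \<int>" if "i \<in> {1..M}" for i
      unfolding eq minus_in_Ints_iff by (rule L(2)) (use that in \<open>unfold X_def, blast\<close>)
    show "ln \<bar>r' j\<bar> / (-\<tau> / real L) \<in> \<int>" if "j \<in> {1..N}" for j
      unfolding eq minus_in_Ints_iff by (rule L(2)) (use that in \<open>unfold X_def, blast\<close>)
  qed
qed

text \<open>
  If the logarithms of the two word ratios are \<open>-k\<theta>\<close> and \<open>-l\<theta>\<close>, the \<open>2l\<close>-th power of the first ratio equals
  the \<open>2k\<close>-th power of the second; the even exponents remove the signs. Repeating the words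
  accordingly balances them.
\<close>
lemma balanced_extension:
  assumes \<theta>: "0 < \<theta>" "\<And>i. i \<in> {1..M} \<Longrightarrow> ln \<bar>r i\<bar> / \<theta> \<in> \<int>" "\<And>j. j \<in> {1..N} \<Longrightarrow> ln \<bar>r' j\<bar> / \<theta> \<in> \<int>"
    and u: "set u \<subseteq> {1..M}" "u \<noteq> []" and v: "set v \<subseteq> {1..N}" "v \<noteq> []"
  obtains z w where "set z \<subseteq> {1..M}" "set w \<subseteq> {1..N}"
    "A.word_ratio u * A.word_ratio z = B.word_ratio v * B.word_ratio w"
proof -
  let ?U = "A.word_ratio u" and ?V = "B.word_ratio v"
  have nz: "?U \<noteq> 0" "?V \<noteq> 0" using A.word_ratio_nz B.word_ratio_nz u v by auto
  have lt: "ln \<bar>?U\<bar> < 0" "ln \<bar>?V\<bar> < 0"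
    using A.word_ratio_abs_less_1[OF u] B.word_ratio_abs_less_1[OF v] nz by auto
  obtain m where m: "ln \<bar>?U\<bar> / \<theta> = of_int m" using A.ln_word_ratio[OF \<theta>(2) u(1)] by (auto elim: Ints_cases)
  obtain n where n: "ln \<bar>?V\<bar> / \<theta> = of_int n" using B.ln_word_ratio[OF \<theta>(3) v(1)] by (auto elim: Ints_cases)
  have "of_int m < (0::real)" "of_int n < (0::real)"
    using lt \<theta>(1) unfolding m[symmetric] n[symmetric] by (auto intro: divide_neg_pos)
  then have neg: "m < 0" "n < 0" by auto
  define k where "k = nat (- m)"
  define l where "l = nat (- n)"
  have kl: "0 < k" "0 < l" "ln \<bar>?U\<bar> = - \<theta> * real k" "ln \<bar>?V\<bar> = - \<theta> * real l"
    using neg m n \<theta>(1) by (auto simp: k_def l_def field_simps)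
  have "ln (\<bar>?U\<bar> ^ (2 * l)) = ln (\<bar>?V\<bar> ^ (2 * k))"
    using nz kl by (simp add: ln_realpow)
  then have "\<bar>?U\<bar> ^ (2 * l) = \<bar>?V\<bar> ^ (2 * k)" using nz by simp
  then have eq: "?U ^ (2 * l) = ?V ^ (2 * k)" by (simp add: power_mult)
  show ?thesis
  proof (rule that)
    show "set (concat (replicate (2 * l - 1) u)) \<subseteq> {1..M}" using u by (auto simp: set_replicate_conv_if)
    show "set (concat (replicate (2 * k - 1) v)) \<subseteq> {1..N}" using v by (auto simp: set_replicate_conv_if)
    have "?U * ?U ^ (2 * l - 1) = ?U ^ (2 * l)" using kl by (metis power_Suc Suc_pred' mult_pos_pos zero_less_numeral One_nat_def diff_Suc_1 Suc_diff_1)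
    moreover have "?V * ?V ^ (2 * k - 1) = ?V ^ (2 * k)" using kl by (metis power_Suc Suc_pred' mult_pos_pos zero_less_numeral One_nat_def diff_Suc_1 Suc_diff_1)
    ultimately show "A.word_ratio u * A.word_ratio (concat (replicate (2 * l - 1) u)) =
      B.word_ratio v * B.word_ratio (concat (replicate (2 * k - 1) v))"
      using eq by (simp add: A.word_ratio_power B.word_ratio_power)
  qed
qed

text \<open>
  The extension depends only on the quotient of the two ratios. In a bounded window these quotients
  take finitely many values, namely \<open>\<plusminus> exp (k\<theta>)\<close> with \<open>k\<close> in a finite range, so one extension for each
  value gives a uniform lower bound \<open>\<eta>\<close>.
\<close>
lemma balanced_extension_uniform:
  assumes rat: "\<And>i j. i \<in> {1..M} \<Longrightarrow> j \<in> {1..N} \<Longrightarrow> ln \<bar>r i\<bar> / ln \<bar>r' j\<bar> \<in> \<rat>"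
    and "0 < c1"
  obtains \<eta> where "0 < \<eta>" "\<And>u v. set u \<subseteq> {1..M} \<Longrightarrow> u \<noteq> [] \<Longrightarrow> set v \<subseteq> {1..N} \<Longrightarrow> v \<noteq> [] \<Longrightarrow>
    c1 \<le> \<bar>A.word_ratio u / B.word_ratio v\<bar> \<Longrightarrow> \<bar>A.word_ratio u / B.word_ratio v\<bar> \<le> c2 \<Longrightarrow>
    \<exists>z w. set z \<subseteq> {1..M} \<and> set w \<subseteq> {1..N} \<and>
      A.word_ratio u * A.word_ratio z = B.word_ratio v * B.word_ratio w \<and> \<eta> \<le> \<bar>A.word_ratio z\<bar>"
proof -
  obtain \<theta> where \<theta>: "0 < \<theta>" "\<And>i. i \<in> {1..M} \<Longrightarrow> ln \<bar>r i\<bar> / \<theta> \<in> \<int>"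
      "\<And>j. j \<in> {1..N} \<Longrightarrow> ln \<bar>r' j\<bar> / \<theta> \<in> \<int>"
    using common_log_unit[OF rat] by metis
  define T where "T = {A.word_ratio u / B.word_ratio v | u v. set u \<subseteq> {1..M} \<and> u \<noteq> [] \<and> set v \<subseteq> {1..N} \<and> v \<noteq> [] \<and>
    c1 \<le> \<bar>A.word_ratio u / B.word_ratio v\<bar> \<and> \<bar>A.word_ratio u / B.word_ratio v\<bar> \<le> c2}"
  have "T \<subseteq> (\<lambda>(s, k). s * exp (\<theta> * of_int k)) ` ({1, -1} \<times> {\<lfloor>ln c1 / \<theta>\<rfloor>..\<lceil>ln c2 / \<theta>\<rceil>})"
  proof
    fix \<tau> assume "\<tau> \<in> T"
    then obtain u v where uv: "\<tau> = A.word_ratio u / B.word_ratio v" "set u \<subseteq> {1..M}" "set v \<subseteq> {1..N}"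
      "c1 \<le> \<bar>\<tau>\<bar>" "\<bar>\<tau>\<bar> \<le> c2" unfolding T_def by blast
    have "\<tau> \<noteq> 0" using uv(4) assms(2) by auto
    have "ln \<bar>\<tau>\<bar> / \<theta> = ln \<bar>A.word_ratio u\<bar> / \<theta> - ln \<bar>B.word_ratio v\<bar> / \<theta>"
      using A.word_ratio_nz[OF uv(2)] B.word_ratio_nz[OF uv(3)]
      by (simp add: uv(1) abs_divide ln_div diff_divide_distrib)
    then have "ln \<bar>\<tau>\<bar> / \<theta> \<in> \<int>"
      using A.ln_word_ratio[OF \<theta>(2) uv(2)] B.ln_word_ratio[OF \<theta>(3) uv(3)] by simp
    then obtain k where k: "ln \<bar>\<tau>\<bar> / \<theta> = of_int k" by (rule Ints_cases)
    have "\<bar>\<tau>\<bar> = exp (\<theta> * of_int k)" using \<theta>(1) \<open>\<tau> \<noteq> 0\<close> unfolding k[symmetric] by simp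
    then have "\<tau> = sgn \<tau> * exp (\<theta> * of_int k)" by (metis sgn_mult_abs)
    moreover have "sgn \<tau> \<in> {1, -1}" using \<open>\<tau> \<noteq> 0\<close> by (auto simp: sgn_if)
    moreover have "ln c1 / \<theta> \<le> of_int k" "of_int k \<le> ln c2 / \<theta>"
      unfolding k[symmetric] using uv(4,5) assms(2) \<theta>(1) \<open>\<tau> \<noteq> 0\<close> by (auto intro!: divide_right_mono)
    then have "k \<in> {\<lfloor>ln c1 / \<theta>\<rfloor>..\<lceil>ln c2 / \<theta>\<rceil>}" by (simp add: floor_le_iff le_ceiling_iff)
    ultimately show "\<tau> \<in> (\<lambda>(s, k). s * exp (\<theta> * of_int k)) ` ({1, -1} \<times> {\<lfloor>ln c1 / \<theta>\<rfloor>..\<lceil>ln c2 / \<theta>\<rceil>})"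
      by (intro image_eqI[of _ _ "(sgn \<tau>, k)"]) auto
  qed
  then have "finite T" by (rule finite_subset) auto
  have "\<exists>z w. set z \<subseteq> {1..M} \<and> set w \<subseteq> {1..N} \<and> \<tau> * A.word_ratio z = B.word_ratio w" if "\<tau> \<in> T" for \<tau>
  proof -
    obtain u v where uv: "\<tau> = A.word_ratio u / B.word_ratio v" "set u \<subseteq> {1..M}" "u \<noteq> []" "set v \<subseteq> {1..N}" "v \<noteq> []"
      using \<open>\<tau> \<in> T\<close> unfolding T_def by blast
    obtain z w where "set z \<subseteq> {1..M}" "set w \<subseteq> {1..N}"
      "A.word_ratio u * A.word_ratio z = B.word_ratio v * B.word_ratio w"
      using balanced_extension[OF \<theta> uv(2-5)] by blast
    then show ?thesis using B.word_ratio_nz[OF uv(4)]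
      by (intro exI[of _ z] exI[of _ w]) (simp add: uv(1) field_simps)
  qed
  then obtain z w where zw: "\<And>\<tau>. \<tau> \<in> T \<Longrightarrow> set (z \<tau>) \<subseteq> {1..M} \<and> set (w \<tau>) \<subseteq> {1..N} \<and> \<tau> * A.word_ratio (z \<tau>) = B.word_ratio (w \<tau>)"
    by metis
  define \<eta> where "\<eta> = Min (insert 1 ((\<lambda>\<tau>. \<bar>A.word_ratio (z \<tau>)\<bar>) ` T))"
  show ?thesis
  proof (rule that)
    show "0 < \<eta>" unfolding \<eta>_def using \<open>finite T\<close> zw A.word_ratio_nz by (subst Min_gr_iff) auto
    fix u v assume uv: "set u \<subseteq> {1..M}" "u \<noteq> []" "set v \<subseteq> {1..N}" "v \<noteq> []"
      "c1 \<le> \<bar>A.word_ratio u / B.word_ratio v\<bar>" "\<bar>A.word_ratio u / B.word_ratio v\<bar> \<le> c2"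
    define \<tau> where "\<tau> = A.word_ratio u / B.word_ratio v"
    have \<tau>: "\<tau> \<in> T" using uv unfolding T_def \<tau>_def by blast
    have "\<eta> \<le> \<bar>A.word_ratio (z \<tau>)\<bar>" unfolding \<eta>_def using \<open>finite T\<close> \<tau> by (intro Min_le) auto
    moreover have "A.word_ratio u * A.word_ratio (z \<tau>) = B.word_ratio v * B.word_ratio (w \<tau>)"
      using zw[OF \<tau>] B.word_ratio_nz[OF uv(3)] by (simp add: \<tau>_def field_simps)
    ultimately show "\<exists>z w. set z \<subseteq> {1..M} \<and> set w \<subseteq> {1..N} \<and>
      A.word_ratio u * A.word_ratio z = B.word_ratio v * B.word_ratio w \<and> \<eta> \<le> \<bar>A.word_ratio z\<bar>"
      using zw[OF \<tau>] by blast
  qed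
qed

text \<open>
  Near \<open>p = x - y\<close>, cylinders of \<open>x\<close> and \<open>y\<close> of size about \<open>\<delta>\<close> are extended to a balanced pair, whose
  contribution to the difference set is a scaled copy of \<open>\<Delta>\<close> itself.
\<close>
lemma copies_in_balls:
  assumes rat: "\<And>i j. i \<in> {1..M} \<Longrightarrow> j \<in> {1..N} \<Longrightarrow> ln \<bar>r i\<bar> / ln \<bar>r' j\<bar> \<in> \<rat>"
  obtains \<eta> where "0 < \<eta>" "\<And>p \<delta>. p \<in> \<Delta> \<Longrightarrow> 0 < \<delta> \<Longrightarrow> \<delta> \<le> 1 \<Longrightarrow>
     \<exists>c e. \<eta> * \<delta> \<le> \<bar>c\<bar> \<and> \<bar>c\<bar> \<le> \<delta> \<and> (\<lambda>z. c * z + e) ` \<Delta> \<subseteq> \<Delta> \<inter> cball p ((a + b) * \<delta>)"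
proof -
  obtain \<rho>1 where \<rho>1: "0 < \<rho>1" "\<rho>1 < 1" "\<And>i. i \<in> {1..M} \<Longrightarrow> \<rho>1 \<le> \<bar>r i\<bar>"
    using A.ratio_lower by blast
  obtain \<rho>2 where \<rho>2: "0 < \<rho>2" "\<rho>2 < 1" "\<And>j. j \<in> {1..N} \<Longrightarrow> \<rho>2 \<le> \<bar>r' j\<bar>"
    using B.ratio_lower by blast
  obtain \<eta> where \<eta>: "0 < \<eta>" "\<And>u v. set u \<subseteq> {1..M} \<Longrightarrow> u \<noteq> [] \<Longrightarrow> set v \<subseteq> {1..N} \<Longrightarrow> v \<noteq> [] \<Longrightarrow>
    \<rho>1 \<le> \<bar>A.word_ratio u / B.word_ratio v\<bar> \<Longrightarrow> \<bar>A.word_ratio u / B.word_ratio v\<bar> \<le> 1 / \<rho>2 \<Longrightarrow>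
    \<exists>z w. set z \<subseteq> {1..M} \<and> set w \<subseteq> {1..N} \<and>
      A.word_ratio u * A.word_ratio z = B.word_ratio v * B.word_ratio w \<and> \<eta> \<le> \<bar>A.word_ratio z\<bar>"
    by (rule balanced_extension_uniform[OF rat \<rho>1(1), of "1/\<rho>2"]) (assumption | blast)+
  show ?thesis
  proof (rule that[of "\<rho>1 * \<eta>"])
    show "0 < \<rho>1 * \<eta>" using \<rho>1 \<eta> by simp
    fix p \<delta> :: real assume p: "p \<in> \<Delta>" and \<delta>: "0 < \<delta>" "\<delta> \<le> 1"
    obtain x y where xy: "p = x - y" "x \<in> K" "y \<in> K'" using p by (auto simp: scaled_difference_def)
    obtain u x' where u: "set u \<subseteq> {1..M}" "u \<noteq> []" "x' \<in> K" "x = A.word_map u x'"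
      "\<rho>1 * \<delta> \<le> \<bar>A.word_ratio u\<bar>" "\<bar>A.word_ratio u\<bar> \<le> \<delta>"
      using A.small_cylinder[OF \<rho>1(1,3) xy(2) \<delta>] .
    obtain v y' where v: "set v \<subseteq> {1..N}" "v \<noteq> []" "y' \<in> K'" "y = B.word_map v y'"
      "\<rho>2 * \<delta> \<le> \<bar>B.word_ratio v\<bar>" "\<bar>B.word_ratio v\<bar> \<le> \<delta>"
      using B.small_cylinder[OF \<rho>2(1,3) xy(3) \<delta>] .
    have vpos: "0 < \<bar>B.word_ratio v\<bar>" using B.word_ratio_nz[OF v(1)] by simp
    have 1: "\<rho>1 \<le> \<bar>A.word_ratio u / B.word_ratio v\<bar>"
    proof -
      have "\<rho>1 * \<bar>B.word_ratio v\<bar> \<le> \<rho>1 * \<delta>" using v(6) \<rho>1 by (intro mult_left_mono) auto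
      also have "\<dots> \<le> \<bar>A.word_ratio u\<bar>" by (rule u(5))
      finally show ?thesis using vpos by (simp add: abs_divide field_simps)
    qed
    have 2: "\<bar>A.word_ratio u / B.word_ratio v\<bar> \<le> 1 / \<rho>2"
    proof -
      have "\<rho>2 * \<bar>A.word_ratio u\<bar> \<le> \<rho>2 * \<delta>" using u(6) \<rho>2 by (intro mult_left_mono) auto
      also have "\<dots> \<le> \<bar>B.word_ratio v\<bar>" by (rule v(5))
      finally show ?thesis using vpos \<rho>2 by (simp add: abs_divide field_simps)
    qed
    obtain z w where zw: "set z \<subseteq> {1..M}" "set w \<subseteq> {1..N}"
      "A.word_ratio u * A.word_ratio z = B.word_ratio v * B.word_ratio w" "\<eta> \<le> \<bar>A.word_ratio z\<bar>"
      using \<eta>(2)[OF u(1,2) v(1,2) 1 2] by blast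
    define c where "c = A.word_ratio u * A.word_ratio z"
    define e where "e = A.word_map (u @ z) 0 - B.word_map (v @ w) 0"
    show "\<exists>c e. \<rho>1 * \<eta> * \<delta> \<le> \<bar>c\<bar> \<and> \<bar>c\<bar> \<le> \<delta> \<and> (\<lambda>z. c * z + e) ` \<Delta> \<subseteq> \<Delta> \<inter> cball p ((a + b) * \<delta>)"
    proof (intro exI conjI)
      have "(\<rho>1 * \<delta>) * \<eta> \<le> \<bar>A.word_ratio u\<bar> * \<bar>A.word_ratio z\<bar>"
        using u(5) zw(4) \<eta>(1) by (intro mult_mono) auto
      then show "\<rho>1 * \<eta> * \<delta> \<le> \<bar>c\<bar>" by (simp add: c_def abs_mult algebra_simps)
      have "\<bar>A.word_ratio z\<bar> \<le> 1"
        using A.word_ratio_abs_less_1[OF zw(1)] by (cases "z = []") auto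
      then have "\<bar>A.word_ratio u\<bar> * \<bar>A.word_ratio z\<bar> \<le> \<delta> * 1" using u(6) by (intro mult_mono) auto
      then show "\<bar>c\<bar> \<le> \<delta>" by (simp add: c_def abs_mult)
      show "(\<lambda>z. c * z + e) ` \<Delta> \<subseteq> \<Delta> \<inter> cball p ((a + b) * \<delta>)"
      proof
        fix q assume "q \<in> (\<lambda>z. c * z + e) ` \<Delta>"
        then obtain x1 y1 where q: "q = c * (x1 - y1) + e" "x1 \<in> K" "y1 \<in> K'"
          by (auto simp: scaled_difference_def)
        have "A.word_map (u @ z) x1 = c * x1 + A.word_map (u @ z) 0"
          using A.word_map_affine[of "u @ z" x1] by (simp add: c_def)
        moreover have "B.word_map (v @ w) y1 = c * y1 + B.word_map (v @ w) 0"
          using B.word_map_affine[of "v @ w" y1] zw(3) by (simp add: c_def)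
        ultimately have q2: "q = A.word_map u (A.word_map z x1) - B.word_map v (B.word_map w y1)"
          unfolding q(1) e_def by (simp add: algebra_simps)
        define x2 where "x2 = A.word_map z x1"
        define y2 where "y2 = B.word_map w y1"
        have in2: "x2 \<in> K" "y2 \<in> K'" unfolding x2_def y2_def
          using A.word_map_in B.word_map_in zw q by auto
        have "q \<in> \<Delta>" unfolding q2 x2_def[symmetric] y2_def[symmetric]
          using A.word_map_in[OF u(1) in2(1)] B.word_map_in[OF v(1) in2(2)] by (auto simp: scaled_difference_def)
        moreover have "\<bar>p - q\<bar> \<le> (a + b) * \<delta>"
        proof -
          have "p - q = A.word_ratio u * (x' - x2) - B.word_ratio v * (y' - y2)"
            unfolding xy(1) u(4) v(4) q2 x2_def[symmetric] y2_def[symmetric]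
            using A.word_map_affine[of u x'] A.word_map_affine[of u x2]
              B.word_map_affine[of v y'] B.word_map_affine[of v y2] by (simp add: algebra_simps)
          then have "\<bar>p - q\<bar> \<le> \<bar>A.word_ratio u\<bar> * \<bar>x' - x2\<bar> + \<bar>B.word_ratio v\<bar> * \<bar>y' - y2\<bar>"
            by (metis abs_mult abs_triangle_ineq4)
          also have "\<dots> \<le> \<delta> * a + \<delta> * b"
          proof (intro add_mono mult_mono u v)
            have "x' \<in> {0..a}" "x2 \<in> {0..a}" "y' \<in> {0..b}" "y2 \<in> {0..b}"
              using u(3) v(3) in2 A.K_sub B.K_sub by blast+
            then show "\<bar>x' - x2\<bar> \<le> a" "\<bar>y' - y2\<bar> \<le> b" by auto
          qed (use \<delta> in auto)
          finally show ?thesis by (simp add: algebra_simps)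
        qed
        ultimately show "q \<in> \<Delta> \<inter> cball p ((a + b) * \<delta>)" by (simp add: dist_real_def)
      qed
    qed
  qed
qed

text \<open>
  Separated points of \<open>\<Delta>\<close> at scale \<open>\<epsilon>\<close> carry separated copies of \<open>\<Delta>\<close> of size about \<open>\<eta>\<epsilon>\<close>. If there
  were more than \<open>(\<eta>\<epsilon>)\<^sup>-\<^sup>\<sigma>\<close> of them for some \<open>\<sigma>\<close> above the dimension, the blow-up principle would make
  the dimension at least \<open>\<sigma>\<close>. Letting \<open>\<sigma>\<close> decrease to the dimension gives the net bound.
\<close>
theorem net_bounded_difference_commensurable:
  assumes rat: "\<And>i j. i \<in> {1..M} \<Longrightarrow> j \<in> {1..N} \<Longrightarrow> ln \<bar>r i\<bar> / ln \<bar>r' j\<bar> \<in> \<rat>"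
  shows "net_bounded (hausdorff_dim \<Delta>) \<Delta>"
proof -
  define s where "s = hausdorff_dim \<Delta>"
  have s: "0 \<le> s" unfolding s_def by (rule hausdorff_dim_nonneg[OF compact_\<Delta> \<Delta>_ne])
  obtain \<eta> where \<eta>: "0 < \<eta>" "\<And>p \<delta>. p \<in> \<Delta> \<Longrightarrow> 0 < \<delta> \<Longrightarrow> \<delta> \<le> 1 \<Longrightarrow>
     \<exists>c e. \<eta> * \<delta> \<le> \<bar>c\<bar> \<and> \<bar>c\<bar> \<le> \<delta> \<and> (\<lambda>z. c * z + e) ` \<Delta> \<subseteq> \<Delta> \<inter> cball p ((a + b) * \<delta>)"
    using copies_in_balls[OF rat] by blast
  define D where "D = a + b + 1"
  have D: "1 \<le> D" "a + b \<le> D" using A.a_pos B.a_pos by (auto simp: D_def)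
  have "\<exists>S. finite S \<and> real (card S) \<le> (\<eta> / (6 * D)) powr (-s) * \<delta> powr (-s) \<and> \<Delta> \<subseteq> (\<Union>x\<in>S. cball x \<delta>)"
    if \<delta>: "\<delta> \<in> {0<..1}" for \<delta>
  proof -
    \<comment> \<open>Copies lie within \<open>D\<epsilon>\<close> of their points; points more than \<open>3D\<epsilon>\<close> apart leave gaps of \<open>D\<epsilon>\<close>, and the net
      of radius \<open>3D\<epsilon>\<close> for a net of radius \<open>3D\<epsilon>\<close> has radius \<open>6D\<epsilon> = \<delta>\<close>.\<close>
    define \<epsilon> where "\<epsilon> = \<delta> / (6 * D)"
    have \<epsilon>: "0 < \<epsilon>" "\<epsilon> \<le> 1/6" "6 * D * \<epsilon> = \<delta>" using \<delta> D by (auto simp: \<epsilon>_def field_simps)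
    have "\<Delta> \<subseteq> (\<Union>x\<in>\<Delta>. ball x (3 * D * \<epsilon>))" using \<epsilon> D by auto
    then obtain P where P: "P \<subseteq> \<Delta>" "finite P" "\<Delta> \<subseteq> (\<Union>x\<in>P. ball x (3 * D * \<epsilon>))"
      using compactE_image[OF compact_\<Delta>, of \<Delta> "\<lambda>x. ball x (3 * D * \<epsilon>)"] by auto
    have nn: "0 \<le> 3 * D * \<epsilon>" using \<epsilon> D by simp
    obtain S where S: "S \<subseteq> P" "\<forall>p\<in>S. \<forall>q\<in>S. p \<noteq> q \<longrightarrow> 3 * D * \<epsilon> < \<bar>id p - id q\<bar>"
      "\<forall>p\<in>P. \<exists>s\<in>S. \<bar>id p - id s\<bar> \<le> 3 * D * \<epsilon>"
      using separated_subset[OF P(2) nn, of id] .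
    have fin: "finite S" using S(1) P(2) finite_subset by blast
    have SD: "S \<subseteq> \<Delta>" using S(1) P(1) by blast
    have cov: "\<Delta> \<subseteq> (\<Union>x\<in>S. cball x \<delta>)"
    proof
      fix x assume "x \<in> \<Delta>"
      then obtain p where "p \<in> P" "\<bar>p - x\<bar> < 3 * D * \<epsilon>" using P(3) by (auto simp: dist_real_def)
      moreover obtain y where "y \<in> S" "\<bar>p - y\<bar> \<le> 3 * D * \<epsilon>"
        using S(3) \<open>p \<in> P\<close> unfolding id_apply by blast
      ultimately have "\<bar>y - x\<bar> \<le> \<delta>" using \<epsilon>(3) by linarith
      then show "x \<in> (\<Union>x\<in>S. cball x \<delta>)" using \<open>y \<in> S\<close> by (auto simp: dist_real_def)
    qed
    have card_lt: "real (card S) \<le> (\<eta> * \<epsilon>) powr (-\<sigma>)" if \<sigma>: "s < \<sigma>" for \<sigma>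
    proof (rule ccontr)
      assume "\<not> ?thesis"
      then have "(\<eta> * \<epsilon>) powr (-\<sigma>) * (\<eta> * \<epsilon>) powr \<sigma> \<le> real (card S) * (\<eta> * \<epsilon>) powr \<sigma>"
        by (intro mult_right_mono) auto
      then have big: "1 \<le> real (card S) * (\<eta> * \<epsilon>) powr \<sigma>"
        using \<eta> \<epsilon> by (simp add: powr_minus)
      have "\<forall>p\<in>S. \<exists>c e. \<eta> * \<epsilon> \<le> \<bar>c\<bar> \<and> \<bar>c\<bar> \<le> \<epsilon> \<and> (\<lambda>z. c * z + e) ` \<Delta> \<subseteq> \<Delta> \<inter> cball p ((a + b) * \<epsilon>)"
        using \<eta>(2) SD \<epsilon> by auto
      from bchoice[OF this] obtain c where "\<forall>p\<in>S. \<exists>e. \<eta> * \<epsilon> \<le> \<bar>c p\<bar> \<and> \<bar>c p\<bar> \<le> \<epsilon> \<and>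
          (\<lambda>z. c p * z + e) ` \<Delta> \<subseteq> \<Delta> \<inter> cball p ((a + b) * \<epsilon>)" by blast
      from bchoice[OF this] obtain e where ce': "\<forall>p\<in>S. \<eta> * \<epsilon> \<le> \<bar>c p\<bar> \<and> \<bar>c p\<bar> \<le> \<epsilon> \<and>
          (\<lambda>z. c p * z + e p) ` \<Delta> \<subseteq> \<Delta> \<inter> cball p ((a + b) * \<epsilon>)" by blast
      note ce = ce'[rule_format]
      have "(D * \<epsilon> / 2) powr \<sigma> \<le> cover_cost \<sigma> L" if L: "ball_cover \<Delta> L" for L
      proof -
        have "1 * (D * \<epsilon> / 2) powr \<sigma> \<le> 1 * cover_cost \<sigma> L"
        proof (rule self_reproducing_cover_bound[where X = "{()}" and A = "\<lambda>_. \<Delta>" and w = "\<lambda>_. 1" and x = "()" and \<kappa> = "1/6"])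
          show "\<exists>(I::real set) c e y. finite I \<and>
            (\<forall>i\<in>I. y i \<in> {()} \<and> 0 < \<bar>c i\<bar> \<and> \<bar>c i\<bar> \<le> 1/6 \<and> (\<lambda>z. c i * z + e i) ` \<Delta> \<subseteq> \<Delta>) \<and>
            (\<forall>i\<in>I. \<forall>j\<in>I. i \<noteq> j \<longrightarrow> (\<forall>p\<in>\<Delta>. \<forall>q\<in>\<Delta>. D * \<epsilon> \<le> \<bar>(c i * p + e i) - (c j * q + e j)\<bar>)) \<and>
            (1::real) \<le> (\<Sum>i\<in>I. \<bar>c i\<bar> powr \<sigma> * 1)"
          proof (intro exI conjI)
            show "finite S" by (rule fin)
            show "\<forall>i\<in>S. () \<in> {()} \<and> 0 < \<bar>c i\<bar> \<and> \<bar>c i\<bar> \<le> 1/6 \<and> (\<lambda>z. c i * z + e i) ` \<Delta> \<subseteq> \<Delta>"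
            proof
              fix i assume i: "i \<in> S"
              have "0 < \<eta> * \<epsilon>" using \<eta> \<epsilon> by simp
              then have "0 < \<bar>c i\<bar>" "\<bar>c i\<bar> \<le> 1/6" "(\<lambda>z. c i * z + e i) ` \<Delta> \<subseteq> \<Delta>"
                using ce[OF i] \<epsilon> by auto
              then show "() \<in> {()} \<and> 0 < \<bar>c i\<bar> \<and> \<bar>c i\<bar> \<le> 1/6 \<and> (\<lambda>z. c i * z + e i) ` \<Delta> \<subseteq> \<Delta>" by blast
            qed
            show "\<forall>i\<in>S. \<forall>j\<in>S. i \<noteq> j \<longrightarrow> (\<forall>p\<in>\<Delta>. \<forall>q\<in>\<Delta>. D * \<epsilon> \<le> \<bar>(c i * p + e i) - (c j * q + e j)\<bar>)"
            proof (intro ballI impI)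
              fix i j p q assume ij: "i \<in> S" "j \<in> S" "i \<noteq> j" and pq: "p \<in> \<Delta>" "q \<in> \<Delta>"
              have "\<bar>i - (c i * p + e i)\<bar> \<le> (a + b) * \<epsilon>" "\<bar>j - (c j * q + e j)\<bar> \<le> (a + b) * \<epsilon>"
                using ce[OF ij(1)] ce[OF ij(2)] pq by (auto simp: dist_real_def)
              moreover have "(a + b) * \<epsilon> \<le> D * \<epsilon>" using D \<epsilon> by (intro mult_right_mono) auto
              moreover have "3 * (D * \<epsilon>) < \<bar>i - j\<bar>" using S(2) ij by (simp add: mult.assoc)
              ultimately show "D * \<epsilon> \<le> \<bar>(c i * p + e i) - (c j * q + e j)\<bar>" by linarith
            qed
            have "1 \<le> (\<Sum>i\<in>S. (\<eta> * \<epsilon>) powr \<sigma>)" using big by simp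
            also have "\<dots> \<le> (\<Sum>i\<in>S. \<bar>c i\<bar> powr \<sigma> * 1)"
            proof (rule sum_mono)
              fix i assume "i \<in> S"
              then show "(\<eta> * \<epsilon>) powr \<sigma> \<le> \<bar>c i\<bar> powr \<sigma> * 1"
                using ce \<eta> \<epsilon> s \<sigma> by (simp add: powr_mono2)
            qed
            finally show "1 \<le> (\<Sum>i\<in>S. \<bar>c i\<bar> powr \<sigma> * 1)" .
          qed
        qed (use D \<epsilon> s \<sigma> L \<Delta>_ne in auto)
        then show ?thesis by simp
      qed
      then have "\<sigma> \<le> s" unfolding s_def using D \<epsilon> s \<sigma>
        by (intro hausdorff_dim_ge[OF compact_\<Delta>, of _ "(D * \<epsilon> / 2) powr \<sigma>"]) auto
      then show False using \<sigma> by simp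
    qed
    have "((\<lambda>\<sigma>. (\<eta> * \<epsilon>) powr (-\<sigma>)) \<longlongrightarrow> (\<eta> * \<epsilon>) powr (-s)) (at_right s)"
      using \<eta> \<epsilon> by (intro tendsto_intros) auto
    then have "real (card S) \<le> (\<eta> * \<epsilon>) powr (-s)"
      by (rule tendsto_lowerbound) (use card_lt in \<open>auto simp: eventually_at_filter\<close>)
    also have "\<dots> = (\<eta> / (6 * D)) powr (-s) * \<delta> powr (-s)"
      using \<eta> D \<delta> by (simp add: \<epsilon>_def powr_mult[symmetric])
    finally show ?thesis using fin cov by blast
  qed
  then show ?thesis unfolding net_bounded_def s_def by blast
qed

end

section \<open>Homogeneous systems and irrational rotations\<close>

text \<open>
  Assign every element to a nearby element of the net \<open>S\<close>. Elements assigned to the same point form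
  close pairs, and by the Cauchy-Schwarz inequality \<open>card S\<close> classes produce at least
  \<open>(card P)\<^sup>2 / card S\<close> such pairs.
\<close>
lemma card_squared_le_separated_times_close_pairs:
  fixes f :: "'a \<Rightarrow> real"
  assumes "finite P" "S \<subseteq> P" "\<forall>p\<in>P. \<exists>s\<in>S. \<bar>f p - f s\<bar> \<le> d"
  shows "(real (card P))\<^sup>2 \<le> real (card S) * real (card {(x, y). x \<in> P \<and> y \<in> P \<and> \<bar>f x - f y\<bar> \<le> 2 * d})"
proof -
  have fS: "finite S" using assms finite_subset by blast
  have "\<forall>p\<in>P. \<exists>s. s \<in> S \<and> \<bar>f p - f s\<bar> \<le> d" using assms(3) by blast
  from bchoice[OF this] obtain c where c: "\<forall>p\<in>P. c p \<in> S \<and> \<bar>f p - f (c p)\<bar> \<le> d" by blast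
  define F where "F s = {p \<in> P. c p = s}" for s
  have finF: "finite (F s)" for s using assms(1) by (simp add: F_def)
  let ?Q = "{(x, y). x \<in> P \<and> y \<in> P \<and> \<bar>f x - f y\<bar> \<le> 2 * d}"
  have "(\<Sum>s\<in>S. (real (card (F s)))\<^sup>2) = real (\<Sum>s\<in>S. card (F s \<times> F s))"
    by (simp add: power2_eq_square card_cartesian_product)
  also have "(\<Sum>s\<in>S. card (F s \<times> F s)) = card (\<Union>s\<in>S. F s \<times> F s)"
    by (rule card_UN_disjoint[symmetric]) (use fS finF in \<open>auto simp: F_def\<close>)
  also have "real \<dots> \<le> real (card ?Q)"
  proof (rule of_nat_mono[OF card_mono])
    show "finite ?Q"
      by (rule finite_subset[of _ "P \<times> P"]) (use assms(1) in auto)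
    show "(\<Union>s\<in>S. F s \<times> F s) \<subseteq> ?Q"
    proof clarify
      fix s x y assume "s \<in> S" "x \<in> F s" "y \<in> F s"
      then have xy: "x \<in> P" "y \<in> P" "c x = s" "c y = s" by (auto simp: F_def)
      then have "\<bar>f x - f s\<bar> \<le> d" "\<bar>f y - f s\<bar> \<le> d" using c by auto
      then show "x \<in> P \<and> y \<in> P \<and> \<bar>f x - f y\<bar> \<le> 2 * d" using xy by auto
    qed
  qed
  finally have Q: "(\<Sum>s\<in>S. (real (card (F s)))\<^sup>2) \<le> real (card ?Q)" .
  have "card P = (\<Sum>s\<in>S. card (F s))"
    unfolding F_def using c by (subst card_eq_sum, subst sum.group[symmetric, OF assms(1) fS]) auto
  then have "(real (card P))\<^sup>2 = (\<Sum>s\<in>S. real (card (F s)))\<^sup>2" by simp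
  also have "\<dots> \<le> (\<Sum>s\<in>S. (real (card (F s)))\<^sup>2) * real (card S)"
    by (rule sum_squared_le_sum_of_squares)
  also have "\<dots> \<le> real (card ?Q) * real (card S)"
    using Q by (rule mult_right_mono) simp
  finally show ?thesis by (simp add: mult.commute)
qed

text \<open>
  The upper half of equidistribution for an irrational rotation, uniformly in the starting point: an
  arc of length \<open>1/(2L)\<close> is visited at most \<open>2n/L\<close> times in a long time \<open>n\<close>. The visits are described only by
  their pairwise distances, so the arc itself does not occur. Choose \<open>m\<close> such that \<open>m\<theta>\<close> is between \<open>1/(2L)\<close> and
  \<open>1/L\<close> modulo \<open>1\<close>; then the set \<open>S\<close> of visiting times and its shifts by \<open>m, 2m, \<dots>, (L-1)m\<close> are disjoint.
\<close>
lemma rotation_visits_bound: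
  fixes \<theta> :: real and Lmax :: nat
  assumes "\<theta> \<notin> \<rat>"
  obtains n0 where "\<forall>L\<in>{1..Lmax}. \<forall>n\<ge>n0. \<forall>S\<subseteq>{..<n}.
    (\<forall>k\<in>S. \<forall>k'\<in>S. \<exists>z::int. \<bar>(real k - real k') * \<theta> - of_int z\<bar> \<le> 1 / (2 * real L)) \<longrightarrow> card S * L \<le> 2 * n"
proof -
  have ex: "\<exists>m. \<forall>n\<ge>L * m. \<forall>S\<subseteq>{..<n}.
    (\<forall>k\<in>S. \<forall>k'\<in>S. \<exists>z::int. \<bar>(real k - real k') * \<theta> - of_int z\<bar> \<le> 1 / (2 * real L)) \<longrightarrow> card S * L \<le> 2 * n"
    if L: "L \<in> {1..Lmax}" for L
  proof -
    have Lpos: "0 < real L" using L by simp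
    obtain m :: nat where m: "\<bar>frac (real m * \<theta>) - 3 / (4 * real L)\<bar> < 1 / (4 * real L)"
    proof -
      have "0 \<le> 3 / (4 * real L)" "3 / (4 * real L) \<le> 1" "0 < 1 / (4 * real L)" using L by (auto simp: field_simps)
      then show ?thesis using Kronecker_approx_1_explicit[OF assms] that by metis
    qed
    define \<phi> where "\<phi> = frac (real m * \<theta>)"
    have \<phi>: "1 / (2 * real L) < \<phi>" "\<phi> < 1 / real L"
    proof -
      have "3 / (4 * real L) - 1 / (4 * real L) = 1 / (2 * real L)" "3 / (4 * real L) + 1 / (4 * real L) = 1 / real L"
        using Lpos by (auto simp: field_simps)
      then show "1 / (2 * real L) < \<phi>" "\<phi> < 1 / real L" using m unfolding \<phi>_def by linarith+
    qed
    have far: "1 / (2 * real L) < \<bar>real D * (real m * \<theta>) - of_int z\<bar>" if D: "1 \<le> D" "D < L" for D :: nat and z :: int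
    proof -
      define z' where "z' = z - int D * \<lfloor>real m * \<theta>\<rfloor>"
      have eq: "real D * (real m * \<theta>) - of_int z = real D * \<phi> - of_int z'"
        by (simp add: \<phi>_def z'_def frac_def algebra_simps)
      have "0 < 1 / (2 * real L)" using Lpos by simp
      then have \<phi>pos: "0 < \<phi>" using \<phi>(1) by linarith
      have "1 * \<phi> \<le> real D * \<phi>" using D \<phi>pos by (intro mult_right_mono) auto
      then have lo: "1 / (2 * real L) < real D * \<phi>" using \<phi>(1) by linarith
      have "real D * \<phi> \<le> (real L - 1) * (1 / real L)"
        using D \<phi>(2) \<phi>pos by (intro mult_mono less_imp_le[OF \<phi>(2)]) auto
      also have "\<dots> = 1 - 1 / real L" using Lpos by (simp add: field_simps)
      finally have hi: "real D * \<phi> \<le> 1 - 1 / real L" .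
      have half: "1 / (2 * real L) < 1 / real L" using Lpos by (simp add: field_simps)
      show ?thesis
      proof (cases "z' \<le> 0")
        case True
        then have "of_int z' \<le> (0::real)" by simp
        then show ?thesis unfolding eq using lo by linarith
      next
        case False
        then have "1 \<le> (of_int z' :: real)" by simp
        then show ?thesis unfolding eq using hi half by linarith
      qed
    qed
    have "card S * L \<le> 2 * n"
      if n: "L * m \<le> n" and S: "S \<subseteq> {..<n}"
        and close: "\<forall>k\<in>S. \<forall>k'\<in>S. \<exists>z::int. \<bar>(real k - real k') * \<theta> - of_int z\<bar> \<le> 1 / (2 * real L)" for n S
    proof -
      have no: False if h: "k \<in> S" "k' \<in> S" "i < j" "j < L" "k + i * m = k' + j * m" for k k' i j
      proof -
        obtain z :: int where z: "\<bar>(real k - real k') * \<theta> - of_int z\<bar> \<le> 1 / (2 * real L)" using close h by blast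
        have "real (k + i * m) = real (k' + j * m)" using h(5) by simp
        then have "real k - real k' = real (j - i) * real m" using h(3) by (simp add: of_nat_diff algebra_simps)
        then have "\<bar>real (j - i) * (real m * \<theta>) - of_int z\<bar> \<le> 1 / (2 * real L)" using z by (simp add: mult.assoc)
        moreover have "1 / (2 * real L) < \<bar>real (j - i) * (real m * \<theta>) - of_int z\<bar>"
          using h by (intro far) auto
        ultimately show False by simp
      qed
      have inj: "inj_on (\<lambda>(k, i). k + i * m) (S \<times> {..<L})"
      proof (rule inj_onI)
        fix x y assume xy: "x \<in> S \<times> {..<L}" "y \<in> S \<times> {..<L}"
          and eq: "(case x of (k, i) \<Rightarrow> k + i * m) = (case y of (k, i) \<Rightarrow> k + i * m)"
        obtain k i where x: "x = (k, i)" "k \<in> S" "i < L" using xy(1) by auto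
        obtain k' j where y: "y = (k', j)" "k' \<in> S" "j < L" using xy(2) by auto
        have e: "k + i * m = k' + j * m" using eq x y by simp
        then have "i = j" using no[of k k' i j] no[of k' k j i] x y by (metis linorder_neqE_nat)
        then show "x = y" using e x y by simp
      qed
      have "(\<lambda>(k, i). k + i * m) ` (S \<times> {..<L}) \<subseteq> {..<n + L * m}"
      proof (rule image_subsetI)
        fix x assume "x \<in> S \<times> {..<L}"
        then obtain k i where x: "x = (k, i)" "k \<in> S" "i < L" by auto
        then have "k < n" "i * m \<le> L * m" using S by (auto intro: mult_right_mono)
        then have "k + i * m < n + L * m" by (rule add_less_le_mono)
        then show "(case x of (k, i) \<Rightarrow> k + i * m) \<in> {..<n + L * m}" unfolding x by simp
      qed
      then have "card (S \<times> {..<L}) \<le> card {..<n + L * m}"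
        using card_inj_on_le[OF inj] by blast
      then have "card S * L \<le> n + L * m" by (simp add: card_cartesian_product)
      then show ?thesis using n by simp
    qed
    then show ?thesis by blast
  qed
  have "\<forall>L\<in>{1..Lmax}. \<exists>m. \<forall>n\<ge>L * m. \<forall>S\<subseteq>{..<n}.
    (\<forall>k\<in>S. \<forall>k'\<in>S. \<exists>z::int. \<bar>(real k - real k') * \<theta> - of_int z\<bar> \<le> 1 / (2 * real L)) \<longrightarrow> card S * L \<le> 2 * n"
    using ex by blast
  from bchoice[OF this] obtain m where m: "\<forall>L\<in>{1..Lmax}. \<forall>n\<ge>L * m L. \<forall>S\<subseteq>{..<n}.
    (\<forall>k\<in>S. \<forall>k'\<in>S. \<exists>z::int. \<bar>(real k - real k') * \<theta> - of_int z\<bar> \<le> 1 / (2 * real L)) \<longrightarrow> card S * L \<le> 2 * n"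
    by blast
  show ?thesis
  proof (rule that[of "\<Sum>L\<in>{1..Lmax}. L * m L"], intro ballI allI impI)
    fix L n S assume L: "L \<in> {1..Lmax}" and n: "(\<Sum>L\<in>{1..Lmax}. L * m L) \<le> n" and S: "S \<subseteq> {..<n}"
      "\<forall>k\<in>S. \<forall>k'\<in>S. \<exists>z::int. \<bar>(real k - real k') * \<theta> - of_int z\<bar> \<le> 1 / (2 * real L)"
    have "L * m L \<le> (\<Sum>L\<in>{1..Lmax}. L * m L)" using L by (intro member_le_sum) auto
    then have "L * m L \<le> n" using n by simp
    then show "card S * L \<le> 2 * n" using m L S by blast
  qed
qed

text \<open>
  The maps \<open>x \<mapsto> R x + b\<close> with \<open>b\<close> in the digit set \<open>E\<close> have a common ratio, so after \<open>p\<close> steps all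
  cylinders have the same size \<open>R\<^sup>p\<close>; a cylinder is represented by the image of the base point \<open>x0\<close>.
\<close>
locale homogeneous_system =
  fixes K :: "real set" and R :: real and E :: "real set" and g x0 :: real
  assumes R: "0 < R" "R < 1" and finite_E: "finite E" and g: "0 < g" and x0: "x0 \<in> K"
    and step: "b \<in> E \<Longrightarrow> x \<in> K \<Longrightarrow> R * x + b \<in> K"
    and sep: "b \<in> E \<Longrightarrow> b' \<in> E \<Longrightarrow> b \<noteq> b' \<Longrightarrow> x \<in> K \<Longrightarrow> y \<in> K \<Longrightarrow> g \<le> \<bar>(R * x + b) - (R * y + b')\<bar>"
begin

definition point :: "real list \<Rightarrow> real" where
  "point w = foldr (\<lambda>b z. R * z + b) w x0"

definition codes :: "nat \<Rightarrow> real list set" where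
  "codes p = {w. set w \<subseteq> E \<and> length w = p}"

lemma point_Cons [simp]: "point (b # w) = R * point w + b"
  by (simp add: point_def)

lemma cylinder_subset:
  assumes "x \<in> K" shows "w \<in> codes p \<Longrightarrow> R ^ p * (x - x0) + point w \<in> K"
proof (induction w arbitrary: p)
  case Nil
  then show ?case using assms by (simp add: codes_def point_def)
next
  case (Cons b w)
  then obtain p' where p: "p = Suc p'" "w \<in> codes p'" "b \<in> E" by (auto simp: codes_def)
  have "R * (R ^ p' * (x - x0) + point w) + b \<in> K" using Cons.IH[OF p(2)] p(3) by (rule step[rotated])
  then show ?case by (simp add: p(1) algebra_simps)
qed

lemma point_in: "w \<in> codes p \<Longrightarrow> point w \<in> K"
  using cylinder_subset[OF x0, of w p] by simp

lemma finite_codes: "finite (codes p)" and card_codes: "card (codes p) = card E ^ p"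
  unfolding codes_def using finite_lists_length_eq[OF finite_E] card_lists_length_eq[OF finite_E] by auto

lemma codes_Suc: "codes (Suc p) = (\<lambda>(b, w). b # w) ` (E \<times> codes p)"
proof (intro equalityI subsetI)
  fix w assume w: "w \<in> codes (Suc p)"
  then obtain b v where "w = b # v" by (cases w) (auto simp: codes_def)
  then show "w \<in> (\<lambda>(b, w). b # w) ` (E \<times> codes p)"
    using w by (intro image_eqI[of _ _ "(b, v)"]) (auto simp: codes_def)
qed (auto simp: codes_def)

lemma distinct_points:
  assumes "w \<in> codes p" "w' \<in> codes p" "w \<noteq> w'" shows "g * R ^ p \<le> \<bar>point w - point w'\<bar>"
  using assms
proof (induction p arbitrary: w w')
  case 0
  then show ?case by (simp add: codes_def)
next
  case (Suc p)
  then obtain b v b' v' where w: "w = b # v" "w' = b' # v'" "b \<in> E" "b' \<in> E" "v \<in> codes p" "v' \<in> codes p"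
    unfolding codes_Suc by auto
  show ?case
  proof (cases "b = b'")
    case True
    have "R * (g * R ^ p) \<le> R * \<bar>point v - point v'\<bar>"
      using Suc w True R by (intro mult_left_mono) auto
    also have "\<dots> = \<bar>point w - point w'\<bar>"
      using True R by (simp add: w abs_mult[symmetric] abs_mult_pos algebra_simps) (simp add: abs_mult flip: right_diff_distrib)
    finally show ?thesis by (simp add: algebra_simps)
  next
    case False
    have "R ^ Suc p \<le> 1" using R by (intro power_le_one) auto
    then have "g * R ^ Suc p \<le> g" using g by (simp add: mult_left_le)
    also have "\<dots> \<le> \<bar>point w - point w'\<bar>"
      using sep[OF w(3,4) False point_in[OF w(5)] point_in[OF w(6)]] by (simp add: w)
    finally show ?thesis .
  qed
qed

text \<open>
  The cylinder points are spread out like a set of dimension \<open>\<tau>\<close>. Points closer than \<open>g\<close> share the first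
  digit, and deleting it enlarges distances by the factor \<open>1/R\<close>.
\<close>
lemma card_close_codes_le:
  assumes \<tau>: "0 \<le> \<tau>" "1 \<le> real (card E) * R powr \<tau>" and "w \<in> codes p" "0 \<le> d"
  shows "real (card {w' \<in> codes p. \<bar>point w - point w'\<bar> \<le> d}) \<le>
    real (card E) ^ p * (max 1 (g powr (-\<tau>)) * (max d (R ^ p)) powr \<tau>)"
  using assms(3,4)
proof (induction p arbitrary: w d)
  case 0
  have "card {w' \<in> codes 0. \<bar>point w - point w'\<bar> \<le> d} \<le> card {[]::real list}"
    by (rule card_mono) (auto simp: codes_def)
  then have "real (card {w' \<in> codes 0. \<bar>point w - point w'\<bar> \<le> d}) \<le> 1 * 1" by simp
  also have "\<dots> \<le> max 1 (g powr (-\<tau>)) * (max d 1) powr \<tau>"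
    using \<tau> by (intro mult_mono ge_one_powr_ge_zero) auto
  finally show ?case by simp
next
  case (Suc p)
  let ?C = "max 1 (g powr (-\<tau>))"
  obtain b v where w: "w = b # v" "b \<in> E" "v \<in> codes p" using Suc.prems unfolding codes_Suc by auto
  show ?case
  proof (cases "g \<le> d")
    case True
    have "real (card {w' \<in> codes (Suc p). \<bar>point w - point w'\<bar> \<le> d}) \<le> real (card (codes (Suc p)))"
      by (intro of_nat_mono card_mono finite_codes) auto
    also have "\<dots> = real (card E) ^ Suc p * 1" by (simp add: card_codes)
    also have "\<dots> \<le> real (card E) ^ Suc p * (?C * (max d (R ^ Suc p)) powr \<tau>)"
    proof (rule mult_left_mono)
      have "1 = g powr (-\<tau>) * g powr \<tau>" using g by (simp add: powr_minus)
      also have "\<dots> \<le> ?C * (max d (R ^ Suc p)) powr \<tau>"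
        using True g \<tau> by (intro mult_mono powr_mono2) auto
      finally show "1 \<le> ?C * (max d (R ^ Suc p)) powr \<tau>" .
    qed simp
    finally show ?thesis .
  next
    case False
    have "{w' \<in> codes (Suc p). \<bar>point w - point w'\<bar> \<le> d} \<subseteq>
        (\<lambda>v'. b # v') ` {v' \<in> codes p. \<bar>point v - point v'\<bar> \<le> d / R}"
    proof
      fix w' assume "w' \<in> {w' \<in> codes (Suc p). \<bar>point w - point w'\<bar> \<le> d}"
      then obtain b' v' where w': "w' = b' # v'" "b' \<in> E" "v' \<in> codes p" "\<bar>point w - point w'\<bar> \<le> d"
        unfolding codes_Suc by auto
      have "b = b'"
      proof (rule ccontr)
        assume "b \<noteq> b'"
        then show False
          using sep[OF w(2) w'(2) _ point_in[OF w(3)] point_in[OF w'(3)]] w'(4) False by (simp add: w w')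
      qed
      moreover have "\<bar>point v - point v'\<bar> \<le> d / R"
      proof -
        have eq: "point w - point w' = R * (point v - point v')" using \<open>b = b'\<close> by (simp add: w w' algebra_simps)
        have "\<bar>point v - point v'\<bar> * R = \<bar>point w - point w'\<bar>" unfolding eq abs_mult using R by simp
        then show ?thesis using w'(4) R by (simp add: pos_le_divide_eq)
      qed
      ultimately show "w' \<in> (\<lambda>v'. b # v') ` {v' \<in> codes p. \<bar>point v - point v'\<bar> \<le> d / R}"
        using w' by auto
    qed
    then have "card {w' \<in> codes (Suc p). \<bar>point w - point w'\<bar> \<le> d} \<le>
        card {v' \<in> codes p. \<bar>point v - point v'\<bar> \<le> d / R}"
      using finite_codes by (intro surj_card_le) auto
    then have "real (card {w' \<in> codes (Suc p). \<bar>point w - point w'\<bar> \<le> d}) \<le>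
        real (card {v' \<in> codes p. \<bar>point v - point v'\<bar> \<le> d / R})" by simp
    also have "\<dots> \<le> real (card E) ^ p * (?C * (max (d / R) (R ^ p)) powr \<tau>)"
      using Suc.IH[OF w(3), of "d / R"] Suc.prems R by simp
    also have "max (d / R) (R ^ p) = max d (R ^ Suc p) / R" using R by (simp add: max_def field_simps)
    also have "(max d (R ^ Suc p) / R) powr \<tau> = R powr (-\<tau>) * (max d (R ^ Suc p)) powr \<tau>"
      using R by (simp add: powr_divide powr_minus field_simps)
    also have "real (card E) ^ p * (?C * (R powr (-\<tau>) * (max d (R ^ Suc p)) powr \<tau>)) \<le>
        real (card E) ^ p * (?C * (real (card E) * (max d (R ^ Suc p)) powr \<tau>))"
      using \<tau>(2) R by (intro mult_left_mono mult_right_mono) (auto simp: powr_minus field_simps)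
    finally show ?thesis by (simp add: algebra_simps)
  qed
qed

text \<open>
  A discrete energy estimate. Points with different first digits are at distance at least \<open>g\<close> and
  contribute the term \<open>i = 0\<close>; those with the same first digit are handled by the induction hypothesis
  after rescaling.
\<close>
lemma sum_inverse_distances_le:
  assumes \<tau>: "0 < \<upsilon>" "1 \<le> real (card E) * R powr \<tau>" and "w \<in> codes p"
  shows "(\<Sum>w'\<in>codes p - {w}. \<bar>point w - point w'\<bar> powr (-\<upsilon>)) \<le>
    real (card E) ^ p * (g powr (-\<upsilon>) * (\<Sum>i<p. (R powr (\<tau> - \<upsilon>)) ^ i))"
  using assms(3)
proof (induction p arbitrary: w)
  case 0
  then have empty: "codes 0 - {w} = {}" by (auto simp: codes_def)
  show ?case unfolding empty by simp
next
  case (Suc p)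
  let ?G = "g powr (-\<upsilon>)" and ?X = "R powr (\<tau> - \<upsilon>)"
  let ?f = "\<lambda>w'. \<bar>point w - point w'\<bar> powr (-\<upsilon>)"
  obtain b v where w: "w = b # v" "b \<in> E" "v \<in> codes p" using Suc.prems unfolding codes_Suc by auto
  have split: "codes (Suc p) - {w} = (\<lambda>(b, w). b # w) ` ((E - {b}) \<times> codes p) \<union> (\<lambda>v'. b # v') ` (codes p - {v})"
    unfolding codes_Suc using w by auto
  have "(\<Sum>w'\<in>codes (Suc p) - {w}. ?f w') =
      (\<Sum>w'\<in>(\<lambda>(b, w). b # w) ` ((E - {b}) \<times> codes p). ?f w') + (\<Sum>w'\<in>(\<lambda>v'. b # v') ` (codes p - {v}). ?f w')"
    unfolding split using finite_E finite_codes by (intro sum.union_disjoint) auto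
  also have "(\<Sum>w'\<in>(\<lambda>(b, w). b # w) ` ((E - {b}) \<times> codes p). ?f w') \<le>
      (\<Sum>w'\<in>(\<lambda>(b, w). b # w) ` ((E - {b}) \<times> codes p). ?G)"
  proof (rule sum_mono)
    fix w' assume "w' \<in> (\<lambda>(b, w). b # w) ` ((E - {b}) \<times> codes p)"
    then obtain b' v' where w': "w' = b' # v'" "b' \<in> E" "b \<noteq> b'" "v' \<in> codes p" by auto
    have "g \<le> \<bar>point w - point w'\<bar>"
      using sep[OF w(2) w'(2,3) point_in[OF w(3)] point_in[OF w'(4)]] by (simp add: w w')
    then show "?f w' \<le> ?G" using g \<tau> by (intro powr_mono2') auto
  qed
  also have "\<dots> = real (card ((\<lambda>(b, w). b # w) ` ((E - {b}) \<times> codes p))) * ?G" by simp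
  also have "card ((\<lambda>(b, w). b # w) ` ((E - {b}) \<times> codes p)) \<le> card (E \<times> codes p)"
    using finite_E finite_codes
    by (intro order_trans[OF card_image_le card_mono]) auto
  then have "real (card ((\<lambda>(b, w). b # w) ` ((E - {b}) \<times> codes p))) * ?G \<le> real (card E) ^ Suc p * ?G"
    by (intro mult_right_mono) (auto simp: card_cartesian_product card_codes simp flip: of_nat_mult of_nat_power)
  also have "(\<Sum>w'\<in>(\<lambda>v'. b # v') ` (codes p - {v}). ?f w') = (\<Sum>v'\<in>codes p - {v}. ?f (b # v'))"
    by (subst sum.reindex) (auto simp: inj_on_def)
  also have "\<dots> = (\<Sum>v'\<in>codes p - {v}. R powr (-\<upsilon>) * \<bar>point v - point v'\<bar> powr (-\<upsilon>))"
  proof (rule sum.cong[OF refl])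
    fix v'
    have "point w - point (b # v') = R * (point v - point v')" by (simp add: w algebra_simps)
    then show "?f (b # v') = R powr (-\<upsilon>) * \<bar>point v - point v'\<bar> powr (-\<upsilon>)"
      using R by (simp add: abs_mult powr_mult)
  qed
  also have "\<dots> = R powr (-\<upsilon>) * (\<Sum>v'\<in>codes p - {v}. \<bar>point v - point v'\<bar> powr (-\<upsilon>))"
    by (simp add: sum_distrib_left)
  also have "\<dots> \<le> (real (card E) * ?X) * (real (card E) ^ p * (?G * (\<Sum>i<p. ?X ^ i)))"
  proof (rule mult_mono)
    have "R powr (-\<upsilon>) = 1 * R powr (-\<upsilon>)" by simp
    also have "\<dots> \<le> (real (card E) * R powr \<tau>) * R powr (-\<upsilon>)" using \<tau>(2) by (intro mult_right_mono) auto
    also have "\<dots> = real (card E) * ?X" by (simp add: mult.assoc flip: powr_add)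
    finally show "R powr (-\<upsilon>) \<le> real (card E) * ?X" .
    show "(\<Sum>v'\<in>codes p - {v}. \<bar>point v - point v'\<bar> powr (-\<upsilon>)) \<le> real (card E) ^ p * (?G * (\<Sum>i<p. ?X ^ i))"
      by (rule Suc.IH[OF w(3)])
  qed (auto intro: sum_nonneg)
  also have "real (card E) ^ Suc p * ?G + (real (card E) * ?X) * (real (card E) ^ p * (?G * (\<Sum>i<p. ?X ^ i)))
      = real (card E) ^ Suc p * (?G * ((\<Sum>i<p. ?X ^ i) * ?X + 1))"
    by (simp add: algebra_simps)
  also have "(\<Sum>i<p. ?X ^ i) * ?X + 1 = (\<Sum>i<Suc p. ?X ^ i)"
    by (simp add: sum.lessThan_Suc_shift sum_distrib_left mult.commute del: sum.lessThan_Suc)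
  finally show ?case by simp
qed

end

section \<open>Dimension in the incommensurable case\<close>

lemma abs_ln_diff_le:
  fixes u w :: real
  assumes "1 \<le> u" "1 \<le> w"
  shows "\<bar>ln u - ln w\<bar> \<le> \<bar>u - w\<bar>"
proof -
  have *: "\<bar>ln y - ln x\<bar> \<le> \<bar>y - x\<bar>" if "1 \<le> x" "x \<le> y" for x y :: real
  proof -
    have "ln y - ln x = ln (y / x)" using that by (simp add: ln_div)
    also have "\<dots> \<le> y / x - 1" using that by (intro ln_le_minus_one) auto
    also have "\<dots> = (y - x) / x" using that by (simp add: field_simps)
    also have "\<dots> \<le> (y - x) / 1" using that by (intro divide_left_mono) auto
    finally show ?thesis using that by simp
  qed
  show ?thesis using *[of u w] *[of w u] assms by (cases "u \<le> w") (auto simp: abs_minus_commute)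
qed

lemma sum_card_swap:
  fixes P :: "nat \<Rightarrow> 'z \<Rightarrow> bool"
  assumes "finite Z"
  shows "(\<Sum>k<n. card {z \<in> Z. P k z}) = (\<Sum>z\<in>Z. card {k. k < n \<and> P k z})"
proof -
  have 1: "card {z \<in> Z. P k z} = (\<Sum>z\<in>Z. if P k z then 1 else 0)" for k
    using assms by (simp add: sum.If_cases Int_def)
  have 2: "card {k. k < n \<and> P k z} = (\<Sum>k<n. if P k z then 1 else 0)" for z
    by (simp add: sum.If_cases Int_def)
  show ?thesis unfolding 1 2 by (rule sum.swap)
qed

text \<open>
  Two homogeneous systems with incommensurable ratios. The exponents \<open>\<tau>\<close> and \<open>\<tau>'\<close> are lower bounds for
  the dimensions; keeping their sum below \<open>1\<close> makes the geometric series in the energy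
  estimate grow like its last term, which is what the counting needs.
\<close>
locale homogeneous_pair =
  U: homogeneous_system K R E g x0 + V: homogeneous_system K' R' E' g' y0
  for K R E g x0 K' R' E' g' y0 +
  fixes a b \<tau> \<tau>' :: real
  assumes K_sub: "K \<subseteq> {0..a}" and K'_sub: "K' \<subseteq> {0..b}" and ab: "0 < a" "0 < b"
    and \<tau>: "0 \<le> \<tau>" "0 \<le> \<tau>'" "\<tau> + \<tau>' < 1"
    and card_E: "1 \<le> real (card E) * R powr \<tau>" and card_E': "1 \<le> real (card E') * R' powr \<tau>'"
    and irr: "ln R / ln R' \<notin> \<rat>"
begin

definition "\<alpha> = - ln R"
definition "\<beta> = - ln R'"
definition "\<Lambda> = 1 / R'"
definition "\<kappa> = 4 * (a + \<Lambda> * b + 1)"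

text \<open>
  In \<open>k\<close> rounds, \<open>k p\<close> digits of the first system are read, and as many digits of the second as keep
  the slope in the window \<open>[1, \<Lambda>]\<close>. The logarithm of the slope is then \<open>k p \<alpha>\<close> modulo \<open>\<beta>\<close>, the orbit of an
  irrational rotation.
\<close>
definition level :: "nat \<Rightarrow> nat \<Rightarrow> nat" where
  "level p k = nat \<lfloor>real k * (real p * \<alpha> / \<beta>)\<rfloor>"

definition slope :: "nat \<Rightarrow> nat \<Rightarrow> real" where
  "slope p k = exp (real k * real p * \<alpha> - real (level p k) * \<beta>)"

lemma \<alpha>\<beta>: "0 < \<alpha>" "0 < \<beta>" "\<alpha> / \<beta> \<notin> \<rat>"
  using U.R V.R irr by (auto simp: \<alpha>_def \<beta>_def)

lemma \<Lambda>: "1 \<le> \<Lambda>" "\<Lambda> = exp \<beta>"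
  using V.R by (auto simp: \<Lambda>_def \<beta>_def exp_minus field_simps)

lemma \<kappa>: "4 \<le> \<kappa>"
  using ab \<Lambda> by (auto simp: \<kappa>_def)

lemma R_power: "R ^ n = exp (- (real n * \<alpha>))" and R'_power: "R' ^ n = exp (- (real n * \<beta>))"
  using U.R V.R by (auto simp: \<alpha>_def \<beta>_def exp_of_nat_mult)

lemma level_bounds: "0 \<le> real k * real p * \<alpha> - real (level p k) * \<beta>"
  "real k * real p * \<alpha> - real (level p k) * \<beta> < \<beta>"
proof -
  let ?z = "real k * (real p * \<alpha> / \<beta>)"
  have "0 \<le> ?z" using \<alpha>\<beta> by simp
  then have l: "real (level p k) = of_int \<lfloor>?z\<rfloor>" by (simp add: level_def)
  have z: "?z * \<beta> = real k * real p * \<alpha>" using \<alpha>\<beta> by simp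
  have "of_int \<lfloor>?z\<rfloor> * \<beta> \<le> ?z * \<beta>" using \<alpha>\<beta> by (intro mult_right_mono) auto
  then show "0 \<le> real k * real p * \<alpha> - real (level p k) * \<beta>" unfolding l z by simp
  have "?z * \<beta> < (of_int \<lfloor>?z\<rfloor> + 1) * \<beta>" using \<alpha>\<beta> by (intro mult_strict_right_mono) linarith+
  then show "real k * real p * \<alpha> - real (level p k) * \<beta> < \<beta>" unfolding l z by (simp add: algebra_simps)
qed

lemma slope_bounds: "1 \<le> slope p k" "slope p k \<le> \<Lambda>"
  using level_bounds[of k p] by (auto simp: slope_def \<Lambda>(2))

lemma slope_0: "slope p 0 = 1"
  by (simp add: level_def slope_def)

lemma level_Suc: "level p (Suc k) = level p k + level p 1 \<or> level p (Suc k) = Suc (level p k + level p 1)"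
proof -
  let ?\<theta> = "real p * \<alpha> / \<beta>"
  let ?x = "real k * ?\<theta>"
  have nn: "0 \<le> ?\<theta>" "0 \<le> ?x" using \<alpha>\<beta> by auto
  have "real (Suc k) = real k + 1" by simp
  then have e: "real (Suc k) * ?\<theta> = ?x + ?\<theta>" by (simp only: distrib_right mult_1_left)
  have "\<lfloor>?x + ?\<theta>\<rfloor> = \<lfloor>?x\<rfloor> + \<lfloor>?\<theta>\<rfloor> \<or> \<lfloor>?x + ?\<theta>\<rfloor> = \<lfloor>?x\<rfloor> + \<lfloor>?\<theta>\<rfloor> + 1" by linarith
  moreover have "0 \<le> \<lfloor>?x\<rfloor>" "0 \<le> \<lfloor>?\<theta>\<rfloor>" using nn by auto
  ultimately show ?thesis unfolding level_def e by (auto simp: nat_add_distrib)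
qed

lemma slope_Suc: "slope p k * R' ^ (level p (Suc k) - level p k) = slope p (Suc k) * R ^ p"
proof -
  have le: "level p k \<le> level p (Suc k)" using level_Suc[of p k] by auto
  have "slope p k * R' ^ (level p (Suc k) - level p k) =
      exp (real k * real p * \<alpha> - real (level p k) * \<beta> - real (level p (Suc k) - level p k) * \<beta>)"
    unfolding slope_def R'_power by (simp flip: exp_add)
  also have "real k * real p * \<alpha> - real (level p k) * \<beta> - real (level p (Suc k) - level p k) * \<beta> =
      (real (Suc k) * real p * \<alpha> - real (level p (Suc k)) * \<beta>) + (- (real p * \<alpha>))"
    using le by (simp add: of_nat_diff algebra_simps)
  also have "exp \<dots> = slope p (Suc k) * R ^ p"
    unfolding slope_def R_power by (rule exp_add)
  finally show ?thesis .
qed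

lemma scales_comparable: "R ^ p \<le> R' ^ level p 1" "R' ^ level p 1 * R' \<le> R ^ p"
proof -
  have "real (level p 1) * \<beta> \<le> real p * \<alpha>" "real p * \<alpha> \<le> real (level p 1) * \<beta> + \<beta>"
    using level_bounds[of 1 p] by auto
  then have "R ^ p \<le> R' ^ level p 1" "R' ^ Suc (level p 1) \<le> R ^ p"
    unfolding R_power R'_power by (auto simp: algebra_simps)
  then show "R ^ p \<le> R' ^ level p 1" "R' ^ level p 1 * R' \<le> R ^ p" by (auto simp: mult.commute)
qed

text \<open>
  The slopes for which \<open>x - slope * y\<close> is within \<open>\<kappa> R\<^sup>p\<close> of zero form an interval of length
  proportional to \<open>R\<^sup>p / \<bar>y\<bar>\<close>, and the rotation visits it with a frequency of that order.
\<close>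
lemma visits_le:
  assumes "1 \<le> p"
  obtains n0 where "\<forall>n\<ge>n0. \<forall>x y. y \<noteq> 0 \<longrightarrow> \<bar>y\<bar> \<le> b \<longrightarrow>
    real (card {k. k < n \<and> \<bar>x - slope p k * y\<bar> \<le> \<kappa> * R ^ p}) \<le> real n * (16 * \<kappa> / \<beta> * R ^ p / \<bar>y\<bar>)"
proof -
  let ?\<delta> = "R ^ p"
  have \<delta>: "0 < ?\<delta>" using U.R by simp
  define \<theta> where "\<theta> = real p * \<alpha> / \<beta>"
  have "\<theta> \<notin> \<rat>"
  proof
    assume "\<theta> \<in> \<rat>"
    then have "\<theta> / real p \<in> \<rat>" by (intro Rats_divide) auto
    moreover have "\<theta> / real p = \<alpha> / \<beta>" using assms by (simp add: \<theta>_def)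
    ultimately show False using \<alpha>\<beta> by simp
  qed
  define Lmax where "Lmax = nat \<lfloor>\<beta> * b / (4 * \<kappa> * ?\<delta>)\<rfloor>"
  obtain n0 where n0: "\<forall>L\<in>{1..Lmax}. \<forall>n\<ge>n0. \<forall>S\<subseteq>{..<n}.
    (\<forall>k\<in>S. \<forall>k'\<in>S. \<exists>z::int. \<bar>(real k - real k') * \<theta> - of_int z\<bar> \<le> 1 / (2 * real L)) \<longrightarrow> card S * L \<le> 2 * n"
    using rotation_visits_bound[OF \<open>\<theta> \<notin> \<rat>\<close>] .
  have main: "real (card {k. k < n \<and> \<bar>x - slope p k * y\<bar> \<le> \<kappa> * ?\<delta>}) \<le> real n * (16 * \<kappa> / \<beta> * ?\<delta> / \<bar>y\<bar>)"
    if n: "n0 \<le> n" and y: "y \<noteq> 0" "\<bar>y\<bar> \<le> b" for n x y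
  proof -
    define S where "S = {k. k < n \<and> \<bar>x - slope p k * y\<bar> \<le> \<kappa> * ?\<delta>}"
    \<comment> \<open>On the circle the interval of slopes has length at most \<open>1/(2v)\<close>. The rotation bound needs an integer
      \<open>L \<le> v\<close>; if there is no positive one, the trivial bound \<open>n\<close> is good enough.\<close>
    define v where "v = \<beta> * \<bar>y\<bar> / (4 * \<kappa> * ?\<delta>)"
    define L where "L = nat \<lfloor>v\<rfloor>"
    have v: "0 < v" using \<alpha>\<beta> \<kappa> \<delta> y by (simp add: v_def)
    have target: "16 * \<kappa> / \<beta> * ?\<delta> / \<bar>y\<bar> = 4 / v" using \<alpha>\<beta> \<kappa> \<delta> y by (simp add: v_def field_simps)
    show ?thesis
    proof (cases "L = 0")
      case True
      then have "v < 1" using v by (simp add: L_def)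
      have "card S \<le> card {..<n}" unfolding S_def by (rule card_mono) auto
      then have "real (card S) \<le> real n * 1" by simp
      also have "\<dots> \<le> real n * (4 / v)" using \<open>v < 1\<close> v by (intro mult_left_mono) (auto simp: field_simps)
      finally show ?thesis unfolding target S_def .
    next
      case False
      have Lv: "real L \<le> v" "v < real L + 1" using v by (auto simp: L_def)
      have L: "L \<in> {1..Lmax}"
      proof -
        have "v \<le> \<beta> * b / (4 * \<kappa> * ?\<delta>)" unfolding v_def
          using y \<alpha>\<beta> \<kappa> \<delta> by (intro divide_right_mono mult_left_mono) auto
        then have "L \<le> Lmax" unfolding L_def Lmax_def by (intro nat_mono floor_mono)
        then show ?thesis using False by simp
      qed
      have "\<exists>z::int. \<bar>(real k - real k') * \<theta> - of_int z\<bar> \<le> 1 / (2 * real L)" if kk: "k \<in> S" "k' \<in> S" for k k'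
      proof -
        have "\<bar>x - slope p k * y\<bar> \<le> \<kappa> * ?\<delta>" "\<bar>x - slope p k' * y\<bar> \<le> \<kappa> * ?\<delta>"
          using kk by (auto simp: S_def)
        then have "\<bar>slope p k * y - slope p k' * y\<bar> \<le> 2 * (\<kappa> * ?\<delta>)" by linarith
        then have "\<bar>slope p k - slope p k'\<bar> * \<bar>y\<bar> \<le> 2 * (\<kappa> * ?\<delta>)"
          by (simp add: abs_mult[symmetric] left_diff_distrib)
        then have "\<bar>slope p k - slope p k'\<bar> \<le> 2 * (\<kappa> * ?\<delta>) / \<bar>y\<bar>"
          using y by (simp add: pos_le_divide_eq)
        then have "\<bar>ln (slope p k) - ln (slope p k')\<bar> \<le> 2 * (\<kappa> * ?\<delta>) / \<bar>y\<bar>"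
          using abs_ln_diff_le[OF slope_bounds(1)[of p k] slope_bounds(1)[of p k']] by linarith
        then have "\<bar>ln (slope p k) - ln (slope p k')\<bar> / \<beta> \<le> 2 * (\<kappa> * ?\<delta>) / \<bar>y\<bar> / \<beta>"
          using \<alpha>\<beta> by (intro divide_right_mono) auto
        also have "2 * (\<kappa> * ?\<delta>) / \<bar>y\<bar> / \<beta> = 1 / (2 * v)"
          using \<alpha>\<beta> \<kappa> \<delta> y by (simp add: v_def field_simps)
        also have "\<dots> \<le> 1 / (2 * real L)"
          using Lv(1) False by (intro divide_left_mono) auto
        also have "\<bar>ln (slope p k) - ln (slope p k')\<bar> / \<beta> = \<bar>(ln (slope p k) - ln (slope p k')) / \<beta>\<bar>"
          using \<alpha>\<beta> by (simp add: abs_divide)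
        also have "(ln (slope p k) - ln (slope p k')) / \<beta> =
            (real k - real k') * \<theta> - of_int (int (level p k) - int (level p k'))"
          using \<alpha>\<beta> by (simp add: slope_def \<theta>_def field_simps)
        finally show ?thesis by blast
      qed
      moreover have "S \<subseteq> {..<n}" by (auto simp: S_def)
      ultimately have "card S * L \<le> 2 * n" using n0 L n by blast
      then have "real (card S) * real L \<le> 2 * real n" by (metis of_nat_le_iff of_nat_mult of_nat_numeral)
      moreover have "v \<le> 2 * real L" using Lv False by simp
      then have "real (card S) * v \<le> real (card S) * (2 * real L)" by (intro mult_left_mono) auto
      ultimately have "real (card S) * v \<le> 4 * real n" by simp
      then show ?thesis unfolding target S_def[symmetric] using v by (simp add: field_simps)
    qed
  qed
  show ?thesis using that[of n0] main by blast
qed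

definition cells :: "nat \<Rightarrow> (real list \<times> real list) set" where
  "cells p = U.codes p \<times> V.codes (level p 1)"

text \<open>
  The projection of the cell \<open>c\<close> in direction \<open>slope p k\<close>, up to the size of the cell.
\<close>
definition shadow :: "nat \<Rightarrow> nat \<Rightarrow> real list \<times> real list \<Rightarrow> real" where
  "shadow p k c = U.point (fst c) - slope p k * V.point (snd c)"

definition close_pairs :: "nat \<Rightarrow> nat \<Rightarrow> nat" where
  "close_pairs p k = card {(c, c'). c \<in> cells p \<and> c' \<in> cells p \<and> \<bar>shadow p k c - shadow p k c'\<bar> \<le> \<kappa> * R ^ p}"

lemma finite_cells: "finite (cells p)" and card_cells: "card (cells p) = card E ^ p * card E' ^ level p 1"
  by (auto simp: cells_def U.finite_codes V.finite_codes card_cartesian_product U.card_codes V.card_codes)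

lemma card_E_pos: "0 < card E" "0 < card E'"
  using card_E card_E' by (auto intro: ccontr)

lemma sum_inverse_distances_at_scale:
  obtains C where "0 \<le> C" "\<forall>p. \<forall>v\<in>V.codes (level p 1).
    (\<Sum>v'\<in>V.codes (level p 1) - {v}. \<bar>V.point v - V.point v'\<bar> powr (\<tau> - 1)) \<le>
      real (card E') ^ level p 1 * (C * (R ^ p) powr (\<tau> + \<tau>' - 1))"
proof -
  define X where "X = R' powr (\<tau>' - (1 - \<tau>))"
  define G where "G = g' powr (-(1 - \<tau>))"
  have X: "1 < X" unfolding X_def using V.R \<tau> powr_less_mono2_neg[of "\<tau>' - (1 - \<tau>)" R' 1] by simp
  have main: "(\<Sum>v'\<in>V.codes (level p 1) - {v}. \<bar>V.point v - V.point v'\<bar> powr (\<tau> - 1)) \<le>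
      real (card E') ^ level p 1 * (G / (X - 1) * (R ^ p) powr (\<tau> + \<tau>' - 1))"
    if v: "v \<in> V.codes (level p 1)" for p v
  proof -
    let ?q = "level p 1"
    have "(\<Sum>v'\<in>V.codes ?q - {v}. \<bar>V.point v - V.point v'\<bar> powr (-(1 - \<tau>))) \<le>
        real (card E') ^ ?q * (G * (\<Sum>i<?q. X ^ i))"
      unfolding G_def X_def using \<tau> by (intro V.sum_inverse_distances_le v card_E') auto
    also have "(\<Sum>i<?q. X ^ i) \<le> X ^ ?q / (X - 1)"
    proof -
      have "(\<Sum>i<?q. X ^ i) = (X ^ ?q - 1) / (X - 1)" using X by (intro geometric_sum) auto
      also have "\<dots> \<le> X ^ ?q / (X - 1)" using X by (intro divide_right_mono) auto
      finally show ?thesis .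
    qed
    also have "X ^ ?q = (R' ^ ?q) powr (\<tau> + \<tau>' - 1)"
      using V.R by (simp add: X_def powr_powr mult.commute algebra_simps flip: powr_realpow)
    also have "\<dots> \<le> (R ^ p) powr (\<tau> + \<tau>' - 1)"
      using scales_comparable(1)[of p] U.R \<tau> by (intro powr_mono2') auto
    finally have "(\<Sum>v'\<in>V.codes ?q - {v}. \<bar>V.point v - V.point v'\<bar> powr (-(1 - \<tau>))) \<le>
        real (card E') ^ ?q * (G * ((R ^ p) powr (\<tau> + \<tau>' - 1) / (X - 1)))"
      using X by (auto simp: G_def mult_left_mono divide_right_mono)
    then show ?thesis by simp
  qed
  have "0 \<le> G / (X - 1)" using X by (simp add: G_def)
  then show ?thesis using that main by blast
qed

text \<open>
  Fix one cell and sum over the others the frequency of the rounds in which the two shadows are close.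
  A cell in the same row of \<open>V\<close>-digits counts fully, but only few such cells have close \<open>U\<close>-points. In
  another row at vertical distance \<open>y\<close>, closeness is impossible unless the horizontal distance is
  \<open>O(y)\<close>, which leaves \<open>O(y\<^sup>\<tau>)\<close> of the cells, and these are close with frequency \<open>O(R\<^sup>p / y)\<close>. Summing
  \<open>y\<^sup>\<tau>\<^sup>-\<^sup>1\<close> over the rows is the discrete energy estimate. The constant \<open>C\<close> does not depend on \<open>p\<close>, whereas
  the time \<open>n0\<close> from which the average is controlled does.
\<close>
lemma average_close_pairs:
  obtains C where "0 \<le> C" "\<forall>p\<ge>1. \<exists>n0. \<forall>n\<ge>n0.
    (\<Sum>k<n. real (close_pairs p k)) \<le> real n * (real (card (cells p)))\<^sup>2 * (C * (R ^ p) powr (\<tau> + \<tau>'))"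
proof -
  obtain C3 where C3: "0 \<le> C3" "\<forall>p. \<forall>v\<in>V.codes (level p 1).
    (\<Sum>v'\<in>V.codes (level p 1) - {v}. \<bar>V.point v - V.point v'\<bar> powr (\<tau> - 1)) \<le>
      real (card E') ^ level p 1 * (C3 * (R ^ p) powr (\<tau> + \<tau>' - 1))"
    using sum_inverse_distances_at_scale .
  define C1 where "C1 = max 1 (g powr (-\<tau>))"
  define C4 where "C4 = 16 * \<kappa> / \<beta>"
  define C5 where "C5 = \<Lambda> + \<kappa> / g'"
  \<comment> \<open>\<open>Cd\<close> accounts for the cells in the same row, \<open>Co\<close> for all other rows.\<close>
  define Cd where "Cd = C1 * \<kappa> powr \<tau> * R' powr (-\<tau>')"
  define Co where "Co = C1 * C5 powr \<tau> * C4 * C3"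
  have pos: "1 \<le> C1" "0 \<le> C4" "0 < C5" "0 \<le> Cd" "0 \<le> Co"
    using \<kappa> \<alpha>\<beta> \<Lambda> V.g C3(1) unfolding C1_def C4_def C5_def Cd_def Co_def by (auto intro!: mult_nonneg_nonneg add_pos_pos)
  have main: "\<exists>n0. \<forall>n\<ge>n0. (\<Sum>k<n. real (close_pairs p k)) \<le>
      real n * (real (card (cells p)))\<^sup>2 * ((Cd + Co) * (R ^ p) powr (\<tau> + \<tau>'))" if p: "1 \<le> p" for p
  proof -
    let ?\<delta> = "R ^ p" and ?q = "level p 1"
    let ?U = "U.codes p" and ?V = "V.codes (level p 1)"
    have \<delta>: "0 < ?\<delta>" using U.R by simp
    obtain n0 where n0: "\<forall>n\<ge>n0. \<forall>x y. y \<noteq> 0 \<longrightarrow> \<bar>y\<bar> \<le> b \<longrightarrow>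
      real (card {k. k < n \<and> \<bar>x - slope p k * y\<bar> \<le> \<kappa> * ?\<delta>}) \<le> real n * (16 * \<kappa> / \<beta> * ?\<delta> / \<bar>y\<bar>)"
      using visits_le[OF p] .
    have "(\<Sum>k<n. real (close_pairs p k)) \<le>
        real n * (real (card (cells p)))\<^sup>2 * ((Cd + Co) * ?\<delta> powr (\<tau> + \<tau>'))" if n: "n0 \<le> n" for n
    proof -
      define vis where "vis c c' = real (card {k. k < n \<and> \<bar>shadow p k c - shadow p k c'\<bar> \<le> \<kappa> * ?\<delta>})" for c c'
      have diff: "shadow p k (w, v) - shadow p k (w', v') = (U.point w - U.point w') - slope p k * (V.point v - V.point v')"
        for k w v w' v' by (simp add: shadow_def algebra_simps)
      have vis_le_n: "vis c c' \<le> real n" for c c'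
      proof -
        have "card {k. k < n \<and> \<bar>shadow p k c - shadow p k c'\<bar> \<le> \<kappa> * ?\<delta>} \<le> card {..<n}" by (rule card_mono) auto
        then show ?thesis by (simp add: vis_def)
      qed
      have vis_0: "vis (w, v) (w', v') = 0"
        if "\<not> \<bar>U.point w - U.point w'\<bar> \<le> \<Lambda> * \<bar>V.point v - V.point v'\<bar> + \<kappa> * ?\<delta>" for w v w' v'
      proof -
        have "\<not> \<bar>shadow p k (w, v) - shadow p k (w', v')\<bar> \<le> \<kappa> * ?\<delta>" for k
        proof -
          have "\<bar>slope p k * (V.point v - V.point v')\<bar> \<le> \<Lambda> * \<bar>V.point v - V.point v'\<bar>"
            unfolding abs_mult using slope_bounds[of p k] by (intro mult_right_mono) auto
          then show ?thesis unfolding diff using that by linarith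
        qed
        then show ?thesis by (simp add: vis_def)
      qed
      have column: "(\<Sum>w'\<in>?U. vis (w, v) (w', v')) \<le> B * (real (card E) ^ p * (C1 * D powr \<tau>))"
        if w: "w \<in> ?U" and B: "\<And>w'. vis (w, v) (w', v') \<le> B"
          and D: "\<Lambda> * \<bar>V.point v - V.point v'\<bar> + \<kappa> * ?\<delta> \<le> D" "?\<delta> \<le> D" for w v v' B D
      proof -
        have "0 \<le> vis (w, v) (w, v')" by (simp add: vis_def)
        then have B0: "0 \<le> B" using B[of w] by linarith
        have D0: "0 \<le> D" using D(2) \<delta> by linarith
        let ?N = "{w' \<in> ?U. \<bar>U.point w - U.point w'\<bar> \<le> D}"
        have "(\<Sum>w'\<in>?U. vis (w, v) (w', v')) = (\<Sum>w'\<in>?N. vis (w, v) (w', v'))"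
        proof (rule sum.mono_neutral_right)
          show "\<forall>w'\<in>?U - ?N. vis (w, v) (w', v') = 0"
          proof
            fix w' assume "w' \<in> ?U - ?N"
            then have "D < \<bar>U.point w - U.point w'\<bar>" by auto
            then show "vis (w, v) (w', v') = 0" using D(1) by (intro vis_0) linarith
          qed
        qed (use U.finite_codes in auto)
        also have "\<dots> \<le> (\<Sum>w'\<in>?N. B)" by (intro sum_mono B)
        also have "\<dots> = B * real (card ?N)" by simp
        also have "\<dots> \<le> B * (real (card E) ^ p * (C1 * (max D ?\<delta>) powr \<tau>))"
          unfolding C1_def by (intro mult_left_mono U.card_close_codes_le \<tau> card_E w D0 B0)
        also have "max D ?\<delta> = D" using D(2) by simp
        finally show ?thesis .
      qed
      have row: "(\<Sum>c'\<in>cells p. vis c c') \<le> real n * real (card (cells p)) * ((Cd + Co) * ?\<delta> powr (\<tau> + \<tau>'))"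
        if c: "c \<in> cells p" for c
      proof -
        obtain w v where wv: "c = (w, v)" "w \<in> ?U" "v \<in> ?V" using c by (auto simp: cells_def)
        have "(\<Sum>c'\<in>cells p. vis c c') = (\<Sum>v'\<in>?V. \<Sum>w'\<in>?U. vis (w, v) (w', v'))"
          unfolding cells_def wv(1) by (subst sum.swap) (simp add: sum.cartesian_product case_prod_beta)
        also have "\<dots> = (\<Sum>w'\<in>?U. vis (w, v) (w', v)) + (\<Sum>v'\<in>?V - {v}. \<Sum>w'\<in>?U. vis (w, v) (w', v'))"
          using wv(3) V.finite_codes by (rule sum.remove[rotated])
        also have "(\<Sum>w'\<in>?U. vis (w, v) (w', v)) \<le> real n * (real (card E) ^ p * (C1 * (\<kappa> * ?\<delta>) powr \<tau>))"
        proof (rule column[OF wv(2) vis_le_n])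
          show "?\<delta> \<le> \<kappa> * ?\<delta>" using \<kappa> \<delta> by simp
        qed simp
        also have "\<dots> \<le> real n * real (card (cells p)) * (Cd * ?\<delta> powr (\<tau> + \<tau>'))"
        proof -
          have "1 \<le> (real (card E') * R' powr \<tau>') ^ ?q" using card_E' by (rule one_le_power)
          also have "\<dots> = real (card E') ^ ?q * (R' ^ ?q) powr \<tau>'"
            using V.R by (simp add: power_mult_distrib powr_powr mult.commute flip: powr_realpow)
          also have "\<dots> \<le> real (card E') ^ ?q * (?\<delta> / R') powr \<tau>'"
            using scales_comparable(2)[of p] V.R \<tau> by (intro mult_left_mono powr_mono2) (auto simp: field_simps)
          also have "(?\<delta> / R') powr \<tau>' = ?\<delta> powr \<tau>' * R' powr (-\<tau>')"
            using V.R \<delta> by (simp add: powr_divide powr_minus field_simps)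
          finally have one: "1 \<le> real (card E') ^ ?q * (?\<delta> powr \<tau>' * R' powr (-\<tau>'))" .
          have "real n * (real (card E) ^ p * (C1 * (\<kappa> * ?\<delta>) powr \<tau>)) * 1 \<le>
            real n * (real (card E) ^ p * (C1 * (\<kappa> * ?\<delta>) powr \<tau>)) * (real (card E') ^ ?q * (?\<delta> powr \<tau>' * R' powr (-\<tau>')))"
            using one pos by (intro mult_left_mono) auto
          also have "\<dots> = real n * real (card (cells p)) * (Cd * ?\<delta> powr (\<tau> + \<tau>'))"
            using \<kappa> \<delta> by (simp add: Cd_def card_cells powr_mult powr_add mult_ac)
          finally show ?thesis by simp
        qed
        also have "(\<Sum>v'\<in>?V - {v}. \<Sum>w'\<in>?U. vis (w, v) (w', v')) \<le>
            (\<Sum>v'\<in>?V - {v}. real n * (real (card E) ^ p * (C1 * C5 powr \<tau> * (C4 * ?\<delta>))) * \<bar>V.point v - V.point v'\<bar> powr (\<tau> - 1))"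
        proof (rule sum_mono)
          fix v' assume v': "v' \<in> ?V - {v}"
          let ?y = "\<bar>V.point v - V.point v'\<bar>"
          have "g' * ?\<delta> \<le> g' * R' ^ ?q" using scales_comparable(1)[of p] V.g by (intro mult_left_mono) auto
          also have "\<dots> \<le> ?y" using wv(3) v' by (intro V.distinct_points) auto
          finally have y: "g' * ?\<delta> \<le> ?y" .
          have y0: "0 < ?y" using y V.g \<delta> by (meson less_le_trans mult_pos_pos)
          have yb: "?y \<le> b"
          proof -
            have "V.point v \<in> {0..b}" "V.point v' \<in> {0..b}"
              using V.point_in[OF wv(3)] V.point_in[of v' ?q] v' K'_sub by auto
            then show ?thesis by auto
          qed
          have "\<kappa> * ?\<delta> \<le> \<kappa> / g' * ?y"
          proof -
            have "\<kappa> / g' * (g' * ?\<delta>) \<le> \<kappa> / g' * ?y" using y \<kappa> V.g by (intro mult_left_mono) auto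
            then show ?thesis using V.g by simp
          qed
          then have D1: "\<Lambda> * ?y + \<kappa> * ?\<delta> \<le> C5 * ?y" by (simp add: C5_def distrib_right)
          have "?\<delta> \<le> \<kappa> * ?\<delta>" using \<kappa> \<delta> by simp
          moreover have "0 \<le> \<Lambda> * ?y" using \<Lambda> by simp
          ultimately have D2: "?\<delta> \<le> C5 * ?y" using D1 by linarith
          have "(\<Sum>w'\<in>?U. vis (w, v) (w', v')) \<le> (real n * (C4 * ?\<delta> / ?y)) * (real (card E) ^ p * (C1 * (C5 * ?y) powr \<tau>))"
          proof (rule column[OF wv(2) _ D1 D2])
            fix w'
            show "vis (w, v) (w', v') \<le> real n * (C4 * ?\<delta> / ?y)"
              unfolding vis_def diff C4_def using n0 n y0 yb by auto
          qed
          also have "\<dots> = real n * (real (card E) ^ p * (C1 * C5 powr \<tau> * (C4 * ?\<delta>))) * (?y powr \<tau> / ?y)"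
            using pos y0 by (simp add: powr_mult)
          also have "?y powr \<tau> / ?y = ?y powr (\<tau> - 1)" using y0 by (simp add: powr_diff)
          finally show "(\<Sum>w'\<in>?U. vis (w, v) (w', v')) \<le>
            real n * (real (card E) ^ p * (C1 * C5 powr \<tau> * (C4 * ?\<delta>))) * ?y powr (\<tau> - 1)" .
        qed
        also have "\<dots> = real n * (real (card E) ^ p * (C1 * C5 powr \<tau> * (C4 * ?\<delta>))) *
            (\<Sum>v'\<in>?V - {v}. \<bar>V.point v - V.point v'\<bar> powr (\<tau> - 1))"
          by (simp add: sum_distrib_left)
        also have "\<dots> \<le> real n * (real (card E) ^ p * (C1 * C5 powr \<tau> * (C4 * ?\<delta>))) *
            (real (card E') ^ ?q * (C3 * ?\<delta> powr (\<tau> + \<tau>' - 1)))"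
          using C3(2) wv(3) pos \<delta> by (intro mult_left_mono) auto
        also have "\<dots> = real n * real (card (cells p)) * (Co * (?\<delta> * ?\<delta> powr (\<tau> + \<tau>' - 1)))"
          by (simp add: Co_def card_cells mult_ac)
        also have "?\<delta> * ?\<delta> powr (\<tau> + \<tau>' - 1) = ?\<delta> powr (\<tau> + \<tau>')"
          using \<delta> by (simp add: powr_diff)
        finally show ?thesis by (simp add: algebra_simps)
      qed
      have "(\<Sum>k<n. real (close_pairs p k)) = real (\<Sum>k<n. card {z \<in> cells p \<times> cells p. \<bar>shadow p k (fst z) - shadow p k (snd z)\<bar> \<le> \<kappa> * ?\<delta>})"
        unfolding close_pairs_def of_nat_sum by (intro sum.cong refl arg_cong[where f = "\<lambda>x. real (card x)"]) auto
      also have "\<dots> = real (\<Sum>z\<in>cells p \<times> cells p. card {k. k < n \<and> \<bar>shadow p k (fst z) - shadow p k (snd z)\<bar> \<le> \<kappa> * ?\<delta>})"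
        by (subst sum_card_swap) (auto simp: finite_cells)
      also have "\<dots> = (\<Sum>c\<in>cells p. \<Sum>c'\<in>cells p. vis c c')"
        by (simp add: vis_def sum.cartesian_product case_prod_beta)
      also have "\<dots> \<le> (\<Sum>c\<in>cells p. real n * real (card (cells p)) * ((Cd + Co) * ?\<delta> powr (\<tau> + \<tau>')))"
        by (intro sum_mono row)
      also have "\<dots> = real n * (real (card (cells p)))\<^sup>2 * ((Cd + Co) * ?\<delta> powr (\<tau> + \<tau>'))"
        by (simp add: power2_eq_square)
      finally show ?thesis .
    qed
    then show ?thesis by blast
  qed
  have "0 \<le> Cd + Co" using pos by simp
  then show ?thesis using that main by blast
qed

text \<open>
  In round \<open>k\<close> the set \<open>K - slope p k * K'\<close> contains separated copies of the set of the next round,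
  scaled by \<open>R\<^sup>p\<close>, at least \<open>(card (cells p))\<^sup>2 / close_pairs p k\<close> in number. For the exponent \<open>\<sigma>\<close> the
  weight may therefore grow by the factor \<open>close_pairs p k / T\<close> in this round, and the blow-up principle
  needs the products of these factors to be bounded. Since \<open>x \<le> exp (x - 1)\<close>, it is enough that their average
  is at most \<open>1\<close>, and this holds for large \<open>p\<close> because \<open>\<sigma> < \<tau> + \<tau>'\<close>.
\<close>
theorem difference_cover_bound:
  assumes \<sigma>: "0 \<le> \<sigma>" "\<sigma> < \<tau> + \<tau>'"
  obtains c where "0 < c" "\<forall>L. ball_cover (arith_difference K K') L \<longrightarrow> c \<le> cover_cost \<sigma> L"
proof -
  obtain C where C: "0 \<le> C" "\<forall>p\<ge>1. \<exists>n0. \<forall>n\<ge>n0.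
    (\<Sum>k<n. real (close_pairs p k)) \<le> real n * (real (card (cells p)))\<^sup>2 * (C * (R ^ p) powr (\<tau> + \<tau>'))"
    using average_close_pairs .
  obtain p where p: "1 \<le> p" "C * (R ^ p) powr (\<tau> + \<tau>' - \<sigma>) \<le> 1"
  proof -
    define y where "y = R powr (\<tau> + \<tau>' - \<sigma>)"
    have y: "0 < y" "y < 1" using U.R \<sigma> powr_less_mono2[of "\<tau> + \<tau>' - \<sigma>" R 1] by (auto simp: y_def)
    obtain n where n: "y ^ n < 1 / (C + 1)" using real_arch_pow_inv[of "1 / (C + 1)" y] y C by auto
    have "(R ^ m) powr (\<tau> + \<tau>' - \<sigma>) = y ^ m" for m
      using U.R by (induction m) (simp_all add: y_def powr_mult)
    then have "(R ^ Suc n) powr (\<tau> + \<tau>' - \<sigma>) = y ^ Suc n" .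
    also have "\<dots> \<le> y ^ n" using y by (simp add: mult_left_le_one_le)
    finally have "C * (R ^ Suc n) powr (\<tau> + \<tau>' - \<sigma>) \<le> C * (1 / (C + 1))"
      using n C by (intro mult_left_mono) auto
    also have "\<dots> \<le> 1" using C by (simp add: field_simps)
    finally show ?thesis using that[of "Suc n"] by simp
  qed
  let ?\<delta> = "R ^ p" and ?q = "level p 1"
  have \<delta>: "0 < ?\<delta>" "?\<delta> < 1" using U.R p(1) by (auto simp: power_less_one_iff)
  define T where "T = (real (card (cells p)))\<^sup>2 * ?\<delta> powr \<sigma>"
  have "0 < card (cells p)" unfolding card_cells using card_E_pos by simp
  then have T: "0 < T" unfolding T_def using U.R(1) by (intro mult_pos_pos) auto
  obtain n0 where n0: "\<forall>n\<ge>n0. (\<Sum>k<n. real (close_pairs p k)) \<le> real n * (real (card (cells p)))\<^sup>2 * (C * ?\<delta> powr (\<tau> + \<tau>'))"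
    using C(2) p(1) by blast
  define w where "w n = (\<Prod>k<n. real (close_pairs p k) / T)" for n
  have w_nonneg: "0 \<le> w n" for n using T by (auto simp: w_def intro!: prod_nonneg)
  have w_le_1: "w n \<le> 1" if n: "n0 \<le> n" for n
  proof -
    have "(\<Sum>k<n. real (close_pairs p k)) \<le> real n * (real (card (cells p)))\<^sup>2 * (C * ?\<delta> powr (\<tau> + \<tau>'))"
      using n0 n by blast
    also have "?\<delta> powr (\<tau> + \<tau>') = ?\<delta> powr (\<tau> + \<tau>' - \<sigma>) * ?\<delta> powr \<sigma>" by (simp flip: powr_add)
    also have "real n * (real (card (cells p)))\<^sup>2 * (C * (?\<delta> powr (\<tau> + \<tau>' - \<sigma>) * ?\<delta> powr \<sigma>)) =
      (real n * T) * (C * ?\<delta> powr (\<tau> + \<tau>' - \<sigma>))" by (simp add: T_def)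
    also have "\<dots> \<le> (real n * T) * 1" using p(2) T by (intro mult_left_mono) auto
    finally have "(\<Sum>k<n. real (close_pairs p k)) / T \<le> real n" using T by (simp add: field_simps)
    then have avg: "(\<Sum>k<n. real (close_pairs p k) / T) \<le> real n" by (simp add: sum_divide_distrib)
    have "w n \<le> (\<Prod>k<n. exp (real (close_pairs p k) / T - 1))"
      unfolding w_def
    proof (rule prod_mono, intro conjI)
      fix k
      show "0 \<le> real (close_pairs p k) / T" using T by simp
      show "real (close_pairs p k) / T \<le> exp (real (close_pairs p k) / T - 1)"
        using exp_ge_add_one_self[of "real (close_pairs p k) / T - 1"] by simp
    qed
    also have "\<dots> = exp ((\<Sum>k<n. real (close_pairs p k) / T) - real n)"
      by (simp add: exp_sum[symmetric] sum_subtractf)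
    also have "\<dots> \<le> 1" using avg by simp
    finally show ?thesis .
  qed
  \<comment> \<open>Before time \<open>n0\<close> nothing is known about the average, but only finitely many weights are involved.\<close>
  define W where "W = 1 + (\<Sum>n<n0. w n)"
  have W: "1 \<le> W" "w n \<le> W" for n
  proof -
    show "1 \<le> W" using w_nonneg by (simp add: W_def sum_nonneg)
    show "w n \<le> W"
    proof (cases "n < n0")
      case True
      have "w n \<le> (\<Sum>n<n0. w n)" using True w_nonneg by (intro member_le_sum) auto
      then show ?thesis by (simp add: W_def)
    qed (use w_le_1[of n] \<open>1 \<le> W\<close> in simp)
  qed
  \<comment> \<open>An upper bound for the length of a copy: \<open>\<kappa>/4\<close> exceeds the diameter of every \<open>K - slope * K'\<close>.\<close>
  define D where "D = \<kappa> / 4 * ?\<delta>"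
  have D: "0 < D" using \<kappa> \<delta> by (simp add: D_def)
  define A where "A k = scaled_difference (slope p k) K K'" for k
  have A_range: "- (\<Lambda> * b) \<le> z \<and> z \<le> a" if zA: "z \<in> A k" for z k
  proof -
    obtain x y where z: "z = x - slope p k * y" "x \<in> K" "y \<in> K'" using zA by (auto simp: A_def scaled_difference_def)
    have xy: "0 \<le> x" "x \<le> a" "0 \<le> y" "y \<le> b" using z K_sub K'_sub by auto
    have "slope p k * y \<le> \<Lambda> * b" using slope_bounds[of p k] xy \<Lambda> by (intro mult_mono) auto
    moreover have "0 \<le> slope p k * y" using slope_bounds[of p k] xy by auto
    ultimately show ?thesis using z xy by linarith
  qed
  have bound: "(D/2) powr \<sigma> \<le> W * cover_cost \<sigma> L" if L: "ball_cover (arith_difference K K') L" for L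
  proof -
    have "w 0 * (D/2) powr \<sigma> \<le> W * cover_cost \<sigma> L"
    proof (rule self_reproducing_cover_bound[where X = UNIV and A = A and w = w and x = 0 and \<kappa> = ?\<delta>])
      fix k :: nat
      show "A k \<noteq> {}" using U.x0 V.x0 by (auto simp: A_def scaled_difference_def)
      have twoD: "0 \<le> 2 * D" using D by simp
      obtain S where S: "S \<subseteq> cells p" "\<forall>c\<in>S. \<forall>c'\<in>S. c \<noteq> c' \<longrightarrow> 2 * D < \<bar>shadow p k c - shadow p k c'\<bar>"
        "\<forall>c\<in>cells p. \<exists>c'\<in>S. \<bar>shadow p k c - shadow p k c'\<bar> \<le> 2 * D"
        using separated_subset[where f = "shadow p k", OF finite_cells twoD] .
      have fin: "finite S" using S(1) finite_cells finite_subset by blast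
      have "(real (card (cells p)))\<^sup>2 \<le> real (card S) * real (card {(c, c'). c \<in> cells p \<and> c' \<in> cells p \<and> \<bar>shadow p k c - shadow p k c'\<bar> \<le> 2 * (2 * D)})"
        by (rule card_squared_le_separated_times_close_pairs[OF finite_cells S(1,3)])
      also have "2 * (2 * D) = \<kappa> * ?\<delta>" by (simp add: D_def)
      finally have many: "(real (card (cells p)))\<^sup>2 \<le> real (card S) * real (close_pairs p k)"
        by (simp add: close_pairs_def)
      obtain e0 where e0: "e0 \<in> E'" using card_E_pos(2) by (metis card.empty all_not_in_conv less_irrefl)
      \<comment> \<open>In some rounds the second system has to read one digit more than \<open>?q\<close>; the fixed digit \<open>e0\<close> is used then.\<close>
      define ext where "ext = (level p (Suc k) \<noteq> level p k + ?q)"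
      define ex where "ex y = (if ext then R' * y + e0 else y)" for y
      define e where "e c = shadow p k c - ?\<delta> * x0 - slope p k * R' ^ ?q * (ex 0 - y0)" for c
      have point_eq: "?\<delta> * (x - slope p (Suc k) * y) + e (u, v) =
          (?\<delta> * (x - x0) + U.point u) - slope p k * (R' ^ ?q * (ex y - y0) + V.point v)" for x y u v
      proof -
        have "slope p k * (R' ^ ?q * (ex y - ex 0)) = slope p (Suc k) * ?\<delta> * y"
        proof (cases ext)
          case True
          then have "level p (Suc k) - level p k = Suc ?q" using level_Suc[of p k] by (auto simp: ext_def)
          then have "slope p k * (R' * R' ^ ?q) = slope p (Suc k) * ?\<delta>" using slope_Suc[of p k] by simp
          then show ?thesis using True by (simp add: ex_def algebra_simps)
        next
          case False
          then have "level p (Suc k) - level p k = ?q" by (simp add: ext_def)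
          then have "slope p k * R' ^ ?q = slope p (Suc k) * ?\<delta>" using slope_Suc[of p k] by simp
          then show ?thesis using False by (simp add: ex_def algebra_simps)
        qed
        then show ?thesis by (simp add: e_def shadow_def algebra_simps)
      qed
      show "\<exists>(I::(real list \<times> real list) set) c e y. finite I \<and>
        (\<forall>i\<in>I. y i \<in> UNIV \<and> 0 < \<bar>c i\<bar> \<and> \<bar>c i\<bar> \<le> ?\<delta> \<and> (\<lambda>z. c i * z + e i) ` A (y i) \<subseteq> A k) \<and>
        (\<forall>i\<in>I. \<forall>j\<in>I. i \<noteq> j \<longrightarrow> (\<forall>z\<in>A (y i). \<forall>z'\<in>A (y j). D \<le> \<bar>(c i * z + e i) - (c j * z' + e j)\<bar>)) \<and>
        w k \<le> (\<Sum>i\<in>I. \<bar>c i\<bar> powr \<sigma> * w (y i))"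
      proof (intro exI conjI)
        show "finite S" by (rule fin)
        show "\<forall>c\<in>S. Suc k \<in> UNIV \<and> 0 < \<bar>?\<delta>\<bar> \<and> \<bar>?\<delta>\<bar> \<le> ?\<delta> \<and> (\<lambda>z. ?\<delta> * z + e c) ` A (Suc k) \<subseteq> A k"
        proof (intro ballI conjI)
          fix c assume c: "c \<in> S"
          obtain u v where uv: "c = (u, v)" "u \<in> U.codes p" "v \<in> V.codes ?q" using c S(1) by (auto simp: cells_def)
          show "(\<lambda>z. ?\<delta> * z + e c) ` A (Suc k) \<subseteq> A k"
          proof
            fix z assume "z \<in> (\<lambda>z. ?\<delta> * z + e c) ` A (Suc k)"
            then obtain x y where z: "z = ?\<delta> * (x - slope p (Suc k) * y) + e (u, v)" "x \<in> K" "y \<in> K'"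
              by (auto simp: A_def scaled_difference_def uv)
            have "ex y \<in> K'" using V.step[OF e0 z(3)] z(3) by (simp add: ex_def)
            then have "?\<delta> * (x - x0) + U.point u \<in> K" "R' ^ ?q * (ex y - y0) + V.point v \<in> K'"
              using U.cylinder_subset[OF z(2) uv(2)] V.cylinder_subset[OF _ uv(3)] by auto
            then show "z \<in> A k" unfolding z(1) point_eq by (auto simp: A_def scaled_difference_def)
          qed
        qed (use \<delta> in auto)
        show "\<forall>c\<in>S. \<forall>c'\<in>S. c \<noteq> c' \<longrightarrow> (\<forall>z\<in>A (Suc k). \<forall>z'\<in>A (Suc k). D \<le> \<bar>(?\<delta> * z + e c) - (?\<delta> * z' + e c')\<bar>)"
        proof (intro ballI impI)
          fix c c' z z' assume c: "c \<in> S" "c' \<in> S" "c \<noteq> c'" and z: "z \<in> A (Suc k)" "z' \<in> A (Suc k)"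
          have "\<kappa> / 4 = a + \<Lambda> * b + 1" by (simp add: \<kappa>_def)
          then have "\<bar>z - z'\<bar> \<le> \<kappa> / 4" using A_range[OF z(1)] A_range[OF z(2)] by linarith
          then have "?\<delta> * \<bar>z - z'\<bar> \<le> ?\<delta> * (\<kappa> / 4)" using \<delta> by (intro mult_left_mono) auto
          then have "\<bar>?\<delta> * (z - z')\<bar> \<le> D" using \<delta> by (simp add: D_def abs_mult mult.commute)
          moreover have "2 * D < \<bar>shadow p k c - shadow p k c'\<bar>" using S(2) c by blast
          moreover have "(?\<delta> * z + e c) - (?\<delta> * z' + e c') = ?\<delta> * (z - z') + (shadow p k c - shadow p k c')"
            by (simp add: e_def algebra_simps)
          ultimately show "D \<le> \<bar>(?\<delta> * z + e c) - (?\<delta> * z' + e c')\<bar>" by linarith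
        qed
        have "w k * (real (card (cells p)))\<^sup>2 \<le> w k * (real (card S) * real (close_pairs p k))"
          using many w_nonneg by (intro mult_left_mono) auto
        also have "\<dots> = (real (card S) * (?\<delta> powr \<sigma> * w (Suc k))) * (real (card (cells p)))\<^sup>2"
        proof -
          let ?c = "real (close_pairs p k)" and ?N = "(real (card (cells p)))\<^sup>2"
          have wS: "w (Suc k) = w k * (?c / T)" by (simp add: w_def)
          have "?\<delta> powr \<sigma> * (w k * (?c / T)) * ?N = w k * ?c * (?N * ?\<delta> powr \<sigma>) / T" by simp
          also have "\<dots> = w k * ?c" unfolding T_def[symmetric] using T by simp
          finally have E: "?\<delta> powr \<sigma> * (w k * (?c / T)) * ?N = w k * ?c" .
          have "w k * (real (card S) * ?c) = real (card S) * (w k * ?c)" by simp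
          also have "\<dots> = real (card S) * (?\<delta> powr \<sigma> * (w k * (?c / T)) * ?N)" by (simp only: E)
          also have "\<dots> = (real (card S) * (?\<delta> powr \<sigma> * w (Suc k))) * ?N" by (simp only: wS mult.assoc)
          finally show ?thesis .
        qed
        finally have "w k \<le> real (card S) * (?\<delta> powr \<sigma> * w (Suc k))"
          by (rule mult_right_le_imp_le) (use card_E_pos in \<open>simp add: card_cells\<close>)
        then show "w k \<le> (\<Sum>c\<in>S. \<bar>?\<delta>\<bar> powr \<sigma> * w (Suc k))" using \<delta> by simp
      qed
    qed (use D \<delta> W w_nonneg \<sigma> L in \<open>auto simp: A_def slope_0\<close>)
    then show ?thesis by (simp add: w_def)
  qed
  show ?thesis
  proof (rule that[of "(D/2) powr \<sigma> / W"])
    show "0 < (D/2) powr \<sigma> / W" using D W(1) by simp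
    show "\<forall>L. ball_cover (arith_difference K K') L \<longrightarrow> (D/2) powr \<sigma> / W \<le> cover_cost \<sigma> L"
      using bound W(1) by (auto simp: field_simps)
  qed
qed

end

context affine_cantor_pair begin

text \<open>
  Homogeneous subsystems of dimensions slightly below \<open>\<sigma>\<^sub>1\<close> and \<open>\<sigma>\<^sub>2\<close> are available, each with a
  second ratio that differs by \<open>(r i)\<^sup>2\<close> or \<open>(r' j)\<^sup>2\<close>. If the logarithms of all combinations were
  commensurable, so would be \<open>ln \<bar>r i\<bar>\<close> and \<open>ln \<bar>r' j\<bar>\<close>. Both dimensions are shrunk by a common
  factor \<open>\<rho>\<close> to bring their sum below \<open>1\<close> while keeping it above \<open>\<sigma>\<close>.
\<close>
theorem hausdorff_dim_difference_ge:
  assumes irr: "i \<in> {1..M}" "j \<in> {1..N}" "ln \<bar>r i\<bar> / ln \<bar>r' j\<bar> \<notin> \<rat>"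
  shows "min 1 (\<sigma>\<^sub>1 + \<sigma>\<^sub>2) \<le> hausdorff_dim \<Delta>"
proof (rule dense_le)
  fix \<sigma> assume \<sigma>: "\<sigma> < min 1 (\<sigma>\<^sub>1 + \<sigma>\<^sub>2)"
  show "\<sigma> \<le> hausdorff_dim \<Delta>"
  proof (cases "\<sigma> < 0")
    case True
    then show ?thesis using hausdorff_dim_nonneg[OF compact_\<Delta> \<Delta>_ne] by simp
  next
    case False
    have pos: "0 < \<sigma>\<^sub>1" "0 < \<sigma>\<^sub>2" using A.similarity_dim B.similarity_dim by auto
    define m where "m = (\<sigma> + min 1 (\<sigma>\<^sub>1 + \<sigma>\<^sub>2)) / 2"
    have m: "\<sigma> < m" "m < 1" "m < \<sigma>\<^sub>1 + \<sigma>\<^sub>2" "0 < m" using \<sigma> False pos by (auto simp: m_def)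
    define \<rho> where "\<rho> = m / (\<sigma>\<^sub>1 + \<sigma>\<^sub>2)"
    have "\<rho> * (\<sigma>\<^sub>1 + \<sigma>\<^sub>2) = m" using pos by (simp add: \<rho>_def)
    then have \<rho>: "0 < \<rho>" "\<rho> < 1" "\<rho> * \<sigma>\<^sub>1 + \<rho> * \<sigma>\<^sub>2 = m"
      using m pos by (simp_all only: distrib_left) (simp_all add: \<rho>_def)
    have "0 \<le> \<rho> * \<sigma>\<^sub>1" "\<rho> * \<sigma>\<^sub>1 < \<sigma>\<^sub>1" "0 \<le> \<rho> * \<sigma>\<^sub>2" "\<rho> * \<sigma>\<^sub>2 < \<sigma>\<^sub>2" using \<rho> pos by auto
    note \<tau> = this
    obtain R1 where R1: "homogeneous_ratio K (\<rho> * \<sigma>\<^sub>1) R1" "homogeneous_ratio K (\<rho> * \<sigma>\<^sub>1) (R1 * (r i)\<^sup>2)"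
      using A.homogeneous_ratio_exists[OF \<tau>(1,2) irr(1)] .
    obtain R2 where R2: "homogeneous_ratio K' (\<rho> * \<sigma>\<^sub>2) R2" "homogeneous_ratio K' (\<rho> * \<sigma>\<^sub>2) (R2 * (r' j)\<^sup>2)"
      using B.homogeneous_ratio_exists[OF \<tau>(3,4) irr(2)] .
    obtain P Q where PQ: "homogeneous_ratio K (\<rho> * \<sigma>\<^sub>1) P" "homogeneous_ratio K' (\<rho> * \<sigma>\<^sub>2) Q" "ln P / ln Q \<notin> \<rat>"
    proof (rule ccontr)
      note witness = that
      assume no: "\<not> thesis"
      have all: "ln P / ln Q \<in> \<rat>"
        if "homogeneous_ratio K (\<rho> * \<sigma>\<^sub>1) P" "homogeneous_ratio K' (\<rho> * \<sigma>\<^sub>2) Q" for P Q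
        using no witness[OF that] by blast
      have bnd: "0 < R1" "R1 < 1" "0 < R2" "R2 < 1" "R2 * (r' j)\<^sup>2 < 1"
        using R1(1) R2 unfolding homogeneous_ratio_def by auto
      have rr: "0 < \<bar>r i\<bar>" "\<bar>r i\<bar> < 1" "0 < \<bar>r' j\<bar>" "\<bar>r' j\<bar> < 1"
        using A.r_bounds[OF irr(1)] B.r_bounds[OF irr(2)] by auto
      have ln1: "ln (R1 * (r i)\<^sup>2) = ln R1 + 2 * ln \<bar>r i\<bar>"
      proof -
        have "R1 * (r i)\<^sup>2 = R1 * (\<bar>r i\<bar> * \<bar>r i\<bar>)" by (simp add: power2_eq_square)
        then show ?thesis using bnd rr by (simp only: ln_mult_pos mult_pos_pos)
      qed
      have ln2: "ln (R2 * (r' j)\<^sup>2) = ln R2 + 2 * ln \<bar>r' j\<bar>"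
      proof -
        have "R2 * (r' j)\<^sup>2 = R2 * (\<bar>r' j\<bar> * \<bar>r' j\<bar>)" by (simp add: power2_eq_square)
        then show ?thesis using bnd rr by (simp only: ln_mult_pos mult_pos_pos)
      qed
      let ?A = "ln R1" and ?B = "ln R2" and ?a = "2 * ln \<bar>r i\<bar>" and ?b = "2 * ln \<bar>r' j\<bar>"
      have neg: "?A < 0" "?B < 0" "?a < 0" "?b < 0" using bnd rr by auto
      have q: "?A / ?B \<in> \<rat>" "(?A + ?a) / ?B \<in> \<rat>" "?A / (?B + ?b) \<in> \<rat>"
        using all[OF R1(1) R2(1)] all[OF R1(2) R2(1)] all[OF R1(1) R2(2)] ln1 ln2 by simp_all
      have "?a / ?B = (?A + ?a) / ?B - ?A / ?B" by (simp add: add_divide_distrib)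
      then have aB: "?a / ?B \<in> \<rat>" using Rats_diff[OF q(2,1)] by simp
      have "?b / ?B = (?A / ?B) / (?A / (?B + ?b)) - 1" using neg by (simp add: field_simps)
      then have bB: "?b / ?B \<in> \<rat>" using Rats_diff[OF Rats_divide[OF q(1,3)] Rats_1] by simp
      have "ln \<bar>r i\<bar> / ln \<bar>r' j\<bar> = (?a / ?B) / (?b / ?B)" using neg by simp
      then show False using Rats_divide[OF aB bB] irr(3) by simp
    qed
    obtain E g where Eg: "0 < P" "P < 1" "finite E" "0 < g" "\<forall>b\<in>E. \<forall>x\<in>K. P * x + b \<in> K"
      "\<forall>b\<in>E. \<forall>b'\<in>E. \<forall>x\<in>K. \<forall>y\<in>K. b \<noteq> b' \<longrightarrow> g \<le> \<bar>(P * x + b) - (P * y + b')\<bar>"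
      "1 \<le> real (card E) * P powr (\<rho> * \<sigma>\<^sub>1)"
      using PQ(1) unfolding homogeneous_ratio_def by blast
    obtain E' g' where Eg': "0 < Q" "Q < 1" "finite E'" "0 < g'" "\<forall>b\<in>E'. \<forall>x\<in>K'. Q * x + b \<in> K'"
      "\<forall>b\<in>E'. \<forall>b'\<in>E'. \<forall>x\<in>K'. \<forall>y\<in>K'. b \<noteq> b' \<longrightarrow> g' \<le> \<bar>(Q * x + b) - (Q * y + b')\<bar>"
      "1 \<le> real (card E') * Q powr (\<rho> * \<sigma>\<^sub>2)"
      using PQ(2) unfolding homogeneous_ratio_def by blast
    obtain x0 y0 where x0: "x0 \<in> K" "y0 \<in> K'" using A.K_ne B.K_ne by blast
    interpret P: homogeneous_pair K P E g x0 K' Q E' g' y0 a b "\<rho> * \<sigma>\<^sub>1" "\<rho> * \<sigma>\<^sub>2"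
    proof unfold_locales
      show "\<rho> * \<sigma>\<^sub>1 + \<rho> * \<sigma>\<^sub>2 < 1" using \<rho> m by simp
    qed (use Eg Eg' x0 A.K_sub B.K_sub A.a_pos B.a_pos \<tau> PQ in auto)
    obtain c where c: "0 < c" "\<forall>L. ball_cover \<Delta> L \<longrightarrow> c \<le> cover_cost \<sigma> L"
      using P.difference_cover_bound[of \<sigma>] False \<rho> m by (metis not_less)
    then show ?thesis using False by (intro hausdorff_dim_ge[OF compact_\<Delta>, of _ c]) auto
  qed
qed

lemma net_bounded_difference_min: "net_bounded (min 1 (\<sigma>\<^sub>1 + \<sigma>\<^sub>2)) \<Delta>"
  using net_bounded_one[OF bounded_difference[of 1]] net_bounded_difference[OF A.net_bounded_K B.net_bounded_K]
  by (auto simp: min_def)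

lemma hausdorff_dim_difference:
  assumes irr: "i \<in> {1..M}" "j \<in> {1..N}" "ln \<bar>r i\<bar> / ln \<bar>r' j\<bar> \<notin> \<rat>"
  shows "hausdorff_dim \<Delta> = min 1 (\<sigma>\<^sub>1 + \<sigma>\<^sub>2)"
proof (rule order_antisym)
  show "hausdorff_dim \<Delta> \<le> min 1 (\<sigma>\<^sub>1 + \<sigma>\<^sub>2)"
    using A.similarity_dim(1) B.similarity_dim(1) by (intro hausdorff_dim_le net_bounded_difference_min) simp
qed (rule hausdorff_dim_difference_ge[OF irr])

text \<open>
  In the incommensurable case the dimension has its largest conceivable value, for which products of
  nets of \<open>K\<close> and \<open>K'\<close>, or equidistant points, give the bound. In the commensurable case the value of
  the dimension is unknown, but \<open>\<Delta>\<close> contains copies of itself everywhere.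
\<close>
theorem net_bounded_difference_hausdorff_dim: "net_bounded (hausdorff_dim \<Delta>) \<Delta>"
proof (cases "\<exists>i\<in>{1..M}. \<exists>j\<in>{1..N}. ln \<bar>r i\<bar> / ln \<bar>r' j\<bar> \<notin> \<rat>")
  case True
  then show ?thesis using hausdorff_dim_difference net_bounded_difference_min by auto
next
  case False
  then show ?thesis by (intro net_bounded_difference_commensurable) blast
qed

end

section \<open>Dimension and measure of the difference set\<close>

theorem theorem1:
  fixes M N :: nat and r t r' t' :: "nat \<Rightarrow> real" and a b :: real and K K' :: "real set"
  assumes "affine_cantor_set M r t a K"
    and "affine_cantor_set N r' t' b K'"
  shows "let s = hausdorff_dim (arith_difference K K') in
    (has_box_dim (arith_difference K K') s \<and>
     hausdorff_measure s (arith_difference K K') < \<infinity>) \<and>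
    (hausdorff_dim K + hausdorff_dim K' \<le> 1 \<and>
     (\<forall>i\<in>{1..M}. 0 < r i) \<and> (\<forall>j\<in>{1..N}. 0 < r' j) \<and>
     (\<exists>i\<in>{1..M}. \<exists>j\<in>{1..N}. ln (r i) / ln (r' j) \<notin> \<rat>)
     \<longrightarrow> (\<exists>D :: real set. closure D = UNIV \<and>
            (\<forall>c\<in>D. hausdorff_measure s (scaled_difference c K K') = 0)))"
  unfolding Let_def
proof (intro conjI impI)
  interpret affine_cantor_pair M r t a K N r' t' b K'
    using assms by (intro affine_cantor_pair.intro affine_cantor.intro)
  show "has_box_dim \<Delta> (hausdorff_dim \<Delta>)"
    by (rule has_box_dim_hausdorff_dim[OF compact_\<Delta> \<Delta>_ne net_bounded_difference_hausdorff_dim])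
  show "hausdorff_measure (hausdorff_dim \<Delta>) \<Delta> < \<infinity>"
    by (rule hausdorff_measure_finite[OF net_bounded_difference_hausdorff_dim])
  assume h: "hausdorff_dim K + hausdorff_dim K' \<le> 1 \<and>
     (\<forall>i\<in>{1..M}. 0 < r i) \<and> (\<forall>j\<in>{1..N}. 0 < r' j) \<and>
     (\<exists>i\<in>{1..M}. \<exists>j\<in>{1..N}. ln (r i) / ln (r' j) \<notin> \<rat>)"
  then obtain i j where ij: "i \<in> {1..M}" "j \<in> {1..N}" "ln (r i) / ln (r' j) \<notin> \<rat>" by blast
  have pos: "\<And>i. i \<in> {1..M} \<Longrightarrow> 0 < r i" "\<And>j. j \<in> {1..N} \<Longrightarrow> 0 < r' j" using h by auto
  have "ln \<bar>r i\<bar> / ln \<bar>r' j\<bar> \<notin> \<rat>" using ij(3) pos(1)[OF ij(1)] pos(2)[OF ij(2)] by simp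
  moreover have "\<sigma>\<^sub>1 + \<sigma>\<^sub>2 \<le> 1"
    using h A.similarity_dim_le_hausdorff_dim B.similarity_dim_le_hausdorff_dim by linarith
  ultimately have s: "hausdorff_dim \<Delta> = \<sigma>\<^sub>1 + \<sigma>\<^sub>2"
    using hausdorff_dim_difference[OF ij(1,2)] by simp
  show "\<exists>D :: real set. closure D = UNIV \<and>
      (\<forall>c\<in>D. hausdorff_measure (hausdorff_dim \<Delta>) (scaled_difference c K K') = 0)"
  proof (intro exI conjI ballI)
    show "closure (- {0::real}) = UNIV" by (simp add: closure_complement)
    fix c :: real assume "c \<in> - {0}"
    then have "ball_content (\<sigma>\<^sub>1 + \<sigma>\<^sub>2) (scaled_difference c K K') = 0"
      by (intro content_difference_eq_0[OF _ pos ij]) auto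
    then show "hausdorff_measure (hausdorff_dim \<Delta>) (scaled_difference c K K') = 0"
      unfolding s using A.similarity_dim(1) B.similarity_dim(1)
      by (intro hausdorff_measure_eq_0_of_content bounded_difference) auto
  qed
qed

end
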